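(* Let $\sigma>0$, let $(X_{ij})_{i,j\ge 1}$ be i.i.d. complex random variables with $\mathbb{E}X_{ij}=0$ and $\mathbb{E}|X_{ij}|^2=1$, and let $(A_N)_{N\ge1}$ be deterministic matrices, $A_N\in M_N(\mathbb{C})$, such that: there is $M>0$ with $\|A_N\|\le M$ for all $N$; and for every $z\in\mathbb{C}$ the measure $\mu_{(A_N-zI_N)(A_N-zI_N)^*}$ converges weakly, as $N\to\infty$, to a probability measure $\nu_z$. Let $\beta$ and $\mu_z$ be the limit measures described in the context and suppose that $\mathrm{supp}(\beta)=\{z\in\mathbb{C}: 0\in\mathrm{supp}(\mu_z)\}$. Set $S=\{z\in\mathbb{C}: 0\in\mathrm{supp}(\nu_z)\}$. Then $$\mathrm{supp}(\beta)=\Big\{z\in\mathbb{C}:\ z\in S\ \text{ or }\ \int\lambda^{-1}\,d\nu_z(\lambda)\ge\sigma^{-2}\Big\}.$$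
   Context: $\|\cdot\|$ is the operator norm. For $A\in M_N(\mathbb{C})$ with eigenvalues $\lambda_1(A),\dots,\lambda_N(A)$ (with multiplicity), $\mu_A=\frac1N\sum_{i=1}^N\delta_{\lambda_i(A)}$. Put $X_N=(X_{ij})_{1\le i,j\le N}$, $Y_N=X_N/\sqrt N$, $M_N=A_N+\sigma Y_N$. It is known that, under the moment assumptions on $X_{ij}$, the boundedness of $\|A_N\|$ and the convergence to $\nu_z$, there are a deterministic probability measure $\beta$ on $\mathbb{C}$ and, for each $z\in\mathbb{C}$, a deterministic probability measure $\mu_z$ on $[0,\infty)$ such that almost surely $\mu_{M_N}\to\beta$ weakly and, for each $z$, almost surely $\mu_{(M_N-zI_N)(M_N-zI_N)^*}\to\mu_z$ weakly. These measures depend only on $\sigma$ and $(\nu_z)_{z\in\mathbb{C}}$. *)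

theory Defs
  imports "HOL-Probability.Probability" "Jordan_Normal_Form.Schur_Decomposition"
begin

definition mat_op_norm :: "complex mat \<Rightarrow> real" where
  "mat_op_norm A =
     (SUP v \<in> {v \<in> carrier_vec (dim_col A). L2_set (\<lambda>i. cmod (vec_index v i)) {..<dim_vec v} \<le> 1}.
        L2_set (\<lambda>i. cmod (vec_index (A *\<^sub>v v) i)) {..<dim_row A})"

text \<open>
  For an \<open>N \<times> N\<close> matrix with \<open>N \<ge> 1\<close>, the multiset of roots of the characteristic polynomial has
  size \<open>N\<close>, so the following is the measure giving mass \<open>1/N\<close> to each eigenvalue, counted with
  algebraic multiplicity. For \<open>N = 0\<close> it is unspecified.
\<close>

definition esd :: "complex mat \<Rightarrow> complex measure" where
  "esd A = distr (measure_pmf (pmf_of_multiset (proots (char_poly A)))) borel (\<lambda>z. z)"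

text \<open>
  Only applied to Hermitian matrices, whose eigenvalues are real: it is then the same measure,
  regarded as a measure on the real line.
\<close>

definition esd_real :: "complex mat \<Rightarrow> real measure" where
  "esd_real A = distr (esd A) borel Re"

definition shifted_gram :: "complex mat \<Rightarrow> complex \<Rightarrow> complex mat" where
  "shifted_gram A z =
     (A - z \<cdot>\<^sub>m 1\<^sub>m (dim_row A)) * mat_adjoint (A - z \<cdot>\<^sub>m 1\<^sub>m (dim_row A))"

text \<open>
  The array \<open>X\<close> is indexed from 0, so the matrix of size \<open>N\<close> uses the indices \<open>0, \<dots>, N - 1\<close>.
\<close>

definition array_mat :: "(nat \<Rightarrow> nat \<Rightarrow> 'w \<Rightarrow> complex) \<Rightarrow> nat \<Rightarrow> 'w \<Rightarrow> complex mat" where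
  "array_mat X N \<omega> = Matrix.mat N N (\<lambda>(i, j). X i j \<omega>)"

definition deformed_mat ::
    "(nat \<Rightarrow> complex mat) \<Rightarrow> real \<Rightarrow> (nat \<Rightarrow> nat \<Rightarrow> 'w \<Rightarrow> complex) \<Rightarrow> nat \<Rightarrow> 'w \<Rightarrow> complex mat" where
  "deformed_mat A \<sigma> X N \<omega> =
     A N + complex_of_real \<sigma> \<cdot>\<^sub>m (complex_of_real (1 / sqrt (real N)) \<cdot>\<^sub>m array_mat X N \<omega>)"

definition weakly_converges :: "(nat \<Rightarrow> 'a::topological_space measure) \<Rightarrow> 'a measure \<Rightarrow> bool" where
  "weakly_converges \<mu> \<nu> \<longleftrightarrow>
     (\<forall>f :: 'a \<Rightarrow> real. continuous_on UNIV f \<and> bounded (range f) \<longrightarrow>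
        (\<lambda>n. \<integral>x. f x \<partial>\<mu> n) \<longlonglongrightarrow> (\<integral>x. f x \<partial>\<nu>))"

text \<open>On the real line this is the library's notion, defined there through distribution functions.\<close>

lemma weakly_converges_iff_weak_conv_m:
  assumes "\<And>n. real_distribution (\<mu> n)" and "real_distribution \<nu>"
  shows "weakly_converges \<mu> \<nu> \<longleftrightarrow> weak_conv_m \<mu> \<nu>"
proof
  assume *: "weakly_converges \<mu> \<nu>"
  show "weak_conv_m \<mu> \<nu>"
  proof (rule integral_bdd_continuous_conv_imp_weak_conv[OF assms])
    fix f :: "real \<Rightarrow> real"
    assume "\<And>x. isCont f x" and "\<And>x. \<bar>f x\<bar> \<le> 1"
    then have "continuous_on UNIV f" "bounded (range f)"
      by (auto simp: continuous_on_eq_continuous_at bounded_iff intro!: exI[of _ 1])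
    then show "(\<lambda>n. integral\<^sup>L (\<mu> n) f) \<longlonglongrightarrow> integral\<^sup>L \<nu> f"
      using * by (auto simp: weakly_converges_def)
  qed
next
  assume *: "weak_conv_m \<mu> \<nu>"
  show "weakly_converges \<mu> \<nu>"
    unfolding weakly_converges_def
  proof safe
    fix f :: "real \<Rightarrow> real"
    assume f: "continuous_on UNIV f" "bounded (range f)"
    from f(2) obtain B where "\<And>x. norm (f x) \<le> B"
      by (auto simp: bounded_iff)
    with f(1) show "(\<lambda>n. integral\<^sup>L (\<mu> n) f) \<longlonglongrightarrow> integral\<^sup>L \<nu> f"
      by (intro weak_conv_imp_integral_bdd_continuous_conv[OF assms *, where B = B])
         (auto simp: continuous_on_eq_continuous_at)
  qed
qed

definition measure_support :: "'a::topological_space measure \<Rightarrow> 'a set" where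
  "measure_support \<mu> = {x. \<forall>U. open U \<and> x \<in> U \<longrightarrow> emeasure \<mu> U > 0}"

end

theory Submission
  imports Defs "HOL-Complex_Analysis.Complex_Analysis" "HOL-Real_Asymp.Real_Asymp"
begin

text \<open>
  Fix \<open>z\<close> and let \<open>f\<close>, \<open>g\<close> be the Stieltjes transforms \<open>t \<mapsto> \<integral> 1 / (x + t)\<close> of \<open>\<mu> z\<close>, \<open>\<nu> z\<close>.
  For \<open>t > 0\<close> they satisfy \<open>g (t (1 + \<sigma>\<^sup>2 f t)\<^sup>2) = f t / (1 + \<sigma>\<^sup>2 f t)\<close>. Indeed, with
  \<open>\<eta> = sqrt t\<close> and \<open>a = \<eta> (1 + \<sigma>\<^sup>2 f t)\<close>, let \<open>R\<close> be the resolvent at \<open>\<i> \<eta>\<close> of the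
  Hermitization of the random matrix, and \<open>D\<close> the resolvent at \<open>\<i> a\<close> of the Hermitization of its
  deterministic part. Expanding \<open>tr D - tr R\<close> by the resolvent identity and then expanding each
  term to second order in one entry of \<open>X\<close> shows that its normalised expectation tends to 0,
  provided that the normalised trace of \<open>R\<close> is asymptotically deterministic. The latter comes for
  free from the assumed almost sure convergence to a deterministic limit, so that no concentration
  inequality and no truncation is needed.

  A measure on \<open>[0, \<infinity>)\<close> has 0 outside its support iff its transform extends holomorphically
  across 0. By the inverse function theorem the equation above transports such an extension from
  \<open>f\<close> to \<open>g\<close>, and from \<open>g\<close> to \<open>f\<close> as long as \<open>\<sigma>\<^sup>2 g 0 < 1\<close>; moreover
  \<open>g 0 = f 0 / (1 + \<sigma>\<^sup>2 f 0) < 1 / \<sigma>\<^sup>2\<close> if \<open>f\<close> extends.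
\<close>

section \<open>Stieltjes transforms near the origin\<close>

text \<open>Why this \<open>a\<close>: in tr D - tr R the two shifts contribute \<i> (a - \<eta>) tr
  (R D), while the second-order terms in the entries add up, in expectation, to - \<i> \<sigma>^2
  \<eta> g tr (R D), where \<i> \<eta> g is the normalised trace of R. The trace of R D is never
  evaluated: with a - \<eta> = \<sigma>^2 \<eta> s and s the limit of g, it only occurs multiplied
  by s - g, which vanishes in mean. Two obstacles shape the expansion. With second moments only, a
  linear bound on the effect of one entry would lead to third moments, so this effect is bounded by
  a constant and by a linear term at once. Moreover the mean of X^2 is not prescribed, only that of
  |X|^2. Its contributions carry an off-diagonal entry of R, and the square-summability of the rows
  of R makes their total smaller than the diagonal one by a factor sqrt N. The equation is obtained
  on the real half-line t > 0 only; the identity theorem for holomorphic functions makes this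
  enough.\<close>

definition stieltjes :: "real measure \<Rightarrow> real \<Rightarrow> real" where
  "stieltjes m t = (\<integral>x. 1 / (x + t) \<partial>m)"

definition stieltjes_cx :: "real measure \<Rightarrow> complex \<Rightarrow> complex" where
  "stieltjes_cx m w = (\<integral>x. 1 / (of_real x + w) \<partial>m)"

text \<open>With y = x + t0 \<ge> \<rho> > |w|, the integrand 1 / (y + w) is a geometric series in w
  / y, dominated uniformly in x by the one of ratio |w| / \<rho>, so it may be integrated term by
  term. It is used with t0 > 0 for an arbitrary measure on [0, \<infinity>), and with t0 = 0 when
  the measure has a gap at 0.\<close>

lemma stieltjes_power_series:
  fixes m :: "real measure" and w :: complex
  assumes m: "finite_measure m" "sets m = sets borel"
    and \<rho>: "AE x in m. \<rho> \<le> x + t0" "norm w < \<rho>"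
  shows "(\<lambda>k. of_real ((-1) ^ k * (\<integral>x. 1 / (x + t0) ^ Suc k \<partial>m)) * w ^ k) sums
           stieltjes_cx m (of_real t0 + w)"
proof -
  interpret finite_measure m by (fact m)
  note [measurable_cong] = m(2)
  have \<rho>0: "\<rho> > 0" using \<rho>(2) norm_ge_zero[of w] by linarith
  define q where "q = norm w / \<rho>"
  have q: "0 \<le> q" "q < 1" using \<rho> \<rho>0 by (auto simp: q_def)
  define f where "f = (\<lambda>k x. of_real ((-1) ^ k / (x + t0) ^ Suc k) * w ^ k :: complex)"
  have f_bound: "AE x in m. \<forall>k. norm (f k x) \<le> q ^ k / \<rho>"
    using \<rho>(1)
  proof eventually_elim
    case (elim x)
    show ?case
    proof
      fix k
      have "norm (f k x) = \<bar>(-1) ^ k / (x + t0) ^ Suc k\<bar> * norm w ^ k"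
        by (simp only: f_def norm_mult norm_of_real norm_power)
      also have "\<dots> = norm w ^ k / (x + t0) ^ Suc k"
        using elim \<rho>0 by (simp add: abs_mult power_abs)
      also have "\<dots> \<le> norm w ^ k / \<rho> ^ Suc k"
        using elim \<rho>0 by (intro divide_left_mono power_mono mult_pos_pos zero_less_power) auto
      also have "\<dots> = q ^ k / \<rho>" by (simp add: q_def power_divide)
      finally show "norm (f k x) \<le> q ^ k / \<rho>" .
    qed
  qed
  have f_meas [measurable]: "f k \<in> borel_measurable m" for k
    unfolding f_def by measurable
  have int_f: "integrable m (f k)" for k
    by (rule integrable_const_bound[of _ "q ^ k / \<rho>"]) (use f_bound in auto)
  have summ: "summable (\<lambda>k. q ^ k / \<rho> * measure m (space m))"
    using q by (intro summable_mult2 summable_divide summable_geometric) auto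
  have "(\<lambda>k. integral\<^sup>L m (f k)) sums (\<integral>x. (\<Sum>k. f k x) \<partial>m)"
  proof (rule sums_integral[OF int_f])
    show "AE x in m. summable (\<lambda>k. norm (f k x))"
      using f_bound
    proof eventually_elim
      case (elim x)
      show ?case
        by (rule summable_comparison_test'[where g = "\<lambda>k. q ^ k / \<rho>" and N = 0])
           (use elim q in \<open>auto intro!: summable_divide summable_geometric\<close>)
    qed
    show "summable (\<lambda>k. \<integral>x. norm (f k x) \<partial>m)"
    proof (rule summable_comparison_test'[OF summ, where N = 0])
      fix k
      have "(\<integral>x. norm (f k x) \<partial>m) \<le> (\<integral>x. q ^ k / \<rho> \<partial>m)"
        by (rule integral_mono_AE) (use int_f f_bound in auto)
      then show "norm (\<integral>x. norm (f k x) \<partial>m) \<le> q ^ k / \<rho> * measure m (space m)"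
        by (simp add: mult.commute)
    qed
  qed
  moreover have "integral\<^sup>L m (f k) = of_real ((-1) ^ k * (\<integral>x. 1 / (x + t0) ^ Suc k \<partial>m)) * w ^ k" for k
  proof -
    have "integral\<^sup>L m (f k) = (\<integral>x. of_real ((-1) ^ k / (x + t0) ^ Suc k) \<partial>m) * w ^ k"
      unfolding f_def by (rule integral_mult_left_zero)
    also have "(\<integral>x. of_real ((-1) ^ k / (x + t0) ^ Suc k) \<partial>m) =
        complex_of_real (\<integral>x. (-1) ^ k * (1 / (x + t0) ^ Suc k) \<partial>m)"
      by (subst integral_complex_of_real) simp
    finally show ?thesis by (simp only: integral_mult_right_zero)
  qed
  moreover have "(\<integral>x. (\<Sum>k. f k x) \<partial>m) = (\<integral>x. 1 / (of_real x + (of_real t0 + w)) \<partial>m)"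
  proof (rule integral_cong_AE)
    show "AE x in m. (\<Sum>k. f k x) = 1 / (of_real x + (of_real t0 + w))"
      using \<rho>(1)
    proof eventually_elim
      case (elim x)
      define y :: complex where "y = of_real (x + t0)"
      have ny: "norm y \<ge> \<rho>" using elim \<rho>0 by (simp add: y_def del: of_real_add)
      then have y0: "y \<noteq> 0" using \<rho>0 by auto
      have "norm w < norm y" using ny \<rho>(2) by linarith
      then have "norm (- w / y) < 1" using y0 by (simp add: norm_divide)
      then have "(\<lambda>k. (- w / y) ^ k) sums (1 / (1 - (- w / y)))" by (rule geometric_sums)
      then have "(\<lambda>k. 1 / y * (- w / y) ^ k) sums (1 / y * (1 / (1 - (- w / y))))"
        by (rule sums_mult)
      moreover have "1 / y * (- w / y) ^ k = f k x" for k
        unfolding f_def y_def[symmetric] of_real_divide of_real_power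
        by (simp add: power_divide power_minus[of "w / y"])
      moreover have "1 / y * (1 / (1 - (- w / y))) = 1 / (y + w)"
        using y0 by (simp add: field_simps)
      ultimately show ?case
        by (simp add: sums_iff y_def add.assoc)
    qed
  qed auto
  ultimately show ?thesis by (simp add: stieltjes_cx_def)
qed

lemma stieltjes_cx_of_real: "stieltjes_cx m (of_real t) = of_real (stieltjes m t)"
proof -
  have "stieltjes_cx m (of_real t) = (\<integral>x. of_real (1 / (x + t)) \<partial>m)"
    by (simp add: stieltjes_cx_def)
  then show ?thesis by (simp only: integral_complex_of_real stieltjes_def)
qed

text \<open>Since the mass sits on [0, \<infinity>), a null neighbourhood of 0 is the same as a gap
  to the right of 0, the form in which all later estimates use it.\<close>

lemma zero_notin_support_iff:
  fixes m :: "real measure"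
  assumes m: "prob_space m" "sets m = sets borel" "AE x in m. 0 \<le> x"
  shows "0 \<notin> measure_support m \<longleftrightarrow> (\<exists>\<rho>>0. AE x in m. \<rho> \<le> x)"
proof
  note [measurable_cong] = m(2)
  assume "0 \<notin> measure_support m"
  then obtain U where U: "open U" "0 \<in> U" "emeasure m U = 0"
    by (auto simp: measure_support_def)
  then obtain \<rho> where \<rho>: "\<rho> > 0" "ball 0 \<rho> \<subseteq> U" by (meson openE)
  have "U \<in> null_sets m" using U m by (auto simp: null_sets_def)
  then have "AE x in m. x \<notin> U" by (rule AE_not_in)
  with m(3) have "AE x in m. \<rho> \<le> x"
  proof eventually_elim
    case (elim x)
    with \<rho>(2) show ?case by (force simp: ball_def dist_real_def subset_eq)
  qed
  then show "\<exists>\<rho>>0. AE x in m. \<rho> \<le> x" using \<rho> by blast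
next
  assume "\<exists>\<rho>>0. AE x in m. \<rho> \<le> x"
  then obtain \<rho> where \<rho>: "\<rho> > 0" "AE x in m. \<rho> \<le> x" by blast
  have "AE x in m. x \<notin> {..<\<rho>}" using \<rho>(2) by eventually_elim auto
  then have "emeasure m {..<\<rho>} = 0"
    by (subst (asm) AE_iff_measurable[of "{..<\<rho>}"]) (use m sets_eq_imp_space_eq[OF m(2)] in auto)
  then show "0 \<notin> measure_support m"
    using \<rho>(1) by (auto simp: measure_support_def intro!: exI[of _ "{..<\<rho>}"])
qed

text \<open>
  The Taylor coefficients of the transform at \<open>t0 = r / 3\<close> are, up to sign, the moments of
  \<open>1 / (x + t0)\<close>; as the Taylor series converges up to distance \<open>2 r / 3\<close>, these moments
  grow too slowly for \<open>m\<close> to charge \<open>[0, r / 6]\<close>.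
\<close>
lemma zero_notin_support_if_holomorphic:
  fixes m :: "real measure"
  assumes m: "prob_space m" "sets m = sets borel" "AE x in m. 0 \<le> x"
    and r: "r > 0" and f: "f holomorphic_on ball 0 r"
    and eq: "\<And>t. 0 < t \<Longrightarrow> t < r \<Longrightarrow> f (of_real t) = of_real (stieltjes m t)"
  shows "0 \<notin> measure_support m"
proof -
  interpret prob_space m by (fact m)
  note [measurable_cong] = m(2)
  define t0 where "t0 = r / 3"
  have t0: "t0 > 0" using r by (simp add: t0_def)
  define c where "c = (\<lambda>k. \<integral>x. 1 / (x + t0) ^ Suc k \<partial>m)"
  define F where "F = (\<lambda>w. f (of_real t0 + w))"
  define G where "G = (\<lambda>w. stieltjes_cx m (of_real t0 + w))"
  have G_sums: "(\<lambda>k. of_real ((-1) ^ k * c k) * w ^ k) sums G w" if "norm w < t0" for w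
    unfolding G_def c_def
    by (rule stieltjes_power_series[OF finite_measure_axioms m(2), of t0]) (use m(3) that in auto)
  have F_hol: "F holomorphic_on ball 0 (2 * t0)"
    unfolding F_def
  proof (rule holomorphic_on_compose_gen[of "\<lambda>w. of_real t0 + w" _ f, unfolded o_def, OF _ f])
    show "(+) (complex_of_real t0) ` ball 0 (2 * t0) \<subseteq> ball 0 r"
    proof (rule image_subsetI)
      fix w :: complex assume "w \<in> ball 0 (2 * t0)"
      then have "norm (of_real t0 + w) < 3 * t0"
        using norm_triangle_ineq[of "of_real t0" w] t0 by simp
      then show "of_real t0 + w \<in> ball 0 r" by (simp add: t0_def)
    qed
  qed (auto intro!: holomorphic_intros)
  have G_hol: "G holomorphic_on ball 0 t0"
    by (rule power_series_holomorphic[where a = "\<lambda>k. of_real ((-1) ^ k * c k)"])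
       (use G_sums in auto)
  \<comment> \<open>Both functions are holomorphic on the small disc and agree on a real segment
    accumulating at 0. Hence the Taylor coefficients of \<open>F\<close> at 0 are the signed
    moments, although \<open>F\<close> lives on a disc twice as large.\<close>
  have FG: "F w = G w" if "w \<in> ball 0 t0" for w
  proof -
    have "F w - G w = 0"
    proof (rule analytic_continuation[where f = "\<lambda>w. F w - G w" and S = "ball 0 t0" and \<xi> = 0
          and U = "of_real ` {0<..<t0}"])
      show "(\<lambda>w. F w - G w) holomorphic_on ball 0 t0"
        using F_hol G_hol t0 by (intro holomorphic_on_diff)
          (auto dest: holomorphic_on_subset)
      have "0 islimpt {0<..<t0}" using t0 by (simp add: islimpt_greaterThanLessThan1)
      then have "complex_of_real 0 islimpt of_real ` {0<..<t0}"
        by (intro islimpt_isCont_image) (auto simp: eventually_at_filter)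
      then show "0 islimpt complex_of_real ` {0<..<t0}" by simp
      show "F z - G z = 0" if "z \<in> complex_of_real ` {0<..<t0}" for z
      proof -
        from that obtain u where u: "z = of_real u" "0 < u" "u < t0" by auto
        have "F z = of_real (stieltjes m (t0 + u))"
          unfolding F_def u(1) using u t0 by (subst of_real_add[symmetric], intro eq) (auto simp: t0_def)
        moreover have "G z = of_real (stieltjes m (t0 + u))"
          unfolding G_def u(1) by (subst of_real_add[symmetric], rule stieltjes_cx_of_real)
        ultimately show ?thesis by simp
      qed
    qed (use that t0 in auto)
    then show ?thesis by simp
  qed
  have "F has_fps_expansion Abs_fps (\<lambda>k. of_real ((-1) ^ k * c k))"
  proof (rule has_fps_expansionI)
    have "eventually (\<lambda>w. w \<in> ball 0 t0) (nhds (0::complex))"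
      using t0 by (intro eventually_nhds_in_open) auto
    then show "eventually (\<lambda>w. (\<lambda>k. fps_nth (Abs_fps (\<lambda>k. of_real ((-1) ^ k * c k))) k * w ^ k) sums F w) (nhds 0)"
      by eventually_elim (use G_sums FG in auto)
  qed
  then have coeff: "(deriv ^^ k) F 0 / fact k = of_real ((-1) ^ k * c k)" for k
    by (simp flip: fps_nth_fps_expansion)
  \<comment> \<open>The point \<open>3/2 * t0\<close> lies beyond the radius \<open>t0\<close> for
    which the moment series was derived, but inside the disc of \<open>F\<close>, so the terms of
    the series tend to 0 there. Each of them has modulus at least a fixed multiple of
    \<open>prob E\<close>, because x + t0 \<le> 3/2 t0 on \<open>E\<close>.\<close>
  have "(\<lambda>k. (deriv ^^ k) F 0 / fact k * (of_real (3/2 * t0) - 0) ^ k) sums F (of_real (3/2 * t0))"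
    by (rule holomorphic_power_series[OF F_hol]) (use t0 in auto)
  then have "(\<lambda>k. (deriv ^^ k) F 0 / fact k * (of_real (3/2 * t0) - 0) ^ k) \<longlonglongrightarrow> 0"
    by (intro summable_LIMSEQ_zero) (rule sums_summable)
  then have "(\<lambda>k. norm ((deriv ^^ k) F 0 / fact k * (of_real (3/2 * t0) - 0) ^ k)) \<longlonglongrightarrow> 0"
    by (rule tendsto_norm_zero)
  then have lim: "(\<lambda>k. \<bar>c k\<bar> * (3/2 * t0) ^ k) \<longlonglongrightarrow> 0"
    using t0 by (simp add: coeff norm_mult norm_power abs_mult)
  define E where "E = {..t0 / 2}"
  have E: "E \<in> sets m" by (simp add: E_def m)
  have c_ge: "c k \<ge> prob E * (1 / (3/2 * t0) ^ Suc k)" for k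
  proof -
    have bnd: "AE x in m. norm (1 / (x + t0) ^ Suc k) \<le> 1 / t0 ^ Suc k"
      using m(3)
    proof eventually_elim
      case (elim x)
      have "t0 ^ Suc k \<le> (x + t0) ^ Suc k" using elim t0 by (intro power_mono) auto
      then show ?case using elim t0 by (simp add: frac_le del: power_Suc)
    qed
    have "prob E * (1 / (3/2 * t0) ^ Suc k) = (\<integral>x. indicator E x * (1 / (3/2 * t0) ^ Suc k) \<partial>m)"
      using E sets.sets_into_space[OF E] by (simp add: Int_absorb2)
    also have "\<dots> \<le> c k"
      unfolding c_def
    proof (rule integral_mono_AE)
      show "integrable m (\<lambda>x. indicator E x * (1 / (3/2 * t0) ^ Suc k))"
        using E by (intro integrable_mult_left integrable_real_indicator) (auto simp: emeasure_eq_measure)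
      show "integrable m (\<lambda>x. 1 / (x + t0) ^ Suc k)"
        by (rule integrable_const_bound[OF bnd]) auto
      show "AE x in m. indicator E x * (1 / (3/2 * t0) ^ Suc k) \<le> 1 / (x + t0) ^ Suc k"
        using m(3)
      proof eventually_elim
        case (elim x)
        show ?case
        proof (cases "x \<in> E")
          case True
          have "(x + t0) ^ Suc k \<le> (3/2 * t0) ^ Suc k"
            using True elim t0 by (intro power_mono) (auto simp: E_def)
          then have "1 / (3/2 * t0) ^ Suc k \<le> 1 / (x + t0) ^ Suc k"
            using elim t0 by (intro divide_left_mono mult_pos_pos zero_less_power) auto
          then show ?thesis using True by simp
        qed (use elim t0 in auto)
      qed
    qed
    finally show ?thesis .
  qed
  have "prob E * (1 / (3/2 * t0)) \<le> 0"
  proof (rule LIMSEQ_le_const[OF lim], intro exI allI impI)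
    fix k
    have "prob E * (1 / (3/2 * t0)) = prob E * (1 / (3/2 * t0) ^ Suc k) * (3/2 * t0) ^ k"
      using t0 by simp
    also have "\<dots> \<le> \<bar>c k\<bar> * (3/2 * t0) ^ k"
      using c_ge[of k] t0 by (intro mult_right_mono) auto
    finally show "prob E * (1 / (3/2 * t0)) \<le> \<bar>c k\<bar> * (3/2 * t0) ^ k" .
  qed
  then have "prob E \<le> 0" using t0 by (simp add: divide_le_0_iff)
  then have "prob E = 0" using measure_nonneg[of m E] by linarith
  then have "AE x in m. x \<notin> E"
    using E by (intro AE_not_in) (auto simp: null_sets_def emeasure_eq_measure)
  then have "AE x in m. t0 / 2 \<le> x"
    by eventually_elim (auto simp: E_def)
  then show ?thesis
    using t0 by (subst zero_notin_support_iff[OF m]) (auto intro!: exI[of _ "t0 / 2"])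
qed

section \<open>Extension across 0 through a local inverse\<close>

text \<open>Since \<open>\<psi>\<close> has a nonzero derivative at 0, it has a holomorphic inverse
  \<open>k\<close> near 0, and \<open>g \<circ> k\<close> continues the transform of
  \<open>m\<close> across 0. The premise \<open>eq\<close> is asked for every radius
  \<open>r'\<close> because the disc on which \<open>\<psi>\<close> is injective is only found
  inside the proof, and \<open>u\<close> must lie in it for \<open>k\<close> to return
  \<open>u\<close>.\<close>

lemma zero_notin_support_if_inverse:
  fixes m :: "real measure"
  assumes m: "prob_space m" "sets m = sets borel" "AE x in m. 0 \<le> x"
    and r: "r > 0" and hol: "\<psi> holomorphic_on ball 0 r" "g holomorphic_on ball 0 r"
    and \<psi>: "\<psi> 0 = 0" "deriv \<psi> 0 \<noteq> 0"
    and eq: "\<And>r'. r' > 0 \<Longrightarrow> \<exists>\<epsilon>>0. \<forall>t. 0 < t \<and> t < \<epsilon> \<longrightarrow>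
       (\<exists>u. norm u < r' \<and> \<psi> u = of_real t \<and> g u = of_real (stieltjes m t))"
  shows "0 \<notin> measure_support m"
proof -
  have "0 \<in> ball (0 :: complex) r" using r by simp
  from has_complex_derivative_locally_injective[OF hol(1) this open_ball \<psi>(2)]
  obtain r1 where r1: "r1 > 0" "ball (0 :: complex) r1 \<subseteq> ball 0 r" "inj_on \<psi> (ball 0 r1)"
    by blast
  have \<psi>_hol: "\<psi> holomorphic_on ball 0 r1" and g_hol: "g holomorphic_on ball 0 r1"
    using hol r1(2) holomorphic_on_subset by blast+
  obtain k where k: "k holomorphic_on \<psi> ` ball 0 r1" "\<And>z. z \<in> ball 0 r1 \<Longrightarrow> k (\<psi> z) = z"
    by (rule holomorphic_has_inverse[OF \<psi>_hol _ r1(3)]) auto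
  have "open (\<psi> ` ball 0 r1)"
    using open_mapping_thm3[OF \<psi>_hol _ r1(3)] by auto
  moreover have "0 \<in> \<psi> ` ball 0 r1" using \<psi>(1) r1(1) by force
  ultimately obtain r2 where r2: "r2 > 0" "ball 0 r2 \<subseteq> \<psi> ` ball 0 r1" by (meson openE)
  obtain \<epsilon> where \<epsilon>: "\<epsilon> > 0" "\<And>t. 0 < t \<Longrightarrow> t < \<epsilon> \<Longrightarrow>
       (\<exists>u. norm u < r1 \<and> \<psi> u = of_real t \<and> g u = of_real (stieltjes m t))"
    using eq[OF r1(1)] by blast
  show ?thesis
  proof (rule zero_notin_support_if_holomorphic[OF m, of "min \<epsilon> r2" "g \<circ> k"])
    show "g \<circ> k holomorphic_on ball 0 (min \<epsilon> r2)"
    proof (rule holomorphic_on_compose_gen[OF _ g_hol])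
      show "k holomorphic_on ball 0 (min \<epsilon> r2)"
        using k(1) r2(2) by (rule_tac holomorphic_on_subset) auto
      show "k ` ball 0 (min \<epsilon> r2) \<subseteq> ball 0 r1"
      proof
        fix y assume "y \<in> k ` ball 0 (min \<epsilon> r2)"
        then obtain t where "y = k t" "t \<in> ball 0 r2" by auto
        with r2(2) obtain z where "z \<in> ball 0 r1" "t = \<psi> z" by blast
        with k(2) \<open>y = k t\<close> show "y \<in> ball 0 r1" by simp
      qed
    qed
    show "(g \<circ> k) (of_real t) = of_real (stieltjes m t)" if t: "0 < t" "t < min \<epsilon> r2" for t
    proof -
      obtain u where "norm u < r1" "\<psi> u = of_real t" "g u = of_real (stieltjes m t)"
        using \<epsilon>(2)[of t] t by auto
      with k(2)[of u] show ?thesis by simp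
    qed
  qed (use \<epsilon> r2 in auto)
qed

lemma stieltjes_nonneg:
  assumes "AE x in m. 0 \<le> x" "0 \<le> t"
  shows "0 \<le> stieltjes m t"
  unfolding stieltjes_def by (rule integral_nonneg_AE) (use assms in \<open>auto elim!: eventually_mono\<close>)

lemma stieltjes_le_inverse_gap:
  assumes "prob_space m" "sets m = sets borel" "0 < \<rho>" "AE x in m. \<rho> \<le> x" "0 \<le> t"
  shows "stieltjes m t \<le> stieltjes m 0"
proof -
  interpret prob_space m by (fact assms)
  note [measurable_cong] = assms(2)
  have int: "integrable m (\<lambda>x. 1 / (x + s))" if "0 \<le> s" for s
  proof (rule integrable_const_bound[of _ "1 / \<rho>"])
    show "AE x in m. norm (1 / (x + s)) \<le> 1 / \<rho>"
      using assms(4) by eventually_elim (use assms(3) that in \<open>auto intro!: frac_le\<close>)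
  qed auto
  show ?thesis
    unfolding stieltjes_def
    by (rule integral_mono_AE[OF int int])
       (use assms in \<open>auto elim!: eventually_mono intro!: frac_le\<close>)
qed

text \<open>The extended integrand is \<infinity> at 0; a gap keeps it below 1 / \<rho>, so that the
  extended integral of the theorem becomes a real number, the transform at 0.\<close>

lemma nn_integral_inverse_eq_stieltjes:
  assumes "prob_space m" "sets m = sets borel" "0 < \<rho>" "AE x in m. \<rho> \<le> x"
  shows "(\<integral>\<^sup>+ l. inverse (ennreal l) \<partial>m) = ennreal (stieltjes m 0)"
proof -
  interpret prob_space m by (fact assms)
  note [measurable_cong] = assms(2)
  have int: "integrable m (\<lambda>x. 1 / (x + 0))"
  proof (rule integrable_const_bound[of _ "1 / \<rho>"])
    show "AE x in m. norm (1 / (x + 0)) \<le> 1 / \<rho>"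
      using assms(4) by eventually_elim (use assms(3) in \<open>auto intro!: frac_le\<close>)
  qed auto
  have "(\<integral>\<^sup>+ l. inverse (ennreal l) \<partial>m) = (\<integral>\<^sup>+ l. ennreal (1 / (l + 0)) \<partial>m)"
    by (rule nn_integral_cong_AE)
       (use assms in \<open>auto elim!: eventually_mono simp: inverse_ennreal inverse_eq_divide\<close>)
  also have "\<dots> = ennreal (stieltjes m 0)"
    unfolding stieltjes_def
    by (rule nn_integral_eq_integral[OF int])
       (use assms in \<open>auto elim!: eventually_mono\<close>)
  finally show ?thesis .
qed

lemma stieltjes_cx_holomorphic:
  assumes "prob_space m" "sets m = sets borel" "0 < \<rho>" "AE x in m. \<rho> \<le> x"
  shows "stieltjes_cx m holomorphic_on ball 0 \<rho>"
proof (rule power_series_holomorphic)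
  interpret prob_space m by (fact assms)
  fix w :: complex assume "w \<in> ball 0 \<rho>"
  with stieltjes_power_series[OF finite_measure_axioms assms(2), of \<rho> 0 w] assms(4) show "(\<lambda>k. of_real ((-1) ^ k * (\<integral>x. 1 / (x + 0) ^ Suc k \<partial>m)) * (w - 0) ^ k) sums stieltjes_cx m w"
    by simp
qed

lemma deriv_mult_ident_0:
  fixes h :: "complex \<Rightarrow> complex"
  assumes "h holomorphic_on ball 0 r" "r > 0"
  shows "deriv (\<lambda>w. w * h w) 0 = h 0"
proof (rule DERIV_imp_deriv)
  have "(h has_field_derivative deriv h 0) (at 0)"
    using assms by (intro holomorphic_derivI[of h "ball 0 r"]) auto
  from DERIV_mult[OF DERIV_ident this] show "((\<lambda>w. w * h w) has_field_derivative h 0) (at 0)"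
    by simp
qed

text \<open>Write f, g for the transforms of \<open>\<mu>\<close>, \<open>\<nu>\<close>, and h = 1 +
  c f. The equation says that g sends w h(w)^2 to f(w) / h(w). Read backwards, 1 - c g = 1 / h, so f
  sends u (1 - c g(u))^2 to g(u) / (1 - c g(u)). The derivatives of these two substitutions at 0 are
  h(0)^2 and (1 - c g(0))^2: the first is nonzero because f(0) \<ge> 0, the second because the
  inverse moment is below 1 / c. Both directions are proved in contrapositive form.\<close>

lemma zero_in_support_iff_inverse_moment:
  fixes \<mu> \<nu> :: "real measure"
  assumes \<mu>: "prob_space \<mu>" "sets \<mu> = sets borel" "AE x in \<mu>. 0 \<le> x"
    and \<nu>: "prob_space \<nu>" "sets \<nu> = sets borel" "AE x in \<nu>. 0 \<le> x"
    and c: "c > 0"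
    and eq: "\<And>t. 0 < t \<Longrightarrow> stieltjes \<nu> (t * (1 + c * stieltjes \<mu> t)\<^sup>2) =
                 stieltjes \<mu> t / (1 + c * stieltjes \<mu> t)"
  shows "0 \<in> measure_support \<mu> \<longleftrightarrow>
    0 \<in> measure_support \<nu> \<or> (\<integral>\<^sup>+ l. inverse (ennreal l) \<partial>\<nu>) \<ge> ennreal (1 / c)"
proof -
  define S where "S = stieltjes \<mu>"
  define N where "N = stieltjes \<nu>"
  note eq = eq[folded S_def N_def]
  have S_nonneg: "S t \<ge> 0" if "t \<ge> 0" for t unfolding S_def using stieltjes_nonneg \<mu>(3) that by blast
  have N_nonneg: "N t \<ge> 0" if "t \<ge> 0" for t unfolding N_def using stieltjes_nonneg \<nu>(3) that by blast
  have pos: "1 + c * S t > 0" if "t \<ge> 0" for t using S_nonneg[OF that] c by (simp add: add_pos_nonneg)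
  have "0 \<notin> measure_support \<nu> \<and> (\<integral>\<^sup>+ l. inverse (ennreal l) \<partial>\<nu>) < ennreal (1 / c)"
    if not: "0 \<notin> measure_support \<mu>"
  proof
    obtain \<rho> where \<rho>: "\<rho> > 0" "AE x in \<mu>. \<rho> \<le> x"
      using not zero_notin_support_iff[OF \<mu>] by blast
    define f where "f = stieltjes_cx \<mu>"
    have f_hol: "f holomorphic_on ball 0 \<rho>"
      unfolding f_def by (rule stieltjes_cx_holomorphic[OF \<mu>(1,2) \<rho>])
    have f_real: "f (of_real t) = of_real (S t)" for t
      unfolding f_def S_def by (rule stieltjes_cx_of_real)
    define h where "h = (\<lambda>w. 1 + of_real c * f w)"
    have h_hol: "h holomorphic_on ball 0 \<rho>"
      unfolding h_def by (intro holomorphic_intros f_hol)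
    have h_real: "h (of_real t) = of_real (1 + c * S t)" for t
      by (simp add: h_def f_real)
    have h0: "h 0 \<noteq> 0" using h_real[of 0] pos[of 0] by (metis less_irrefl of_real_0 of_real_eq_0_iff order_refl)
    obtain e where e: "e > 0" "\<And>y. dist 0 y < e \<Longrightarrow> h y \<noteq> 0"
      using continuous_on_open_avoid[OF holomorphic_on_imp_continuous_on[OF h_hol], of 0 0] h0 \<rho>(1) by auto
    define r where "r = min e \<rho>"
    have r: "r > 0" "r \<le> \<rho>" using e \<rho> by (auto simp: r_def)
    have fr: "f holomorphic_on ball 0 r" and hr: "h holomorphic_on ball 0 r"
      using f_hol h_hol r by (auto dest: holomorphic_on_subset)
    define \<phi> where "\<phi> = (\<lambda>t. t * (1 + c * S t)\<^sup>2)"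
    have \<phi>_cx: "of_real (\<phi> t) = of_real t * (h (of_real t))\<^sup>2" for t
      by (simp add: \<phi>_def h_real)
    have S_cont: "isCont S t" if "\<bar>t\<bar> < \<rho>" for t
    proof -
      have "isCont f (of_real t)"
        using f_hol that by (intro continuous_on_interior[OF holomorphic_on_imp_continuous_on[OF f_hol]]) auto
      moreover have "isCont complex_of_real t"
        by (intro continuous_of_real continuous_ident)
      ultimately have "isCont (\<lambda>t. f (of_real t)) t"
        by (rule isCont_o2[rotated])
      then have "isCont (\<lambda>t. Re (f (of_real t))) t"
        by (rule continuous_Re)
      then show ?thesis by (simp add: f_real)
    qed
    have \<phi>_cont: "isCont \<phi> t" if "\<bar>t\<bar> < \<rho>" for t
      unfolding \<phi>_def using S_cont[OF that] by (intro continuous_intros)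
    show \<nu>_not: "0 \<notin> measure_support \<nu>"
    proof (rule zero_notin_support_if_inverse[OF \<nu> r(1), where \<psi> = "\<lambda>w. w * (h w)\<^sup>2" and g = "\<lambda>w. f w / h w"])
      show "(\<lambda>w. w * (h w)\<^sup>2) holomorphic_on ball 0 r" by (intro holomorphic_intros hr)
      show "(\<lambda>w. f w / h w) holomorphic_on ball 0 r"
        by (intro holomorphic_intros hr fr) (use e in \<open>auto simp: r_def\<close>)
      show "deriv (\<lambda>w. w * (h w)\<^sup>2) 0 \<noteq> 0"
        using h0 by (subst deriv_mult_ident_0[of _ r]) (auto intro!: holomorphic_intros hr r)
      show "\<exists>\<epsilon>>0. \<forall>t. 0 < t \<and> t < \<epsilon> \<longrightarrow> (\<exists>u. norm u < r' \<and> u * (h u)\<^sup>2 = of_real t \<and>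
              f u / h u = of_real (stieltjes \<nu> t))" if r': "r' > 0" for r'
      proof -
        define r2 where "r2 = min r r' / 2"
        have r2: "0 < r2" "r2 < r" "r2 < r'" using r' r by (auto simp: r2_def min_def)
        show ?thesis
        proof (rule exI[of _ "\<phi> r2"], intro conjI allI impI)
          show "0 < \<phi> r2" unfolding \<phi>_def using r2 pos[of r2] by (intro mult_pos_pos) auto
          fix y assume y: "0 < y \<and> y < \<phi> r2"
          \<comment> \<open>Some preimage under \<open>\<phi>\<close> is all that is asked for, so
            continuity suffices. The value t = 0 is ruled out afterwards by
            \<open>\<phi> 0 = 0 < y\<close>, since the equation holds for t > 0 only.\<close>
          have "\<exists>t. 0 \<le> t \<and> t \<le> r2 \<and> \<phi> t = y"
          proof (rule IVT)
            show "\<phi> 0 \<le> y" using y by (simp add: \<phi>_def)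
          qed (use y r2 r \<phi>_cont in auto)
          then obtain t where t: "0 \<le> t" "t \<le> r2" "\<phi> t = y" by blast
          have "t > 0" using t y by (cases "t = 0") (auto simp: \<phi>_def)
          then have "N y = S t / (1 + c * S t)" using eq[of t] t by (simp add: \<phi>_def)
          then have "f (of_real t) / h (of_real t) = of_real (stieltjes \<nu> y)"
            by (simp add: f_real h_real N_def)
          moreover have "norm (complex_of_real t) < r'" using t r2 by simp
          moreover have "of_real t * (h (of_real t))\<^sup>2 = of_real y" using \<phi>_cx[of t] t by simp
          ultimately show "\<exists>u. norm u < r' \<and> u * (h u)\<^sup>2 = of_real y \<and> f u / h u = of_real (stieltjes \<nu> y)"
            by blast
        qed
      qed
    qed simp
    obtain \<rho>' where \<rho>': "\<rho>' > 0" "AE x in \<nu>. \<rho>' \<le> x"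
      using \<nu>_not zero_notin_support_iff[OF \<nu>] by blast
    \<comment> \<open>The equation says nothing at t = 0, so \<open>N 0\<close> is reached as the
      right limit of \<open>N (\<phi> t)\<close>. The bound passes to the limit because s / (1 + c
      s) increases with s and \<open>S t \<le> S 0\<close>; it is strictly below 1 / c.\<close>
    have "isCont (stieltjes_cx \<nu>) 0"
      by (rule continuous_on_interior[OF holomorphic_on_imp_continuous_on[OF stieltjes_cx_holomorphic[OF \<nu>(1,2) \<rho>']]])
         (use \<rho>' in auto)
    then have "isCont (stieltjes_cx \<nu>) (of_real (\<phi> 0))" by (simp add: \<phi>_def)
    moreover have "isCont (\<lambda>t. complex_of_real (\<phi> t)) 0"
      by (rule continuous_of_real[OF \<phi>_cont]) (use \<rho>(1) in simp)
    ultimately have "isCont (\<lambda>t. stieltjes_cx \<nu> (of_real (\<phi> t))) 0"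
      by (rule isCont_o2[rotated])
    then have "isCont (\<lambda>t. Re (stieltjes_cx \<nu> (of_real (\<phi> t)))) 0"
      by (rule continuous_Re)
    then have "isCont (\<lambda>t. N (\<phi> t)) 0" by (simp add: stieltjes_cx_of_real N_def)
    then have "((\<lambda>t. N (\<phi> t)) \<longlongrightarrow> N 0) (at_right 0)"
      by (auto simp: isCont_def \<phi>_def intro: tendsto_mono[OF at_le])
    moreover have "eventually (\<lambda>t. N (\<phi> t) \<le> S 0 / (1 + c * S 0)) (at_right 0)"
    proof -
      have "N (\<phi> t) \<le> S 0 / (1 + c * S 0)" if "t > 0" for t
      proof -
        have le: "S t \<le> S 0"
          unfolding S_def using stieltjes_le_inverse_gap[OF \<mu>(1,2) \<rho>] that by simp
        have "S t / (1 + c * S t) \<le> S 0 / (1 + c * S 0)"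
          using pos[of t] pos[of 0] that le by (simp add: field_simps)
        then show ?thesis using eq[OF that] by (simp add: \<phi>_def)
      qed
      then show ?thesis by (auto simp: eventually_at_filter)
    qed
    ultimately have "N 0 \<le> S 0 / (1 + c * S 0)"
      by (rule tendsto_upperbound) simp
    also have "\<dots> < 1 / c" using pos[of 0] c by (simp add: field_simps)
    finally have "N 0 < 1 / c" .
    then show "(\<integral>\<^sup>+ l. inverse (ennreal l) \<partial>\<nu>) < ennreal (1 / c)"
      unfolding nn_integral_inverse_eq_stieltjes[OF \<nu>(1,2) \<rho>'] N_def[symmetric]
      using N_nonneg[of 0] by (simp add: ennreal_less_iff)
  qed
  moreover have "0 \<notin> measure_support \<mu>"
    if not: "0 \<notin> measure_support \<nu>" and less: "(\<integral>\<^sup>+ l. inverse (ennreal l) \<partial>\<nu>) < ennreal (1 / c)"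
  proof -
    obtain \<rho> where \<rho>: "\<rho> > 0" "AE x in \<nu>. \<rho> \<le> x"
      using not zero_notin_support_iff[OF \<nu>] by blast
    have "N 0 < 1 / c"
      using less unfolding nn_integral_inverse_eq_stieltjes[OF \<nu>(1,2) \<rho>] N_def[symmetric]
      using N_nonneg[of 0] by (simp add: ennreal_less_iff)
    then have N0: "1 - c * N 0 > 0" using c by (simp add: field_simps)
    define f where "f = stieltjes_cx \<nu>"
    have f_hol: "f holomorphic_on ball 0 \<rho>"
      unfolding f_def by (rule stieltjes_cx_holomorphic[OF \<nu>(1,2) \<rho>])
    have f_real: "f (of_real t) = of_real (N t)" for t
      unfolding f_def N_def by (rule stieltjes_cx_of_real)
    define h where "h = (\<lambda>w. 1 - of_real c * f w)"
    have h_hol: "h holomorphic_on ball 0 \<rho>"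
      unfolding h_def by (intro holomorphic_intros f_hol)
    have h_real: "h (of_real t) = of_real (1 - c * N t)" for t
      by (simp add: h_def f_real)
    have h0: "h 0 \<noteq> 0" using h_real[of 0] N0 by (metis less_irrefl of_real_0 of_real_eq_0_iff)
    obtain e where e: "e > 0" "\<And>y. dist 0 y < e \<Longrightarrow> h y \<noteq> 0"
      using continuous_on_open_avoid[OF holomorphic_on_imp_continuous_on[OF h_hol], of 0 0] h0 \<rho>(1) by auto
    define r where "r = min e \<rho>"
    have r: "r > 0" "r \<le> \<rho>" using e \<rho> by (auto simp: r_def)
    have fr: "f holomorphic_on ball 0 r" and hr: "h holomorphic_on ball 0 r"
      using f_hol h_hol r by (auto dest: holomorphic_on_subset)
    show ?thesis
    proof (rule zero_notin_support_if_inverse[OF \<mu> r(1), where \<psi> = "\<lambda>w. w * (h w)\<^sup>2" and g = "\<lambda>w. f w / h w"])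
      show "(\<lambda>w. w * (h w)\<^sup>2) holomorphic_on ball 0 r" by (intro holomorphic_intros hr)
      show "(\<lambda>w. f w / h w) holomorphic_on ball 0 r"
        by (intro holomorphic_intros hr fr) (use e in \<open>auto simp: r_def\<close>)
      show "deriv (\<lambda>w. w * (h w)\<^sup>2) 0 \<noteq> 0"
        using h0 by (subst deriv_mult_ident_0[of _ r]) (auto intro!: holomorphic_intros hr r)
      \<comment> \<open>Nothing is known yet about the size of \<open>S\<close> near 0, so u = t (1
        + c S t)^2 is bounded through \<open>N\<close> instead: from \<open>N u \<le> N 0\<close> it
        follows that t = u (1 - c N u)^2 \<ge> u (1 - c N 0)^2. This dictates \<epsilon> = r' (1 - c
        N 0)^2.\<close>
      show "\<exists>\<epsilon>>0. \<forall>t. 0 < t \<and> t < \<epsilon> \<longrightarrow> (\<exists>u. norm u < r' \<and> u * (h u)\<^sup>2 = of_real t \<and>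
              f u / h u = of_real (stieltjes \<mu> t))" if r': "r' > 0" for r'
      proof (rule exI[of _ "r' * (1 - c * N 0)\<^sup>2"], intro conjI allI impI)
        show "0 < r' * (1 - c * N 0)\<^sup>2" using r' N0 by simp
        fix t assume t: "0 < t \<and> t < r' * (1 - c * N 0)\<^sup>2"
        define u where "u = t * (1 + c * S t)\<^sup>2"
        have p: "1 + c * S t > 0" using pos[of t] t by simp
        have u: "0 \<le> u" using t by (simp add: u_def)
        have Nu: "N u = S t / (1 + c * S t)" using eq[of t] t by (simp add: u_def)
        then have Nu': "1 - c * N u = 1 / (1 + c * S t)" using p by (simp add: field_simps)
        have "N u \<le> N 0" unfolding N_def by (rule stieltjes_le_inverse_gap[OF \<nu>(1,2) \<rho> u])
        then have "1 - c * N 0 \<le> 1 - c * N u" using c by simp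
        then have "u * (1 - c * N 0)\<^sup>2 \<le> u * (1 - c * N u)\<^sup>2"
          using N0 u by (intro mult_left_mono power_mono) auto
        also have ut: "u * (1 - c * N u)\<^sup>2 = t"
          unfolding Nu' using p by (simp add: u_def power_divide)
        also have "t < r' * (1 - c * N 0)\<^sup>2" using t by simp
        finally have "u < r'" using N0 by simp
        then have "norm (complex_of_real u) < r'" using u by simp
        moreover have "of_real u * (h (of_real u))\<^sup>2 = of_real t"
          unfolding ut[symmetric] by (simp add: h_real)
        moreover have "N u / (1 - c * N u) = S t" unfolding Nu' unfolding Nu using p by simp
        then have "f (of_real u) / h (of_real u) = of_real (stieltjes \<mu> t)"
          unfolding f_real h_real S_def[symmetric] by (metis of_real_divide)
        ultimately show "\<exists>u. norm u < r' \<and> u * (h u)\<^sup>2 = of_real t \<and> f u / h u = of_real (stieltjes \<mu> t)"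
          by blast
      qed
    qed simp
  qed
  ultimately show ?thesis by (meson not_le)
qed

section \<open>Resolvents of Hermitian matrices\<close>

text \<open>Matrices are functions on pairs of indices with the size as a separate argument, so that
  products and traces are plain finite sums; values outside the square are ignored.\<close>

definition hermitian_on :: "nat \<Rightarrow> (nat \<Rightarrow> nat \<Rightarrow> complex) \<Rightarrow> bool" where
  "hermitian_on n h \<longleftrightarrow> (\<forall>i<n. \<forall>j<n. h j i = cnj (h i j))"

text \<open>The matrix h - \<i> \<eta>: for Hermitian h and \<eta> > 0 the point \<i> \<eta> is off
  the spectrum, at distance at least \<eta>.\<close>

definition shifted :: "(nat \<Rightarrow> nat \<Rightarrow> complex) \<Rightarrow> real \<Rightarrow> nat \<Rightarrow> nat \<Rightarrow> complex" where
  "shifted h \<eta> i j = h i j - (if i = j then \<i> * of_real \<eta> else 0)"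

text \<open>The adjugate formula is chosen because it is visibly measurable in the entries.\<close>

definition resolvent :: "nat \<Rightarrow> (nat \<Rightarrow> nat \<Rightarrow> complex) \<Rightarrow> real \<Rightarrow> nat \<Rightarrow> nat \<Rightarrow> complex" where
  "resolvent n h \<eta> i j =
     (let M = Matrix.mat n n (\<lambda>(i, j). shifted h \<eta> i j) in adj_mat M $$ (i, j) / Determinant.det M)"

lemma sum_shifted_mult:
  assumes "i < n"
  shows "(\<Sum>j<n. shifted h \<eta> i j * v j) = (\<Sum>j<n. h i j * v j) - \<i> * of_real \<eta> * v i"
proof -
  have "(\<Sum>j<n. shifted h \<eta> i j * v j) =
      (\<Sum>j<n. h i j * v j - (if j = i then \<i> * of_real \<eta> * v j else 0))"
    by (rule sum.cong) (auto simp: shifted_def algebra_simps)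
  also have "\<dots> = (\<Sum>j<n. h i j * v j) - \<i> * of_real \<eta> * v i"
    using assms by (simp add: sum_subtractf)
  finally show ?thesis .
qed

lemma shifted_transpose: "shifted h \<eta> j i = shifted (\<lambda>i j. h j i) \<eta> i j"
  by (auto simp: shifted_def)

lemma hermitian_onD: "hermitian_on n h \<Longrightarrow> i < n \<Longrightarrow> j < n \<Longrightarrow> cnj (h i j) = h j i"
  unfolding hermitian_on_def by metis

lemma hermitian_on_transpose: "hermitian_on n h \<Longrightarrow> hermitian_on n (\<lambda>i j. h j i)"
  unfolding hermitian_on_def by blast

text \<open>The form of a Hermitian matrix is real, so pairing (h - \<i> \<eta>) v = e with v leaves
  - \<eta> |v|^2 as the imaginary part, and Cauchy-Schwarz finishes. This one inequality yields both
  the invertibility of h - \<i> \<eta> and the bounds on its inverse.\<close>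

lemma shifted_solution_bound:
  assumes h: "hermitian_on n h" and \<eta>: "\<eta> > 0"
    and eq: "\<And>i. i < n \<Longrightarrow> (\<Sum>j<n. shifted h \<eta> i j * v j) = e i"
  shows "\<eta>\<^sup>2 * (\<Sum>i<n. (cmod (v i))\<^sup>2) \<le> (\<Sum>i<n. (cmod (e i))\<^sup>2)"
proof -
  define V where "V = (\<Sum>i<n. (cmod (v i))\<^sup>2)"
  define E where "E = (\<Sum>i<n. (cmod (e i))\<^sup>2)"
  define Q where "Q = (\<Sum>i<n. \<Sum>j<n. cnj (v i) * h i j * v j)"
  have "cnj Q = (\<Sum>i<n. \<Sum>j<n. v i * cnj (h i j) * cnj (v j))"
    by (simp add: Q_def)
  also have "\<dots> = (\<Sum>i<n. \<Sum>j<n. cnj (v j) * h j i * v i)"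
    by (intro sum.cong refl) (simp add: hermitian_onD[OF h])
  also have "\<dots> = Q" unfolding Q_def by (rule sum.swap)
  finally have Q: "Im Q = 0" by (metis Reals_cnj_iff complex_is_Real_iff)
  have "(\<Sum>i<n. cnj (v i) * e i) = (\<Sum>i<n. cnj (v i) * ((\<Sum>j<n. h i j * v j) - \<i> * of_real \<eta> * v i))"
    by (intro sum.cong refl) (simp add: eq[symmetric] sum_shifted_mult)
  also have "\<dots> = Q - (\<Sum>i<n. \<i> * of_real \<eta> * (cnj (v i) * v i))"
    by (simp add: Q_def right_diff_distrib sum_subtractf sum_distrib_left algebra_simps)
  also have "(\<Sum>i<n. \<i> * of_real \<eta> * (cnj (v i) * v i)) = \<i> * of_real (\<eta> * V)"
    by (simp add: V_def sum_distrib_left complex_norm_square algebra_simps del: of_real_power)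
  finally have "Im (\<Sum>i<n. cnj (v i) * e i) = - (\<eta> * V)"
    using Q by simp
  then have "\<eta> * V \<le> cmod (\<Sum>i<n. cnj (v i) * e i)"
    using abs_Im_le_cmod[of "\<Sum>i<n. cnj (v i) * e i"] by linarith
  also have "\<dots> \<le> (\<Sum>i<n. cmod (v i) * cmod (e i))"
    by (rule order_trans[OF norm_sum]) (simp add: norm_mult)
  finally have "(\<eta> * V)\<^sup>2 \<le> (\<Sum>i<n. cmod (v i) * cmod (e i))\<^sup>2"
    using \<eta> by (intro power_mono) (auto simp: V_def sum_nonneg)
  also have "\<dots> \<le> V * E" unfolding V_def E_def by (rule Cauchy_Schwarz_ineq_sum)
  finally have "V * (\<eta>\<^sup>2 * V) \<le> V * E" by (simp add: power2_eq_square algebra_simps)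
  moreover have "V \<ge> 0" "E \<ge> 0" by (auto simp: V_def E_def sum_nonneg)
  ultimately have "\<eta>\<^sup>2 * V \<le> E" by (cases "V = 0") (auto simp: mult_le_cancel_left)
  then show ?thesis by (simp add: V_def E_def)
qed

lemma index_mult_mat_sum:
  assumes "A \<in> carrier_mat n k" "B \<in> carrier_mat k m" "i < n" "j < m"
  shows "(A * B) $$ (i, j) = (\<Sum>l<k. A $$ (i, l) * B $$ (l, j))"
  using assms by (simp add: scalar_prod_def lessThan_atLeast0)

lemma resolvent_inverse:
  assumes h: "hermitian_on n h" and \<eta>: "\<eta> > 0" and ik: "i < n" "k < n"
  shows "(\<Sum>j<n. shifted h \<eta> i j * resolvent n h \<eta> j k) = (if i = k then 1 else 0)"
    and "(\<Sum>j<n. resolvent n h \<eta> i j * shifted h \<eta> j k) = (if i = k then 1 else 0)"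
proof -
  define M where "M = Matrix.mat n n (\<lambda>(i, j). shifted h \<eta> i j)"
  have M: "M \<in> carrier_mat n n" by (simp add: M_def)
  \<comment> \<open>A kernel vector solves the system with right-hand side 0, so
    \<open>shifted_solution_bound\<close> makes it vanish.\<close>
  have det: "Determinant.det M \<noteq> 0"
  proof
    assume "Determinant.det M = 0"
    then obtain v where v: "v \<in> carrier_vec n" "v \<noteq> 0\<^sub>v n" "M *\<^sub>v v = 0\<^sub>v n"
      using det_0_iff_vec_prod_zero[OF M] by blast
    have "(\<Sum>j<n. shifted h \<eta> i j * vec_index v j) = 0" if "i < n" for i
    proof -
      have "(\<Sum>j<n. shifted h \<eta> i j * vec_index v j) = vec_index (M *\<^sub>v v) i"
        using v(1) that by (simp add: M_def scalar_prod_def lessThan_atLeast0)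
      then show ?thesis using v(3) that by simp
    qed
    from shifted_solution_bound[OF h \<eta> this]
    have "\<eta>\<^sup>2 * (\<Sum>i<n. (cmod (vec_index v i))\<^sup>2) \<le> 0" by simp
    then have "(\<Sum>i<n. (cmod (vec_index v i))\<^sup>2) \<le> 0"
      using \<eta> by (simp add: mult_le_0_iff)
    then have "(\<Sum>i<n. (cmod (vec_index v i))\<^sup>2) = 0"
      by (intro antisym sum_nonneg) auto
    then have "\<forall>i<n. vec_index v i = 0" by (subst (asm) sum_nonneg_eq_0_iff) auto
    then have "v = 0\<^sub>v n" using v(1) by (intro eq_vecI) auto
    with v(2) show False by simp
  qed
  have R: "resolvent n h \<eta> i j = adj_mat M $$ (i, j) / Determinant.det M" for i j
    by (simp add: resolvent_def M_def Let_def)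
  have adj: "adj_mat M \<in> carrier_mat n n" using adj_mat[OF M] by simp
  have "(\<Sum>j<n. shifted h \<eta> i j * resolvent n h \<eta> j k) = (M * adj_mat M) $$ (i, k) / Determinant.det M"
    unfolding index_mult_mat_sum[OF M adj ik] sum_divide_distrib R
    using ik by (intro sum.cong) (auto simp: M_def)
  then show "(\<Sum>j<n. shifted h \<eta> i j * resolvent n h \<eta> j k) = (if i = k then 1 else 0)"
    using adj_mat(2)[OF M] ik det by simp
  have "(\<Sum>j<n. resolvent n h \<eta> i j * shifted h \<eta> j k) = (adj_mat M * M) $$ (i, k) / Determinant.det M"
    unfolding index_mult_mat_sum[OF adj M ik] sum_divide_distrib R
    using ik by (intro sum.cong) (auto simp: M_def)
  then show "(\<Sum>j<n. resolvent n h \<eta> i j * shifted h \<eta> j k) = (if i = k then 1 else 0)"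
    using adj_mat(3)[OF M] ik det by simp
qed

lemma resolvent_col_bound:
  assumes h: "hermitian_on n h" and \<eta>: "\<eta> > 0" and k: "k < n"
  shows "(\<Sum>i<n. (cmod (resolvent n h \<eta> i k))\<^sup>2) \<le> 1 / \<eta>\<^sup>2"
proof -
  have "\<eta>\<^sup>2 * (\<Sum>i<n. (cmod (resolvent n h \<eta> i k))\<^sup>2) \<le> (\<Sum>i<n. (cmod (if i = k then 1 else 0))\<^sup>2)"
    by (rule shifted_solution_bound[OF h \<eta>]) (simp add: resolvent_inverse(1)[OF h \<eta> _ k])
  also have "\<dots> = (\<Sum>i<n. if i = k then 1 else 0)" by (rule sum.cong) auto
  also have "\<dots> = 1" using k by simp
  finally show ?thesis using \<eta> by (simp add: field_simps)
qed

text \<open>The transpose of a Hermitian matrix is Hermitian, and a row of the resolvent solves the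
  transposed system with a unit vector on the right.\<close>

lemma resolvent_row_bound:
  assumes h: "hermitian_on n h" and \<eta>: "\<eta> > 0" and k: "k < n"
  shows "(\<Sum>i<n. (cmod (resolvent n h \<eta> k i))\<^sup>2) \<le> 1 / \<eta>\<^sup>2"
proof -
  have "\<eta>\<^sup>2 * (\<Sum>i<n. (cmod (resolvent n h \<eta> k i))\<^sup>2) \<le> (\<Sum>i<n. (cmod (if i = k then 1 else 0))\<^sup>2)"
  proof (rule shifted_solution_bound[OF hermitian_on_transpose[OF h] \<eta>])
    fix i assume i: "i < n"
    have "(\<Sum>j<n. shifted (\<lambda>i j. h j i) \<eta> i j * resolvent n h \<eta> k j) =
        (\<Sum>j<n. resolvent n h \<eta> k j * shifted h \<eta> j i)"
      by (simp add: shifted_transpose[of h] mult.commute)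
    also have "\<dots> = (if i = k then 1 else 0)"
      using resolvent_inverse(2)[OF h \<eta> k i] by auto
    finally show "(\<Sum>j<n. shifted (\<lambda>i j. h j i) \<eta> i j * resolvent n h \<eta> k j) = (if i = k then 1 else 0)" .
  qed
  also have "\<dots> = (\<Sum>i<n. if i = k then 1 else 0)" by (rule sum.cong) auto
  also have "\<dots> = 1" using k by simp
  finally show ?thesis using \<eta> by (simp add: field_simps)
qed

lemma resolvent_entry_bound:
  assumes h: "hermitian_on n h" and \<eta>: "\<eta> > 0" and "i < n" "k < n"
  shows "cmod (resolvent n h \<eta> i k) \<le> 1 / \<eta>"
proof -
  have "(cmod (resolvent n h \<eta> i k))\<^sup>2 \<le> (\<Sum>i<n. (cmod (resolvent n h \<eta> i k))\<^sup>2)"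
    by (rule member_le_sum) (use assms in auto)
  also have "\<dots> \<le> (1 / \<eta>)\<^sup>2" using resolvent_col_bound[OF h \<eta> \<open>k < n\<close>] by (simp add: power_divide)
  finally show ?thesis using \<eta> by (rule_tac power2_le_imp_le) auto
qed

text \<open>Cauchy-Schwarz between a row of one resolvent and a column of the other gives a bound
  free of the dimension, which a termwise estimate of the sum would not.\<close>

lemma resolvent_mult_bound:
  assumes h: "hermitian_on n h" "hermitian_on n g" and \<eta>: "\<eta> > 0" "a > 0" and "i < n" "k < n"
  shows "cmod (\<Sum>j<n. resolvent n h \<eta> i j * resolvent n g a j k) \<le> 1 / (\<eta> * a)"
proof -
  let ?R = "resolvent n h \<eta>" and ?D = "resolvent n g a"
  have "(\<Sum>j<n. cmod (?R i j) * cmod (?D j k))\<^sup>2 \<le> (\<Sum>j<n. (cmod (?R i j))\<^sup>2) * (\<Sum>j<n. (cmod (?D j k))\<^sup>2)"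
    by (rule Cauchy_Schwarz_ineq_sum)
  also have "\<dots> \<le> (1 / \<eta>\<^sup>2) * (1 / a\<^sup>2)"
    by (intro mult_mono resolvent_row_bound resolvent_col_bound assms sum_nonneg) auto
  also have "\<dots> = (1 / (\<eta> * a))\<^sup>2" by (simp add: power_divide power_mult_distrib)
  finally have "(\<Sum>j<n. cmod (?R i j) * cmod (?D j k)) \<le> 1 / (\<eta> * a)"
    using \<eta> by (rule_tac power2_le_imp_le) auto
  then show ?thesis by (intro order_trans[OF norm_sum]) (simp add: norm_mult)
qed

text \<open>With G the shifted matrices, R - D = R (G_D - G_R) D. Both the matrices and the shifts
  may differ: the same identity compares the random matrix at \<eta> with its deterministic part at
  \<open>a\<close>, and tracks the change of one entry at fixed \<eta>.\<close>

lemma resolvent_identity: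
  assumes h: "hermitian_on n h" "hermitian_on n g" and \<eta>: "\<eta> > 0" "a > 0" and ik: "i < n" "k < n"
  shows "resolvent n h \<eta> i k - resolvent n g a i k =
    (\<Sum>p<n. \<Sum>q<n. resolvent n h \<eta> i p * (shifted g a p q - shifted h \<eta> p q) * resolvent n g a q k)"
proof -
  let ?R = "resolvent n h \<eta>" and ?D = "resolvent n g a"
  have "(\<Sum>p<n. \<Sum>q<n. ?R i p * (shifted g a p q - shifted h \<eta> p q) * ?D q k) =
     (\<Sum>p<n. \<Sum>q<n. ?R i p * shifted g a p q * ?D q k) - (\<Sum>p<n. \<Sum>q<n. ?R i p * shifted h \<eta> p q * ?D q k)"
    by (simp add: sum_subtractf algebra_simps)
  also have "(\<Sum>p<n. \<Sum>q<n. ?R i p * shifted g a p q * ?D q k) = (\<Sum>p<n. ?R i p * (\<Sum>q<n. shifted g a p q * ?D q k))"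
    by (simp add: sum_distrib_left mult.assoc)
  also have "\<dots> = (\<Sum>p<n. if p = k then ?R i p else 0)"
    by (intro sum.cong refl) (simp add: resolvent_inverse(1)[OF h(2) \<eta>(2) _ ik(2)])
  also have "\<dots> = ?R i k" using ik by simp
  also have "(\<Sum>p<n. \<Sum>q<n. ?R i p * shifted h \<eta> p q * ?D q k) = (\<Sum>q<n. \<Sum>p<n. ?R i p * shifted h \<eta> p q * ?D q k)"
    by (rule sum.swap)
  also have "\<dots> = (\<Sum>q<n. (\<Sum>p<n. ?R i p * shifted h \<eta> p q) * ?D q k)"
    by (simp add: sum_distrib_right)
  also have "\<dots> = (\<Sum>q<n. if q = i then ?D q k else 0)"
    by (intro sum.cong refl) (auto simp: resolvent_inverse(2)[OF h(1) \<eta>(1) ik(1)])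
  also have "\<dots> = ?D i k" using ik by simp
  finally show ?thesis by simp
qed

text \<open>Only the positions (p, q) and (q, p) differ, so the double sum of the resolvent identity
  collapses to two terms. Each is exact, with one factor taken from \<open>h\<close> and the other
  from \<open>g\<close>.\<close>

lemma resolvent_perturbation:
  assumes h: "hermitian_on n h" "hermitian_on n g" and \<eta>: "\<eta> > 0" and ik: "i < n" "k < n"
    and pq: "p < n" "q < n" "p \<noteq> q"
    and diff: "\<And>r s. r < n \<Longrightarrow> s < n \<Longrightarrow> g r s - h r s =
      (if r = p \<and> s = q then x else if r = q \<and> s = p then y else 0)"
  shows "resolvent n h \<eta> i k - resolvent n g \<eta> i k =
    x * resolvent n h \<eta> i p * resolvent n g \<eta> q k + y * resolvent n h \<eta> i q * resolvent n g \<eta> p k"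
proof -
  let ?R = "resolvent n h \<eta>" and ?D = "resolvent n g \<eta>"
  have "?R i k - ?D i k = (\<Sum>r<n. \<Sum>s<n. ?R i r * (g r s - h r s) * ?D s k)"
    by (subst resolvent_identity[OF h \<eta> \<eta> ik]) (simp add: shifted_def)
  also have "\<dots> = (\<Sum>r<n. \<Sum>s<n. (if r = p then if s = q then ?R i r * x * ?D s k else 0 else 0) +
        (if r = q then if s = p then ?R i r * y * ?D s k else 0 else 0))"
    using pq by (intro sum.cong refl) (auto simp: diff)
  also have "\<dots> = (\<Sum>r<n. (if r = p then \<Sum>s<n. if s = q then ?R i r * x * ?D s k else 0 else 0)) +
        (\<Sum>r<n. (if r = q then \<Sum>s<n. if s = p then ?R i r * y * ?D s k else 0 else 0))"
    unfolding sum.distrib by (intro arg_cong2[of _ _ _ _ "(+)"] sum.cong refl) auto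
  also have "\<dots> = x * ?R i p * ?D q k + y * ?R i q * ?D p k"
    using pq by simp
  finally show ?thesis .
qed

section \<open>Hermitization and its block structure\<close>

text \<open>The block matrix of size 2 N with \<open>w\<close> in the upper right corner, its
  adjoint in the lower left one and zero diagonal blocks. Unlike the Gram matrix, it is linear over
  the reals in \<open>w\<close>, and one entry of \<open>w\<close> occupies just two
  positions.\<close>

definition hermitization :: "nat \<Rightarrow> (nat \<Rightarrow> nat \<Rightarrow> complex) \<Rightarrow> nat \<Rightarrow> nat \<Rightarrow> complex" where
  "hermitization N w i j =
     (if i < N \<and> N \<le> j then w i (j - N) else if N \<le> i \<and> j < N then cnj (w j (i - N)) else 0)"

lemma hermitian_on_hermitization: "hermitian_on n (hermitization N w)"
  by (auto simp: hermitian_on_def hermitization_def)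

lemma sum_lessThan_double:
  fixes f :: "nat \<Rightarrow> 'a :: comm_monoid_add"
  shows "(\<Sum>j<2 * N. f j) = (\<Sum>j<N. f j) + (\<Sum>j<N. f (N + j))"
proof -
  have "(\<Sum>j<2 * N. f j) = (\<Sum>j\<in>{..<N} \<union> {N..<N + N}. f j)" by (rule sum.cong) auto
  also have "\<dots> = (\<Sum>j<N. f j) + (\<Sum>j\<in>{N..<N + N}. f j)" by (rule sum.union_disjoint) auto
  also have "(\<Sum>j\<in>{N..<N + N}. f j) = (\<Sum>j<N. f (N + j))"
    by (rule sum.reindex_bij_witness[of _ "\<lambda>j. N + j" "\<lambda>j. j - N"]) auto
  finally show ?thesis .
qed

text \<open>Four of the block equations saying that R is a two-sided inverse. The first two
  determine the upper left block through the Gram matrix, the last two compare the traces of the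
  diagonal blocks.\<close>

lemma hermitization_blocks:
  fixes N :: nat and w :: "nat \<Rightarrow> nat \<Rightarrow> complex"
  assumes \<eta>: "\<eta> > 0" and N: "i < N" "k < N" "j < N" "l < N"
  defines "R \<equiv> resolvent (2 * N) (hermitization N w) \<eta>"
  shows "(\<Sum>j<N. w i j * R (N + j) k) - \<i> * of_real \<eta> * R i k = (if i = k then 1 else 0)"
    and "(\<Sum>i<N. cnj (w i j) * R i k) = \<i> * of_real \<eta> * R (N + j) k"
    and "(\<Sum>i<N. cnj (w i j) * R i (N + l)) - \<i> * of_real \<eta> * R (N + j) (N + l) = (if j = l then 1 else 0)"
    and "(\<Sum>j<N. R i (N + j) * cnj (w k j)) - \<i> * of_real \<eta> * R i k = (if i = k then 1 else 0)"
proof -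
  let ?h = "hermitization N w"
  have row: "(\<Sum>s<2 * N. ?h r s * R s t) - \<i> * of_real \<eta> * R r t = (if r = t then 1 else 0)"
    if "r < 2 * N" "t < 2 * N" for r t
    using resolvent_inverse(1)[OF hermitian_on_hermitization \<eta> that, of N w] that
    by (simp add: sum_shifted_mult R_def)
  have col: "(\<Sum>s<2 * N. R t s * ?h s r) - \<i> * of_real \<eta> * R t r = (if t = r then 1 else 0)"
    if "r < 2 * N" "t < 2 * N" for r t
  proof -
    have "(\<Sum>s<2 * N. R t s * shifted ?h \<eta> s r) = (\<Sum>s<2 * N. shifted (\<lambda>i j. ?h j i) \<eta> r s * R t s)"
      by (simp add: shifted_transpose[of ?h] mult.commute)
    also have "\<dots> = (\<Sum>s<2 * N. ?h s r * R t s) - \<i> * of_real \<eta> * R t r"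
      using that by (simp add: sum_shifted_mult)
    finally show ?thesis
      using resolvent_inverse(2)[OF hermitian_on_hermitization \<eta> that(2,1), of N w]
      by (simp add: R_def mult.commute)
  qed
  show "(\<Sum>j<N. w i j * R (N + j) k) - \<i> * of_real \<eta> * R i k = (if i = k then 1 else 0)"
    using row[of i k] N by (simp add: sum_lessThan_double hermitization_def)
  show "(\<Sum>i<N. cnj (w i j) * R i k) = \<i> * of_real \<eta> * R (N + j) k"
    using row[of "N + j" k] N by (simp add: sum_lessThan_double hermitization_def)
  show "(\<Sum>i<N. cnj (w i j) * R i (N + l)) - \<i> * of_real \<eta> * R (N + j) (N + l) = (if j = l then 1 else 0)"
    using row[of "N + j" "N + l"] N by (simp add: sum_lessThan_double hermitization_def)
  show "(\<Sum>j<N. R i (N + j) * cnj (w k j)) - \<i> * of_real \<eta> * R i k = (if i = k then 1 else 0)"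
    using col[of k i] N by (simp add: sum_lessThan_double hermitization_def)
qed

text \<open>Up to the same affine map, the two diagonal blocks are the products of the upper right
  block of R with the adjoint of \<open>w\<close>, taken in the two orders; these products have
  equal traces.\<close>

lemma resolvent_hermitization_block_traces:
  fixes N :: nat and w :: "nat \<Rightarrow> nat \<Rightarrow> complex"
  assumes \<eta>: "\<eta> > 0"
  defines "R \<equiv> resolvent (2 * N) (hermitization N w) \<eta>"
  shows "(\<Sum>j<N. R (N + j) (N + j)) = (\<Sum>i<N. R i i)"
proof -
  have "of_nat N + \<i> * of_real \<eta> * (\<Sum>i<N. R i i) = (\<Sum>i<N. 1 + \<i> * of_real \<eta> * R i i)"
    by (simp add: sum.distrib sum_distrib_left)
  also have "\<dots> = (\<Sum>i<N. \<Sum>j<N. R i (N + j) * cnj (w i j))"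
    by (intro sum.cong refl) (use hermitization_blocks(4)[OF \<eta>, of _ N _ _ _ w] in \<open>auto simp: R_def algebra_simps\<close>)
  also have "\<dots> = (\<Sum>j<N. \<Sum>i<N. R i (N + j) * cnj (w i j))" by (rule sum.swap)
  also have "\<dots> = (\<Sum>j<N. 1 + \<i> * of_real \<eta> * R (N + j) (N + j))"
    by (intro sum.cong refl) (use hermitization_blocks(3)[OF \<eta>, of _ N _ _ _ w] in \<open>auto simp: R_def algebra_simps\<close>)
  also have "\<dots> = of_nat N + \<i> * of_real \<eta> * (\<Sum>j<N. R (N + j) (N + j))"
    by (simp add: sum.distrib sum_distrib_left)
  finally show ?thesis using \<eta> by simp
qed

text \<open>Eliminating the lower left block from the first two block equations shows that the upper
  left block of R is \<i> \<eta> times the inverse of W + \<eta>^2, where W is the Gram matrix of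
  \<open>w\<close>. This is how the point t = \<eta>^2 enters.\<close>

lemma resolvent_hermitization_gram:
  fixes N :: nat and w :: "nat \<Rightarrow> nat \<Rightarrow> complex"
  assumes \<eta>: "\<eta> > 0" and N: "i < N" "k < N"
  defines "R \<equiv> resolvent (2 * N) (hermitization N w) \<eta>"
  shows "(\<Sum>l<N. ((\<Sum>j<N. w i j * cnj (w l j)) + (if i = l then of_real (\<eta>\<^sup>2) else 0)) * R l k) =
    (if i = k then \<i> * of_real \<eta> else 0)"
proof -
  have "(\<Sum>l<N. ((\<Sum>j<N. w i j * cnj (w l j)) + (if i = l then of_real (\<eta>\<^sup>2) else 0)) * R l k) =
      (\<Sum>l<N. \<Sum>j<N. w i j * cnj (w l j) * R l k) + (\<Sum>l<N. if l = i then of_real (\<eta>\<^sup>2) * R l k else 0)"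
    unfolding sum.distrib[symmetric] by (intro sum.cong refl) (auto simp: sum_distrib_right distrib_right)
  also have "(\<Sum>l<N. \<Sum>j<N. w i j * cnj (w l j) * R l k) = (\<Sum>j<N. \<Sum>l<N. w i j * cnj (w l j) * R l k)"
    by (rule sum.swap)
  also have "\<dots> = (\<Sum>j<N. w i j * (\<Sum>l<N. cnj (w l j) * R l k))"
    by (simp add: sum_distrib_left mult.assoc)
  also have "\<dots> = (\<Sum>j<N. w i j * (\<i> * of_real \<eta> * R (N + j) k))"
    by (intro sum.cong refl) (use N hermitization_blocks(2)[OF \<eta>, of i N k _ _ w] in \<open>auto simp: R_def\<close>)
  also have "\<dots> = \<i> * of_real \<eta> * (\<Sum>j<N. w i j * R (N + j) k)"
    by (simp add: sum_distrib_left algebra_simps)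
  also have "(\<Sum>j<N. w i j * R (N + j) k) = (if i = k then 1 else 0) + \<i> * of_real \<eta> * R i k"
    using hermitization_blocks(1)[OF \<eta> N N, of w] by (simp add: R_def algebra_simps)
  also have "(\<Sum>l<N. if l = i then of_real (\<eta>\<^sup>2) * R l k else 0) = of_real (\<eta>\<^sup>2) * R i k"
    using N by simp
  finally show ?thesis by (simp add: algebra_simps power2_eq_square)
qed

section \<open>Spectral distributions of Gram matrices\<close>

text \<open>Solving along row i from the left forces the entries of \<open>z\<close> before the
  diagonal to vanish, so \<open>z\<close> is upper triangular too, and the diagonal entry can be
  read off.\<close>

lemma upper_triangular_left_inverse_diag:
  fixes t z :: "nat \<Rightarrow> nat \<Rightarrow> 'a :: field"
  assumes upper: "\<And>i j. i < n \<Longrightarrow> j < i \<Longrightarrow> t i j = 0"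
    and diag: "\<And>i. i < n \<Longrightarrow> t i i \<noteq> 0"
    and inv: "\<And>i j. i < n \<Longrightarrow> j < n \<Longrightarrow> (\<Sum>k<n. z i k * t k j) = (if i = j then c else 0)"
    and i: "i < n"
  shows "z i i = c / t i i"
proof -
  \<comment> \<open>Terms with k < j vanish by assumption on \<open>z\<close>, those with k > j
    because \<open>t\<close> is triangular.\<close>
  have sum_eq: "(\<Sum>k<n. z i k * t k j) = z i j * t j j"
    if j: "j < n" and zero: "\<And>k. k < j \<Longrightarrow> z i k = 0" for j
  proof -
    have "(\<Sum>k<n. z i k * t k j) = (\<Sum>k<n. if k = j then z i j * t j j else 0)"
    proof (rule sum.cong[OF refl])
      fix k assume "k \<in> {..<n}"
      then show "z i k * t k j = (if k = j then z i j * t j j else 0)"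
        using zero[of k] upper[of k j] by (cases k j rule: linorder_cases) auto
    qed
    then show ?thesis using j by simp
  qed
  have low: "z i j = 0" if "j < i" for j
    using that
  proof (induction j rule: less_induct)
    case (less j)
    have "z i j * t j j = 0"
      using sum_eq[of j] inv[of i j] less i by simp
    then show ?case using diag[of j] less i by simp
  qed
  then have "z i i * t i i = c" using sum_eq[of i] inv[of i i] i by simp
  then show ?thesis using diag[OF i] by (simp add: field_simps)
qed

lemma trace_comm:
  fixes A B :: "'a :: comm_semiring_0 mat"
  assumes "A \<in> carrier_mat n n" "B \<in> carrier_mat n n"
  shows "(\<Sum>i<n. (A * B) $$ (i, i)) = (\<Sum>i<n. (B * A) $$ (i, i))"
proof -
  have "(\<Sum>i<n. (A * B) $$ (i, i)) = (\<Sum>i<n. \<Sum>l<n. A $$ (i, l) * B $$ (l, i))"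
    by (intro sum.cong refl index_mult_mat_sum[OF assms]) auto
  also have "\<dots> = (\<Sum>l<n. \<Sum>i<n. B $$ (l, i) * A $$ (i, l))"
    by (subst sum.swap) (simp add: mult.commute)
  also have "\<dots> = (\<Sum>i<n. (B * A) $$ (i, i))"
    by (intro sum.cong refl index_mult_mat_sum[OF assms(2,1), symmetric]) auto
  finally show ?thesis .
qed

text \<open>A Schur form P = U B V with V inverse to U is enough: V Q U inverts the triangular
  matrix B + u up to the factor \<open>c\<close>, so its diagonal entries are c / (e + u), and
  conjugation preserves the trace. The list \<open>es\<close> records each eigenvalue with its
  algebraic multiplicity.\<close>

lemma trace_shifted_inverse:
  fixes P Q :: "complex mat"
  assumes P: "P \<in> carrier_mat n n" and Q: "Q \<in> carrier_mat n n"
    and char: "char_poly P = (\<Prod>e\<leftarrow>es. [:- e, 1:])"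
    and inv: "(P + u \<cdot>\<^sub>m 1\<^sub>m n) * Q = c \<cdot>\<^sub>m 1\<^sub>m n" and c: "c \<noteq> 0"
    and nz: "\<And>e. e \<in> set es \<Longrightarrow> e + u \<noteq> 0"
  shows "(\<Sum>i<n. Q $$ (i, i)) = (\<Sum>e\<leftarrow>es. c / (e + u))"
proof -
  obtain B U V where "schur_decomposition P es = (B, U, V)"
    by (cases "schur_decomposition P es") auto
  from schur_decomposition[OF P char this]
  have sim: "similar_mat_wit P B U V" and upper: "upper_triangular B" and diag: "diag_mat B = es"
    by auto
  from similar_mat_witD2[OF P sim]
  have UV: "U * V = 1\<^sub>m n" and VU: "V * U = 1\<^sub>m n" and PB: "P = U * B * V"
    and B: "B \<in> carrier_mat n n" and U: "U \<in> carrier_mat n n" and V: "V \<in> carrier_mat n n"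
    by auto
  have len: "length es = n" using diag B by (auto simp: diag_mat_def)
  have es: "es ! i = B $$ (i, i)" if "i < n" for i
    using that B by (subst diag[symmetric]) (simp add: diag_mat_def)
  define T where "T = B + u \<cdot>\<^sub>m 1\<^sub>m n"
  define Z where "Z = V * (Q * U)"
  have T: "T \<in> carrier_mat n n" and Z: "Z \<in> carrier_mat n n"
    using B Q U V by (auto simp: T_def Z_def)
  have "V * P = (V * U) * (B * V)"
    unfolding PB using B U V by (simp add: assoc_mult_mat[of _ n n _ n _ n])
  then have VP: "V * P = B * V" using VU B V by simp
  have "V * (P + u \<cdot>\<^sub>m 1\<^sub>m n) = B * V + u \<cdot>\<^sub>m V"
    using V P by (simp add: mult_add_distrib_mat[of _ n n _ n] VP mult_smult_distrib[of _ n n _ n])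
  also have "\<dots> = T * V"
    unfolding T_def using V B
    by (simp add: add_mult_distrib_mat[of _ n n _ _ n] mult_smult_assoc_mat[of _ n n _ n])
  finally have VT: "V * (P + u \<cdot>\<^sub>m 1\<^sub>m n) = T * V" .
  have "T * Z = (T * V) * (Q * U)"
    unfolding Z_def using T V Q U by (simp add: assoc_mult_mat[of _ n n _ n _ n])
  also have "\<dots> = V * (((P + u \<cdot>\<^sub>m 1\<^sub>m n) * Q) * U)"
    unfolding VT[symmetric] using V P Q U by (simp add: assoc_mult_mat[of _ n n _ n _ n])
  also have "\<dots> = c \<cdot>\<^sub>m 1\<^sub>m n"
    unfolding inv using V U VU
    by (simp add: mult_smult_assoc_mat[of _ n n _ n] mult_smult_distrib[of _ n n _ n])
  finally have TZ: "T * Z = c \<cdot>\<^sub>m 1\<^sub>m n" .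
  have "T * ((1 / c) \<cdot>\<^sub>m Z) = (1 / c) \<cdot>\<^sub>m (c \<cdot>\<^sub>m 1\<^sub>m n)"
    using T Z by (simp add: mult_smult_distrib[of _ n n _ n] TZ)
  also have "\<dots> = 1\<^sub>m n" using c by (intro eq_matI) auto
  finally have "T * ((1 / c) \<cdot>\<^sub>m Z) = 1\<^sub>m n" .
  \<comment> \<open>The triangular lemma reads the diagonal of a left inverse, whereas
    \<open>inv\<close> provides a right one; for square matrices the two coincide.\<close>
  then have ZT: "((1 / c) \<cdot>\<^sub>m Z) * T = 1\<^sub>m n"
    by (rule mat_mult_left_right_inverse[OF T, rotated]) (use Z in simp)
  have Zii: "(1 / c) * Z $$ (i, i) = 1 / T $$ (i, i)" if "i < n" for i
  proof (rule upper_triangular_left_inverse_diag[where t = "\<lambda>i j. T $$ (i, j)" and z = "\<lambda>i j. (1 / c) * Z $$ (i, j)", OF _ _ _ that])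
    show "T $$ (i, j) = 0" if "i < n" "j < i" for i j
      using that upper B by (auto simp: T_def upper_triangular_def)
    show "T $$ (i, i) \<noteq> 0" if "i < n" for i
      using that nz[of "es ! i"] B len by (simp add: T_def es[symmetric])
    show "(\<Sum>k<n. 1 / c * Z $$ (i, k) * T $$ (k, j)) = (if i = j then 1 else 0)" if "i < n" "j < n" for i j
    proof -
      have "(\<Sum>k<n. 1 / c * Z $$ (i, k) * T $$ (k, j)) = (((1 / c) \<cdot>\<^sub>m Z) * T) $$ (i, j)"
        using Z T that by (subst index_mult_mat_sum[of _ n n _ n]) (auto intro!: sum.cong)
      then show ?thesis using that by (simp add: ZT)
    qed
  qed
  have "(\<Sum>i<n. Q $$ (i, i)) = (\<Sum>i<n. (Q * (U * V)) $$ (i, i))" using Q by (simp add: UV)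
  also have "\<dots> = (\<Sum>i<n. ((Q * U) * V) $$ (i, i))"
    using Q U V by (simp add: assoc_mult_mat[of _ n n _ n _ n])
  also have "\<dots> = (\<Sum>i<n. Z $$ (i, i))"
    unfolding Z_def using Q U V by (intro trace_comm) auto
  also have "\<dots> = (\<Sum>i<n. c / (es ! i + u))"
  proof (intro sum.cong refl)
    fix i assume "i \<in> {..<n}"
    then show "Z $$ (i, i) = c / (es ! i + u)"
      using Zii[of i] c B by (simp add: T_def es field_simps)
  qed
  also have "\<dots> = (\<Sum>e\<leftarrow>es. c / (e + u))"
    using len by (simp add: sum_list_sum_nth lessThan_atLeast0)
  finally show ?thesis .
qed

text \<open>For an eigenvector v, e |v|^2 is the squared norm of the adjoint of \<open>w\<close>
  applied to v.\<close>

lemma gram_eigenvalue_nonneg: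
  fixes w :: "nat \<Rightarrow> nat \<Rightarrow> complex"
  assumes P: "P \<in> carrier_mat n n"
    and gram: "\<And>i l. i < n \<Longrightarrow> l < n \<Longrightarrow> P $$ (i, l) = (\<Sum>j<n. w i j * cnj (w l j))"
    and e: "eigenvalue P e"
  shows "e = of_real (Re e)" "Re e \<ge> 0"
proof -
  obtain v where v: "v \<in> carrier_vec n" "v \<noteq> 0\<^sub>v n" "P *\<^sub>v v = e \<cdot>\<^sub>v v"
    using e P by (auto simp: eigenvalue_def eigenvector_def)
  define x where "x = vec_index v"
  define V where "V = (\<Sum>i<n. (cmod (x i))\<^sup>2)"
  define K where "K = (\<Sum>j<n. (cmod (\<Sum>l<n. cnj (w l j) * x l))\<^sup>2)"
  have "V \<noteq> 0"
  proof
    assume "V = 0"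
    then have "\<forall>i<n. x i = 0" unfolding V_def by (subst (asm) sum_nonneg_eq_0_iff) auto
    then have "v = 0\<^sub>v n" using v(1) by (intro eq_vecI) (auto simp: x_def)
    with v(2) show False by simp
  qed
  then have V: "V > 0" by (auto simp: V_def less_le sum_nonneg)
  have "e * of_real V = (\<Sum>i<n. cnj (x i) * (e * x i))"
    by (simp add: V_def sum_distrib_left complex_norm_square algebra_simps del: of_real_power)
  also have "\<dots> = (\<Sum>i<n. cnj (x i) * (\<Sum>l<n. P $$ (i, l) * x l))"
  proof (intro sum.cong refl)
    fix i assume i: "i \<in> {..<n}"
    have "e * x i = vec_index (P *\<^sub>v v) i" using v i by (simp add: x_def)
    also have "\<dots> = (\<Sum>l<n. P $$ (i, l) * x l)"
      using v(1) i P by (simp add: scalar_prod_def lessThan_atLeast0 x_def)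
    finally show "cnj (x i) * (e * x i) = cnj (x i) * (\<Sum>l<n. P $$ (i, l) * x l)" by simp
  qed
  also have "\<dots> = (\<Sum>i<n. \<Sum>l<n. \<Sum>j<n. cnj (x i) * w i j * (cnj (w l j) * x l))"
    by (intro sum.cong refl) (auto simp: gram sum_distrib_left sum_distrib_right mult.assoc intro!: sum.cong)
  also have "\<dots> = (\<Sum>i<n. \<Sum>j<n. \<Sum>l<n. cnj (x i) * w i j * (cnj (w l j) * x l))"
    by (intro sum.cong refl sum.swap)
  also have "\<dots> = (\<Sum>j<n. \<Sum>i<n. \<Sum>l<n. cnj (x i) * w i j * (cnj (w l j) * x l))"
    by (rule sum.swap)
  also have "\<dots> = (\<Sum>j<n. (\<Sum>i<n. cnj (x i) * w i j) * (\<Sum>l<n. cnj (w l j) * x l))"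
    by (simp add: sum_product)
  also have "\<dots> = (\<Sum>j<n. cnj (\<Sum>l<n. cnj (w l j) * x l) * (\<Sum>l<n. cnj (w l j) * x l))"
    by (simp add: mult.commute)
  also have "\<dots> = of_real K"
    unfolding K_def of_real_sum by (intro sum.cong refl) (simp only: complex_norm_square mult.commute)
  finally have "e = of_real (K / V)" using V by (simp add: field_simps)
  moreover have "K / V \<ge> 0" using V by (simp add: K_def sum_nonneg)
  ultimately show "e = of_real (Re e)" "Re e \<ge> 0" by simp_all
qed

lemma sum_list_map_eq_sum_count_list:
  fixes g :: "'a \<Rightarrow> real"
  assumes "finite A" "set xs \<subseteq> A"
  shows "(\<Sum>x\<leftarrow>xs. g x) = (\<Sum>x\<in>A. real (count_list xs x) * g x)"
  using assms(2)
proof (induction xs)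
  case (Cons y xs)
  have "(\<Sum>x\<in>A. real (count_list (y # xs) x) * g x) =
      (\<Sum>x\<in>A. real (count_list xs x) * g x + (if x = y then g x else 0))"
    by (rule sum.cong) (auto simp: distrib_right)
  then show ?case using Cons assms(1) by (simp add: sum.distrib)
qed simp

lemma integral_esd_real:
  fixes f :: "real \<Rightarrow> real"
  assumes P: "P \<in> carrier_mat n n" "n \<ge> 1"
    and char: "char_poly P = (\<Prod>e\<leftarrow>es. [:- e, 1:])" and len: "length es = n"
    and f: "f \<in> borel_measurable borel"
  shows "(\<integral>x. f x \<partial>esd_real P) = (\<Sum>e\<leftarrow>es. f (Re e)) / n"
proof -
  have "proots (char_poly P) = sum_list (map proots (map (\<lambda>e. [:- e, 1:]) es))"
    unfolding char by (subst proots_prod_list[of "map (\<lambda>e. [:- e, 1:]) es", simplified]) auto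
  also have "\<dots> = mset es" by (induction es) auto
  finally have roots: "proots (char_poly P) = mset es" .
  have ne: "mset es \<noteq> {#}" using len P(2) by auto
  have Re_meas: "Re \<in> borel_measurable (borel :: complex measure)" by simp
  have "(\<integral>x. f x \<partial>esd_real P) = (\<integral>z. f (Re z) \<partial>esd P)"
    unfolding esd_real_def by (rule integral_distr) (use f in \<open>auto simp: esd_def\<close>)
  also have "\<dots> = (\<integral>z. f (Re z) \<partial>measure_pmf (pmf_of_multiset (mset es)))"
    unfolding esd_def roots by (rule integral_distr) (use f in measurable)
  also have "\<dots> = (\<Sum>z\<in>set es. pmf (pmf_of_multiset (mset es)) z *\<^sub>R f (Re z))"
    by (rule integral_measure_pmf) (use ne in auto)
  also have "\<dots> = (\<Sum>z\<in>set es. real (count (mset es) z) * f (Re z)) / n"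
    using ne len by (simp add: sum_divide_distrib)
  also have "(\<Sum>z\<in>set es. real (count (mset es) z) * f (Re z)) = (\<Sum>e\<leftarrow>es. f (Re e))"
    by (subst sum_list_map_eq_sum_count_list[of "set es"]) (auto simp: count_mset)
  finally show ?thesis .
qed

text \<open>Equal to \<open>1 / (x + t)\<close> on \<open>[0, \<infinity>)\<close>, and made bounded and continuous on the whole line.\<close>

definition resolvent_test :: "real \<Rightarrow> real \<Rightarrow> real" where
  "resolvent_test t x = 1 / (max x 0 + t)"

lemma shifted_gram_mat:
  assumes A: "A \<in> carrier_mat N N"
  shows "shifted_gram A z \<in> carrier_mat N N"
    and "\<And>i l. i < N \<Longrightarrow> l < N \<Longrightarrow> shifted_gram A z $$ (i, l) =
      (\<Sum>j<N. (A $$ (i, j) - (if i = j then z else 0)) * cnj (A $$ (l, j) - (if l = j then z else 0)))"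
proof -
  define w where "w = (\<lambda>i j. A $$ (i, j) - (if i = j then z else 0))"
  have W: "A - z \<cdot>\<^sub>m 1\<^sub>m (dim_row A) = Matrix.mat N N (\<lambda>(i, j). w i j)"
    using A by (intro eq_matI) (auto simp: w_def)
  have adj: "mat_adjoint (Matrix.mat N N (\<lambda>(i, j). w i j)) = Matrix.mat N N (\<lambda>(i, j). cnj (w j i))"
    by (intro eq_matI) (auto simp: mat_adjoint_def mat_of_rows_def cols_def)
  show "shifted_gram A z \<in> carrier_mat N N"
    unfolding shifted_gram_def W adj by (rule mult_carrier_mat[of _ N N]) auto
  show "shifted_gram A z $$ (i, l) =
      (\<Sum>j<N. (A $$ (i, j) - (if i = j then z else 0)) * cnj (A $$ (l, j) - (if l = j then z else 0)))"
    if "i < N" "l < N" for i l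
    unfolding shifted_gram_def W adj using that
    by (subst index_mult_mat_sum[of _ N N _ N]) (auto intro!: sum.cong simp: w_def)
qed

lemma shifted_gram_spectrum:
  assumes A: "A \<in> carrier_mat N N"
  obtains es where "char_poly (shifted_gram A z) = (\<Prod>e\<leftarrow>es. [:- e, 1:])" "length es = N"
    and "\<And>e. e \<in> set es \<Longrightarrow> e = of_real (Re e)" "\<And>e. e \<in> set es \<Longrightarrow> Re e \<ge> 0"
proof -
  note P = shifted_gram_mat(1)[OF A, of z]
  obtain es where es: "char_poly (shifted_gram A z) = (\<Prod>e\<leftarrow>es. [:- e, 1:])" "length es = N"
    using char_poly_factorized[OF P] by blast
  have e: "e = of_real (Re e) \<and> Re e \<ge> 0" if "e \<in> set es" for e
  proof -
    have "poly (char_poly (shifted_gram A z)) e = 0"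
      unfolding es(1) using that by (induction es) auto
    then have "eigenvalue (shifted_gram A z) e" using eigenvalue_root_char_poly[OF P] by simp
    from gram_eigenvalue_nonneg[OF P shifted_gram_mat(2)[OF A] this] show ?thesis by auto
  qed
  show ?thesis by (rule that[OF es]) (use e in blast)+
qed

text \<open>The upper left block is \<i> \<eta> (W + \<eta>^2)^-1 with W the Gram matrix, so its
  trace is a linear statistic of the eigenvalues of W. This turns weak convergence of spectral
  distributions into convergence of resolvent traces, for the random matrix as well as for its
  deterministic part.\<close>

lemma trace_resolvent_hermitization:
  fixes A :: "complex mat" and z :: complex
  assumes A: "A \<in> carrier_mat N N" and N: "N \<ge> 1" and \<eta>: "\<eta> > 0"
  defines "w \<equiv> \<lambda>i j. A $$ (i, j) - (if i = j then z else 0)"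
  shows "(\<Sum>i<N. resolvent (2 * N) (hermitization N w) \<eta> i i) =
    \<i> * of_real (\<eta> * real N * (\<integral>x. resolvent_test (\<eta>\<^sup>2) x \<partial>esd_real (shifted_gram A z)))"
proof -
  define R where "R = resolvent (2 * N) (hermitization N w) \<eta>"
  define P where "P = shifted_gram A z"
  define Q where "Q = Matrix.mat N N (\<lambda>(i, j). R i j)"
  have P: "P \<in> carrier_mat N N"
    unfolding P_def by (rule shifted_gram_mat[OF A])
  have Q: "Q \<in> carrier_mat N N" by (simp add: Q_def)
  have gram: "P $$ (i, l) = (\<Sum>j<N. w i j * cnj (w l j))" if "i < N" "l < N" for i l
    unfolding P_def w_def by (rule shifted_gram_mat(2)[OF A that])
  obtain es where es: "char_poly P = (\<Prod>e\<leftarrow>es. [:- e, 1:])" "length es = N"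
    and e: "\<And>e. e \<in> set es \<Longrightarrow> e = of_real (Re e)" "\<And>e. e \<in> set es \<Longrightarrow> Re e \<ge> 0"
    using shifted_gram_spectrum[OF A, of z] unfolding P_def by blast
  have inv: "(P + of_real (\<eta>\<^sup>2) \<cdot>\<^sub>m 1\<^sub>m N) * Q = (\<i> * of_real \<eta>) \<cdot>\<^sub>m 1\<^sub>m N"
  proof (rule eq_matI)
    fix i k assume "i < dim_row ((\<i> * of_real \<eta>) \<cdot>\<^sub>m 1\<^sub>m N)" "k < dim_col ((\<i> * of_real \<eta>) \<cdot>\<^sub>m 1\<^sub>m N :: complex mat)"
    then have ik: "i < N" "k < N" by auto
    have "((P + of_real (\<eta>\<^sup>2) \<cdot>\<^sub>m 1\<^sub>m N) * Q) $$ (i, k) =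
       (\<Sum>l<N. ((\<Sum>j<N. w i j * cnj (w l j)) + (if i = l then of_real (\<eta>\<^sup>2) else 0)) * R l k)"
      using P Q ik by (subst index_mult_mat_sum[of _ N N _ N]) (auto intro!: sum.cong simp: gram Q_def)
    then show "((P + of_real (\<eta>\<^sup>2) \<cdot>\<^sub>m 1\<^sub>m N) * Q) $$ (i, k) = ((\<i> * of_real \<eta>) \<cdot>\<^sub>m 1\<^sub>m N) $$ (i, k)"
      using resolvent_hermitization_gram[OF \<eta> ik, of w] ik by (simp add: R_def)
  qed (use P Q in auto)
  have "(\<Sum>i<N. R i i) = (\<Sum>i<N. Q $$ (i, i))" by (simp add: Q_def)
  also have "\<dots> = (\<Sum>e\<leftarrow>es. (\<i> * of_real \<eta>) / (e + of_real (\<eta>\<^sup>2)))"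
  proof (rule trace_shifted_inverse[OF P Q es(1) inv])
    show "e + of_real (\<eta>\<^sup>2) \<noteq> 0" if "e \<in> set es" for e
    proof -
      have "Re e + \<eta>\<^sup>2 > 0" using e(2)[OF that] \<eta> by (simp add: add_nonneg_pos)
      then show ?thesis by (metis Re_complex_of_real less_irrefl plus_complex.sel(1) zero_complex.sel(1))
    qed
  qed (use \<eta> in auto)
  also have "\<dots> = (\<Sum>e\<leftarrow>es. \<i> * of_real \<eta> * of_real (resolvent_test (\<eta>\<^sup>2) (Re e)))"
  proof (intro arg_cong[of _ _ sum_list] map_cong refl)
    fix e assume "e \<in> set es"
    with e[of e] show "\<i> * of_real \<eta> / (e + of_real (\<eta>\<^sup>2)) = \<i> * of_real \<eta> * of_real (resolvent_test (\<eta>\<^sup>2) (Re e))"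
      by (auto simp: resolvent_test_def max_def)
  qed
  also have "\<dots> = \<i> * of_real (\<eta> * (\<Sum>e\<leftarrow>es. resolvent_test (\<eta>\<^sup>2) (Re e)))"
    by (induction es) (auto simp: algebra_simps)
  also have "(\<Sum>e\<leftarrow>es. resolvent_test (\<eta>\<^sup>2) (Re e)) = real N * (\<integral>x. resolvent_test (\<eta>\<^sup>2) x \<partial>esd_real P)"
    using N by (subst integral_esd_real[OF P N es]) (auto simp: resolvent_test_def[abs_def])
  finally show ?thesis by (simp add: R_def P_def mult.assoc)
qed

text \<open>The test function is bounded, continuous and positive exactly on the negative half-line,
  so that weak limits of these measures can be shown to live on [0, \<infinity>).\<close>

lemma integral_esd_real_negative_part:
  assumes A: "A \<in> carrier_mat N N" and N: "N \<ge> 1"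
  shows "(\<integral>x. min 1 (max 0 (- x)) \<partial>esd_real (shifted_gram A z)) = 0"
proof -
  obtain es where es: "char_poly (shifted_gram A z) = (\<Prod>e\<leftarrow>es. [:- e, 1:])" "length es = N"
    and e: "\<And>e. e \<in> set es \<Longrightarrow> Re e \<ge> 0"
    using shifted_gram_spectrum[OF A, of z] by blast
  have "(\<Sum>e\<leftarrow>es. min 1 (max 0 (- Re e))) = 0"
    using e by (induction es) auto
  then show ?thesis
    by (subst integral_esd_real[OF shifted_gram_mat(1)[OF A] N es]) auto
qed

section \<open>Expansion in a single entry\<close>

text \<open>The Leibniz formula exhibits the determinant as a polynomial in the entries.\<close>

lemma borel_measurable_det:
  fixes F :: "'a \<Rightarrow> complex mat"
  assumes "\<And>\<omega>. F \<omega> \<in> carrier_mat n n"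
    and "\<And>i j. i < n \<Longrightarrow> j < n \<Longrightarrow> (\<lambda>\<omega>. F \<omega> $$ (i, j)) \<in> borel_measurable M"
  shows "(\<lambda>\<omega>. Determinant.det (F \<omega>)) \<in> borel_measurable M"
proof -
  have "(\<lambda>\<omega>. \<Sum>p\<in>{p. p permutes {0..<n}}. signof p * (\<Prod>i = 0..<n. F \<omega> $$ (i, p i))) \<in> borel_measurable M"
  proof (intro borel_measurable_sum borel_measurable_times borel_measurable_const borel_measurable_prod assms(2))
    fix p i assume "p \<in> {p. p permutes {0..<n}}" "i \<in> {0..<n}"
    then show "i < n" "p i < n" using permutes_in_image[of p "{0..<n}" i] by auto
  qed
  then show ?thesis by (simp add: det_def'[OF assms(1)])
qed

lemma borel_measurable_resolvent:
  assumes "\<And>i j. i < n \<Longrightarrow> j < n \<Longrightarrow> (\<lambda>\<omega>. h \<omega> i j) \<in> borel_measurable M" "i < n" "k < n"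
  shows "(\<lambda>\<omega>. resolvent n (h \<omega>) \<eta> i k) \<in> borel_measurable M"
proof -
  define F where "F = (\<lambda>\<omega>. Matrix.mat n n (\<lambda>(i, j). shifted (h \<omega>) \<eta> i j))"
  have F: "F \<omega> \<in> carrier_mat n n" for \<omega> by (simp add: F_def)
  have F_meas: "(\<lambda>\<omega>. F \<omega> $$ (i, j)) \<in> borel_measurable M" if "i < n" "j < n" for i j
    using that assms(1) by (simp add: F_def shifted_def)
  have "(\<lambda>\<omega>. Determinant.det (mat_delete (F \<omega>) k i)) \<in> borel_measurable M"
  proof (rule borel_measurable_det)
    show "mat_delete (F \<omega>) k i \<in> carrier_mat (n - 1) (n - 1)" for \<omega>
      by (rule mat_delete_carrier[OF F])
    show "(\<lambda>\<omega>. mat_delete (F \<omega>) k i $$ (r, s)) \<in> borel_measurable M" if "r < n - 1" "s < n - 1" for r s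
    proof -
      have "mat_delete (F \<omega>) k i $$ (r, s) =
          F \<omega> $$ (if r < k then r else Suc r, if s < i then s else Suc s)" for \<omega>
        using that F[of \<omega>] by (simp add: mat_delete_def)
      moreover have "(if r < k then r else Suc r) < n" "(if s < i then s else Suc s) < n"
        using that by auto
      ultimately show ?thesis using F_meas by simp
    qed
  qed
  moreover have "(\<lambda>\<omega>. Determinant.det (F \<omega>)) \<in> borel_measurable M"
    by (rule borel_measurable_det[OF F F_meas])
  ultimately have "(\<lambda>\<omega>. ((-1) ^ (k + i) * Determinant.det (mat_delete (F \<omega>) k i)) / Determinant.det (F \<omega>))
      \<in> borel_measurable M"
    by measurable
  moreover have "resolvent n (h \<omega>) \<eta> i k =
      ((-1) ^ (k + i) * Determinant.det (mat_delete (F \<omega>) k i)) / Determinant.det (F \<omega>)" for \<omega>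
    using assms(2,3) F[of \<omega>]
    by (simp add: resolvent_def Let_def F_def adj_mat_def cofactor_def)
  ultimately show ?thesis by simp
qed

section \<open>Replacing one entry of the array by 0\<close>

definition array_resolvent ::
    "nat \<Rightarrow> (nat \<Rightarrow> nat \<Rightarrow> complex) \<Rightarrow> real \<Rightarrow> real \<Rightarrow> (nat \<Rightarrow> nat \<Rightarrow> complex) \<Rightarrow> nat \<Rightarrow> nat \<Rightarrow> complex" where
  "array_resolvent N w c \<eta> x =
     resolvent (2 * N) (hermitization N (\<lambda>i j. w i j + of_real c * x i j)) \<eta>"

text \<open>The product R D of the random resolvent at \<i> \<eta> with the deterministic one at
  \<i> a. It appears when the trace of D (...) R in the resolvent identity is rotated.\<close>

definition array_product ::
    "nat \<Rightarrow> (nat \<Rightarrow> nat \<Rightarrow> complex) \<Rightarrow> real \<Rightarrow> real \<Rightarrow> real \<Rightarrow> (nat \<Rightarrow> nat \<Rightarrow> complex) \<Rightarrow> nat \<Rightarrow> nat \<Rightarrow> complex" where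
  "array_product N w c \<eta> a x i k =
     (\<Sum>j<2 * N. array_resolvent N w c \<eta> x i j * resolvent (2 * N) (hermitization N w) a j k)"

definition zero_entry :: "nat \<Rightarrow> nat \<Rightarrow> (nat \<Rightarrow> nat \<Rightarrow> complex) \<Rightarrow> nat \<Rightarrow> nat \<Rightarrow> complex" where
  "zero_entry p q x i j = (if i = p \<and> j = q then 0 else x i j)"

text \<open>In each correction term the left factor is built without the entry and the right factor
  with it. The formula is thus exact, and replacing the remaining right factor by its value without
  the entry isolates the second-order term.\<close>

lemma array_resolvent_expansion:
  assumes "\<eta> > 0" "p < N" "q < N" "i < 2 * N" "k < 2 * N"
  shows "array_resolvent N w c \<eta> x i k = array_resolvent N w c \<eta> (zero_entry p q x) i k -
    of_real c * (x p q * array_resolvent N w c \<eta> (zero_entry p q x) i p * array_resolvent N w c \<eta> x (N + q) k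
      + cnj (x p q) * array_resolvent N w c \<eta> (zero_entry p q x) i (N + q) * array_resolvent N w c \<eta> x p k)"
proof -
  let ?h = "\<lambda>x. hermitization N (\<lambda>i j. w i j + of_real c * x i j)"
  have "array_resolvent N w c \<eta> (zero_entry p q x) i k - array_resolvent N w c \<eta> x i k =
    (of_real c * x p q) * array_resolvent N w c \<eta> (zero_entry p q x) i p * array_resolvent N w c \<eta> x (N + q) k
    + (of_real c * cnj (x p q)) * array_resolvent N w c \<eta> (zero_entry p q x) i (N + q) * array_resolvent N w c \<eta> x p k"
    unfolding array_resolvent_def
  proof (rule resolvent_perturbation[OF hermitian_on_hermitization hermitian_on_hermitization])
    fix r s assume rs: "r < 2 * N" "s < 2 * N"
    show "?h x r s - ?h (zero_entry p q x) r s =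
      (if r = p \<and> s = N + q then of_real c * x p q
       else if r = N + q \<and> s = p then of_real c * cnj (x p q) else 0)"
      using assms rs by (auto simp: hermitization_def zero_entry_def)
  qed (use assms in auto)
  then show ?thesis by (simp add: algebra_simps)
qed

text \<open>The deterministic factor does not see \<open>x\<close>, so the expansion of the
  resolvent may be multiplied by it on the right.\<close>

lemma array_product_expansion:
  assumes "\<eta> > 0" "p < N" "q < N" "i < 2 * N"
  shows "array_product N w c \<eta> a x i k = array_product N w c \<eta> a (zero_entry p q x) i k -
    of_real c * (x p q * array_resolvent N w c \<eta> (zero_entry p q x) i p * array_product N w c \<eta> a x (N + q) k
      + cnj (x p q) * array_resolvent N w c \<eta> (zero_entry p q x) i (N + q) * array_product N w c \<eta> a x p k)"
proof -
  let ?D = "resolvent (2 * N) (hermitization N w) a"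
  let ?R = "array_resolvent N w c \<eta> x" and ?Z = "array_resolvent N w c \<eta> (zero_entry p q x)"
  have "array_product N w c \<eta> a x i k = (\<Sum>j<2 * N. (?Z i j -
     of_real c * (x p q * ?Z i p * ?R (N + q) j + cnj (x p q) * ?Z i (N + q) * ?R p j)) * ?D j k)"
    unfolding array_product_def
    by (intro sum.cong refl arg_cong[where f = "\<lambda>y. y * _"] array_resolvent_expansion[OF assms]) simp
  also have "\<dots> = array_product N w c \<eta> a (zero_entry p q x) i k -
    of_real c * (x p q * ?Z i p * array_product N w c \<eta> a x (N + q) k
      + cnj (x p q) * ?Z i (N + q) * array_product N w c \<eta> a x p k)"
    by (simp add: array_product_def sum_distrib_left sum.distrib sum_subtractf algebra_simps)
  finally show ?thesis .
qed

lemma norm_array_resolvent_le: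
  assumes "\<eta> > 0" "i < 2 * N" "k < 2 * N"
  shows "cmod (array_resolvent N w c \<eta> x i k) \<le> 1 / \<eta>"
  unfolding array_resolvent_def by (intro resolvent_entry_bound hermitian_on_hermitization assms)

lemma norm_array_product_le:
  assumes "\<eta> > 0" "a > 0" "i < 2 * N" "k < 2 * N"
  shows "cmod (array_product N w c \<eta> a x i k) \<le> 1 / (\<eta> * a)"
  unfolding array_product_def array_resolvent_def
  by (intro resolvent_mult_bound hermitian_on_hermitization assms)

text \<open>The constant bound comes from the sizes of \<open>F\<close> and \<open>F0\<close>, the
  linear one from the expansion. Keeping the smaller of the two matters because the difference is
  later weighted by |\<xi>|^2: the linear bound alone would call for a third moment.\<close>

lemma norm_expansion_difference_le:
  fixes F F0 u v :: complex
  assumes F: "F = F0 - of_real c * (\<xi> * r * u + cnj \<xi> * s * v)" and c: "c \<ge> 0"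
    and r: "cmod r \<le> A" "cmod s \<le> A" and u: "cmod u \<le> B" "cmod v \<le> B"
    and bnd: "cmod F \<le> B" "cmod F0 \<le> B" and \<kappa>: "2 * B \<le> \<kappa>" "2 * A * B \<le> \<kappa>"
  shows "cmod (F - F0) \<le> \<kappa> * min 1 (c * cmod \<xi>)"
proof -
  have nn: "0 \<le> A" "0 \<le> B" using r(1) u(1) norm_ge_zero order_trans by blast+
  have "cmod (F - F0) \<le> \<kappa>"
    using norm_triangle_ineq4[of F F0] bnd \<kappa> by linarith
  moreover have "cmod (F - F0) \<le> \<kappa> * (c * cmod \<xi>)"
  proof -
    have "cmod (F - F0) = c * cmod (\<xi> * r * u + cnj \<xi> * s * v)"
      using c by (simp add: F norm_mult)
    also have "\<dots> \<le> c * (cmod \<xi> * (A * B) + cmod \<xi> * (A * B))"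
    proof (rule mult_left_mono[OF order_trans[OF norm_triangle_ineq add_mono] c])
      show "cmod (\<xi> * r * u) \<le> cmod \<xi> * (A * B)" "cmod (cnj \<xi> * s * v) \<le> cmod \<xi> * (A * B)"
        unfolding norm_mult mult.assoc using r u nn
        by (auto intro!: mult_left_mono mult_mono)
    qed
    also have "\<dots> = (2 * A * B) * (c * cmod \<xi>)" by (simp add: algebra_simps)
    also have "\<dots> \<le> \<kappa> * (c * cmod \<xi>)" using \<kappa> c by (intro mult_right_mono) auto
    finally show ?thesis .
  qed
  ultimately show ?thesis by (auto simp: min_def)
qed

text \<open>Cauchy-Schwarz against the square-summability of rows gives sqrt N where the entrywise
  bound gives N; this gain makes the terms with an off-diagonal resolvent entry negligible. The map
  \<open>f\<close> selects the columns of one block.\<close>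

lemma sum_norm_array_resolvent_le:
  assumes \<eta>: "\<eta> > 0" and i: "i < 2 * N" and f: "\<And>k. k < N \<Longrightarrow> f k < 2 * N" "inj_on f {..<N}"
  shows "(\<Sum>k<N. cmod (array_resolvent N w c \<eta> x i (f k))) \<le> sqrt N / \<eta>"
proof -
  let ?R = "array_resolvent N w c \<eta> x"
  have "(\<Sum>k<N. 1 * cmod (?R i (f k)))\<^sup>2 \<le> (\<Sum>k<N. 1\<^sup>2) * (\<Sum>k<N. (cmod (?R i (f k)))\<^sup>2)"
    by (rule Cauchy_Schwarz_ineq_sum)
  also have "(\<Sum>k<N. (cmod (?R i (f k)))\<^sup>2) = (\<Sum>k\<in>f ` {..<N}. (cmod (?R i k))\<^sup>2)"
    by (simp add: sum.reindex[OF f(2)])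
  also have "\<dots> \<le> (\<Sum>k<2 * N. (cmod (?R i k))\<^sup>2)"
    by (rule sum_mono2) (use f in auto)
  also have "\<dots> \<le> 1 / \<eta>\<^sup>2"
    unfolding array_resolvent_def by (intro resolvent_row_bound hermitian_on_hermitization \<eta> i)
  finally have "(\<Sum>k<N. cmod (?R i (f k)))\<^sup>2 \<le> (sqrt N / \<eta>)\<^sup>2"
    by (simp add: power_divide mult_left_mono)
  then show ?thesis using \<eta> by (rule_tac power2_le_imp_le) auto
qed

lemma borel_measurable_array_resolvent:
  assumes "\<And>i j. i < N \<Longrightarrow> j < N \<Longrightarrow> (\<lambda>\<omega>. Y \<omega> i j) \<in> borel_measurable M" "i < 2 * N" "k < 2 * N"
  shows "(\<lambda>\<omega>. array_resolvent N w c \<eta> (Y \<omega>) i k) \<in> borel_measurable M"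
  unfolding array_resolvent_def
proof (rule borel_measurable_resolvent[OF _ assms(2,3)])
  have cnj_meas: "(\<lambda>\<omega>. cnj (f \<omega>)) \<in> borel_measurable M" if "f \<in> borel_measurable M" for f :: "_ \<Rightarrow> complex"
    using that by (rule measurable_compose) (intro borel_measurable_continuous_onI continuous_intros)
  show "(\<lambda>\<omega>. hermitization N (\<lambda>i j. w i j + of_real c * Y \<omega> i j) r s) \<in> borel_measurable M"
    if "r < 2 * N" "s < 2 * N" for r s
    unfolding hermitization_def using that
    by (cases "r < N \<and> N \<le> s"; cases "N \<le> r \<and> s < N")
       (auto intro!: cnj_meas borel_measurable_add borel_measurable_times borel_measurable_const assms(1))
qed

lemma borel_measurable_array_product:
  assumes "\<And>i j. i < N \<Longrightarrow> j < N \<Longrightarrow> (\<lambda>\<omega>. Y \<omega> i j) \<in> borel_measurable M" "i < 2 * N"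
  shows "(\<lambda>\<omega>. array_product N w c \<eta> a (Y \<omega>) i k) \<in> borel_measurable M"
  unfolding array_product_def
  by (intro borel_measurable_sum borel_measurable_times borel_measurable_const
      borel_measurable_array_resolvent assms) auto

section \<open>Expectation of an entry times a function of the array\<close>

lemma norm_integral_le_integral:
  fixes f :: "'a \<Rightarrow> 'b :: {banach, second_countable_topology}"
  assumes "integrable M f" "integrable M g" "\<And>x. norm (f x) \<le> g x"
  shows "norm (\<integral>x. f x \<partial>M) \<le> (\<integral>x. g x \<partial>M)"
  by (rule order_trans[OF integral_norm_bound]) (intro integral_mono integrable_norm assms)

text \<open>
  Conditionally on the remaining entries, only the terms of second order in \<open>\<xi>\<close> survive;
  replacing the quantities built without \<open>\<xi>\<close> by the full ones costs a factor
  \<open>min 1 (c \<bar>\<xi>\<bar>)\<close>, which is what allows one to work with two moments only.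
\<close>
lemma (in prob_space) second_order_expansion:
  fixes \<xi> C C0 C' C0' R R0 R' R0' :: "'a \<Rightarrow> complex"
  assumes c: "c \<ge> 0"
    and meas [measurable]: "\<xi> \<in> borel_measurable M" "C \<in> borel_measurable M" "C0 \<in> borel_measurable M"
      "C' \<in> borel_measurable M" "C0' \<in> borel_measurable M" "R \<in> borel_measurable M"
      "R0 \<in> borel_measurable M" "R' \<in> borel_measurable M" "R0' \<in> borel_measurable M"
    and \<xi>: "integrable M \<xi>" "expectation \<xi> = 0"
      "integrable M (\<lambda>\<omega>. (cmod (\<xi> \<omega>))\<^sup>2)" "expectation (\<lambda>\<omega>. (cmod (\<xi> \<omega>))\<^sup>2) = 1"
    and bnd: "\<And>\<omega>. cmod (C \<omega>) \<le> \<kappa>" "\<And>\<omega>. cmod (C0 \<omega>) \<le> \<kappa>" "\<And>\<omega>. cmod (C' \<omega>) \<le> \<kappa>" "\<And>\<omega>. cmod (C0' \<omega>) \<le> \<kappa>"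
      "\<And>\<omega>. cmod (R \<omega>) \<le> \<kappa>" "\<And>\<omega>. cmod (R0 \<omega>) \<le> \<kappa>" "\<And>\<omega>. cmod (R' \<omega>) \<le> \<kappa>" "\<And>\<omega>. cmod (R0' \<omega>) \<le> \<kappa>"
    and diff: "\<And>\<omega>. cmod (C \<omega> - C0 \<omega>) \<le> \<kappa> * min 1 (c * cmod (\<xi> \<omega>))"
      "\<And>\<omega>. cmod (C' \<omega> - C0' \<omega>) \<le> \<kappa> * min 1 (c * cmod (\<xi> \<omega>))"
      "\<And>\<omega>. cmod (R \<omega> - R0 \<omega>) \<le> \<kappa> * min 1 (c * cmod (\<xi> \<omega>))"
      "\<And>\<omega>. cmod (R' \<omega> - R0' \<omega>) \<le> \<kappa> * min 1 (c * cmod (\<xi> \<omega>))"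
    and indep: "indep_var borel \<xi> borel C0" "indep_var borel \<xi> borel (\<lambda>\<omega>. R0 \<omega> * C0 \<omega>)"
      "indep_var borel \<xi> borel (\<lambda>\<omega>. R0' \<omega> * C0' \<omega>)"
    and expansion: "\<And>\<omega>. C \<omega> = C0 \<omega> - of_real c * (\<xi> \<omega> * R0 \<omega> * C \<omega> + cnj (\<xi> \<omega>) * R0' \<omega> * C' \<omega>)"
  shows "cmod (expectation (\<lambda>\<omega>. \<xi> \<omega> * C \<omega>) + of_real c * expectation (\<lambda>\<omega>. R' \<omega> * C' \<omega>)) \<le>
    c * (4 * \<kappa>\<^sup>2 * expectation (\<lambda>\<omega>. (1 + (cmod (\<xi> \<omega>))\<^sup>2) * min 1 (c * cmod (\<xi> \<omega>)))
         + \<kappa> * expectation (\<lambda>\<omega>. cmod (R \<omega>)))"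
proof -
  define \<delta> where "\<delta> = (\<lambda>\<omega>. min 1 (c * cmod (\<xi> \<omega>)))"
  have \<delta>: "0 \<le> \<delta> \<omega>" "\<delta> \<omega> \<le> 1" for \<omega> using c by (auto simp: \<delta>_def)
  have [measurable]: "\<delta> \<in> borel_measurable M" unfolding \<delta>_def by measurable
  have \<delta>_eq: "min 1 (c * cmod (\<xi> \<omega>)) = \<delta> \<omega>" for \<omega> by (simp add: \<delta>_def)
  note diff = diff[unfolded \<delta>_eq]
  obtain \<omega>0 where "\<omega>0 \<in> space M" using not_empty by blast
  have \<kappa>: "\<kappa> \<ge> 0" using bnd(1)[of \<omega>0] norm_ge_zero order_trans by blast
  have int_bnd: "integrable M F" if "F \<in> borel_measurable M" "\<And>\<omega>. cmod (F \<omega>) \<le> b" for F b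
    using that by (intro integrable_const_bound[of _ b]) auto
  have mult_bnd: "cmod (x * y) \<le> \<kappa> * \<kappa>" if "cmod x \<le> \<kappa>" "cmod y \<le> \<kappa>" for x y
    unfolding norm_mult using that \<kappa> by (intro mult_mono) auto
  have int_sq: "integrable M (\<lambda>\<omega>. \<zeta> \<omega> * F \<omega>)"
    if [measurable]: "\<zeta> \<in> borel_measurable M" "F \<in> borel_measurable M"
      and "\<And>\<omega>. cmod (\<zeta> \<omega>) = (cmod (\<xi> \<omega>))\<^sup>2" "\<And>\<omega>. cmod (F \<omega>) \<le> b" for \<zeta> F b
  proof (rule Bochner_Integration.integrable_bound[of M "\<lambda>\<omega>. b * (cmod (\<xi> \<omega>))\<^sup>2"])
    show "integrable M (\<lambda>\<omega>. b * (cmod (\<xi> \<omega>))\<^sup>2)" using \<xi>(3) by simp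
    show "AE \<omega> in M. norm (\<zeta> \<omega> * F \<omega>) \<le> norm (b * (cmod (\<xi> \<omega>))\<^sup>2)"
    proof (rule AE_I2)
      fix \<omega>
      have "0 \<le> b" using that(4)[of \<omega>] norm_ge_zero order_trans by blast
      then show "norm (\<zeta> \<omega> * F \<omega>) \<le> norm (b * (cmod (\<xi> \<omega>))\<^sup>2)"
        using mult_left_mono[OF that(4)[of \<omega>], of "(cmod (\<xi> \<omega>))\<^sup>2"]
        by (simp add: norm_mult that(3) mult.commute)
    qed
  qed measurable
  have cnj_meas [measurable]: "cnj \<in> borel_measurable borel"
    by (intro borel_measurable_continuous_onI continuous_intros)
  define sq where "sq = (\<lambda>\<omega>. \<xi> \<omega> * \<xi> \<omega>)"
  define ab where "ab = (\<lambda>\<omega>. \<xi> \<omega> * cnj (\<xi> \<omega>))"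
  have [measurable]: "sq \<in> borel_measurable M" "ab \<in> borel_measurable M"
    unfolding sq_def ab_def by measurable
  have sq: "cmod (sq \<omega>) = (cmod (\<xi> \<omega>))\<^sup>2" and ab: "cmod (ab \<omega>) = (cmod (\<xi> \<omega>))\<^sup>2" for \<omega>
    by (simp_all add: sq_def ab_def norm_mult power2_eq_square)
  have int_sq1: "integrable M sq" using int_sq[of sq "\<lambda>_. 1" 1] sq by simp
  have ab_eq: "ab = (\<lambda>\<omega>. of_real ((cmod (\<xi> \<omega>))\<^sup>2))"
    by (simp add: ab_def complex_norm_square fun_eq_iff del: of_real_power)
  have int_ab1: "integrable M ab" and E_ab: "expectation ab = 1"
    unfolding ab_eq using \<xi>(3,4) by (simp_all del: of_real_power)
  \<comment> \<open>The mean of \<xi>^2 is only known to have modulus at most 1, in contrast to that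
    of |\<xi>|^2, which is 1. Its term therefore stays in the error, measured by the mean of |R|,
    and the other one is the main term.\<close>
  define T where "T = expectation sq"
  have T: "cmod T \<le> 1"
    unfolding T_def using integral_norm_bound[of M sq] \<xi>(4) by (simp add: sq)
  \<comment> \<open>The cost of replacing \<open>C\<close>, \<open>C'\<close> by \<open>C0\<close>,
    \<open>C0'\<close> in the second-order terms. What is left is \<xi>^2 or |\<xi>|^2 times a
    quantity independent of \<xi>, whose expectation factorises.\<close>
  define e where "e = (\<lambda>\<omega>. sq \<omega> * (R0 \<omega> * (C \<omega> - C0 \<omega>)) + ab \<omega> * (R0' \<omega> * (C' \<omega> - C0' \<omega>)))"
  have dle: "\<kappa> * \<delta> \<omega> \<le> \<kappa>" for \<omega> using \<delta>[of \<omega>] \<kappa> by (simp add: mult_left_le)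
  have dC: "cmod (C \<omega> - C0 \<omega>) \<le> \<kappa>" "cmod (C' \<omega> - C0' \<omega>) \<le> \<kappa>" for \<omega>
    using diff(1,2)[of \<omega>] dle[of \<omega>] by linarith+
  have int_e1: "integrable M (\<lambda>\<omega>. sq \<omega> * (R0 \<omega> * (C \<omega> - C0 \<omega>)))"
    by (rule int_sq[of _ _ "\<kappa> * \<kappa>"]) (use sq mult_bnd bnd dC in auto)
  have int_e2: "integrable M (\<lambda>\<omega>. ab \<omega> * (R0' \<omega> * (C' \<omega> - C0' \<omega>)))"
    by (rule int_sq[of _ _ "\<kappa> * \<kappa>"]) (use ab mult_bnd bnd dC in auto)
  have int_e: "integrable M e" unfolding e_def by (intro Bochner_Integration.integrable_add int_e1 int_e2)
  have int_s: "integrable M (\<lambda>\<omega>. sq \<omega> * (R0 \<omega> * C0 \<omega>))"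
    by (rule int_sq[of _ _ "\<kappa> * \<kappa>"]) (use sq mult_bnd bnd in auto)
  have int_a: "integrable M (\<lambda>\<omega>. ab \<omega> * (R0' \<omega> * C0' \<omega>))"
    by (rule int_sq[of _ _ "\<kappa> * \<kappa>"]) (use ab mult_bnd bnd in auto)
  have int_RC: "integrable M (\<lambda>\<omega>. R \<omega> * C \<omega>)" "integrable M (\<lambda>\<omega>. R0 \<omega> * C0 \<omega>)"
     "integrable M (\<lambda>\<omega>. R' \<omega> * C' \<omega>)" "integrable M (\<lambda>\<omega>. R0' \<omega> * C0' \<omega>)"
    by (rule int_bnd[of _ "\<kappa> * \<kappa>"]; use mult_bnd bnd in force)+
  have int_C0: "integrable M C0" by (rule int_bnd[of _ \<kappa>]) (use bnd in auto)
  have int_\<xi>C0: "integrable M (\<lambda>\<omega>. \<xi> \<omega> * C0 \<omega>)" by (rule indep_var_integrable[OF indep(1) \<xi>(1) int_C0])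
  have E0: "expectation (\<lambda>\<omega>. \<xi> \<omega> * C0 \<omega>) = 0"
    using indep_var_lebesgue_integral[OF indep(1) \<xi>(1) int_C0] \<xi>(2) by simp
  have "indep_var borel ((\<lambda>x. x * x) \<circ> \<xi>) borel ((\<lambda>x. x) \<circ> (\<lambda>\<omega>. R0 \<omega> * C0 \<omega>))"
    by (rule indep_var_compose[OF indep(2)]) auto
  then have Es: "expectation (\<lambda>\<omega>. sq \<omega> * (R0 \<omega> * C0 \<omega>)) = T * expectation (\<lambda>\<omega>. R0 \<omega> * C0 \<omega>)"
    unfolding T_def by (intro indep_var_lebesgue_integral int_sq1 int_RC) (simp add: o_def sq_def)
  have "indep_var borel ((\<lambda>x. x * cnj x) \<circ> \<xi>) borel ((\<lambda>x. x) \<circ> (\<lambda>\<omega>. R0' \<omega> * C0' \<omega>))"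
    by (rule indep_var_compose[OF indep(3)]) auto
  then have "expectation (\<lambda>\<omega>. ab \<omega> * (R0' \<omega> * C0' \<omega>)) = expectation ab * expectation (\<lambda>\<omega>. R0' \<omega> * C0' \<omega>)"
    by (intro indep_var_lebesgue_integral int_ab1 int_RC) (simp add: o_def ab_def)
  then have Ea: "expectation (\<lambda>\<omega>. ab \<omega> * (R0' \<omega> * C0' \<omega>)) = expectation (\<lambda>\<omega>. R0' \<omega> * C0' \<omega>)"
    by (simp add: E_ab)
  have "expectation (\<lambda>\<omega>. \<xi> \<omega> * C \<omega>) = expectation (\<lambda>\<omega>. \<xi> \<omega> * C0 \<omega> -
      of_real c * (e \<omega> + (sq \<omega> * (R0 \<omega> * C0 \<omega>) + ab \<omega> * (R0' \<omega> * C0' \<omega>))))"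
  proof (rule Bochner_Integration.integral_cong[OF refl])
    fix \<omega>
    show "\<xi> \<omega> * C \<omega> = \<xi> \<omega> * C0 \<omega> -
      of_real c * (e \<omega> + (sq \<omega> * (R0 \<omega> * C0 \<omega>) + ab \<omega> * (R0' \<omega> * C0' \<omega>)))"
      by (subst expansion) (simp add: e_def sq_def ab_def algebra_simps)
  qed
  also have "\<dots> = expectation (\<lambda>\<omega>. \<xi> \<omega> * C0 \<omega>) - of_real c * (expectation e +
      (expectation (\<lambda>\<omega>. sq \<omega> * (R0 \<omega> * C0 \<omega>)) + expectation (\<lambda>\<omega>. ab \<omega> * (R0' \<omega> * C0' \<omega>))))"
    by (subst Bochner_Integration.integral_diff)
       (use int_\<xi>C0 int_e int_s int_a in \<open>auto intro!: Bochner_Integration.integrable_add integrable_mult_right\<close>)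
  finally have EC: "expectation (\<lambda>\<omega>. \<xi> \<omega> * C \<omega>) = - of_real c * (expectation e +
      (T * expectation (\<lambda>\<omega>. R0 \<omega> * C0 \<omega>) + expectation (\<lambda>\<omega>. R0' \<omega> * C0' \<omega>)))"
    by (simp add: E0 Es Ea)
  define d where "d = expectation \<delta>"
  define d2 where "d2 = expectation (\<lambda>\<omega>. (cmod (\<xi> \<omega>))\<^sup>2 * \<delta> \<omega>)"
  have int_\<delta>: "integrable M \<delta>" by (rule integrable_const_bound[of _ 1]) (use \<delta> in auto)
  have int_\<xi>\<delta>: "integrable M (\<lambda>\<omega>. (cmod (\<xi> \<omega>))\<^sup>2 * \<delta> \<omega>)"
    by (rule Bochner_Integration.integrable_bound[OF \<xi>(3)])
       (use \<delta> in \<open>auto simp: abs_mult mult_left_le\<close>)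
  have prod_diff: "cmod (F0 \<omega> * G0 \<omega> - F \<omega> * G \<omega>) \<le> 2 * \<kappa>\<^sup>2 * \<delta> \<omega>"
    if "cmod (F0 \<omega>) \<le> \<kappa>" "cmod (G \<omega>) \<le> \<kappa>"
      "cmod (F \<omega> - F0 \<omega>) \<le> \<kappa> * \<delta> \<omega>" "cmod (G \<omega> - G0 \<omega>) \<le> \<kappa> * \<delta> \<omega>" for F F0 G G0 :: "'a \<Rightarrow> complex" and \<omega>
  proof -
    have "F0 \<omega> * G0 \<omega> - F \<omega> * G \<omega> = - (F0 \<omega> * (G \<omega> - G0 \<omega>) + (F \<omega> - F0 \<omega>) * G \<omega>)"
      by (simp add: algebra_simps)
    then have "cmod (F0 \<omega> * G0 \<omega> - F \<omega> * G \<omega>) \<le> cmod (F0 \<omega>) * cmod (G \<omega> - G0 \<omega>) + cmod (F \<omega> - F0 \<omega>) * cmod (G \<omega>)"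
      by (metis norm_minus_cancel norm_mult norm_triangle_ineq)
    also have "\<dots> \<le> \<kappa> * (\<kappa> * \<delta> \<omega>) + (\<kappa> * \<delta> \<omega>) * \<kappa>"
      using that \<kappa> \<delta>[of \<omega>] by (intro add_mono mult_mono) auto
    finally show ?thesis by (simp add: power2_eq_square algebra_simps)
  qed
  have E_diff: "cmod (expectation (\<lambda>\<omega>. F0 \<omega> * G0 \<omega>) - expectation (\<lambda>\<omega>. F \<omega> * G \<omega>)) \<le> 2 * \<kappa>\<^sup>2 * d"
    if "integrable M (\<lambda>\<omega>. F0 \<omega> * G0 \<omega>)" "integrable M (\<lambda>\<omega>. F \<omega> * G \<omega>)"
      "\<And>\<omega>. cmod (F0 \<omega>) \<le> \<kappa>" "\<And>\<omega>. cmod (G \<omega>) \<le> \<kappa>"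
      "\<And>\<omega>. cmod (F \<omega> - F0 \<omega>) \<le> \<kappa> * \<delta> \<omega>" "\<And>\<omega>. cmod (G \<omega> - G0 \<omega>) \<le> \<kappa> * \<delta> \<omega>" for F F0 G G0
  proof -
    have "cmod (expectation (\<lambda>\<omega>. F0 \<omega> * G0 \<omega> - F \<omega> * G \<omega>)) \<le> expectation (\<lambda>\<omega>. 2 * \<kappa>\<^sup>2 * \<delta> \<omega>)"
      by (rule norm_integral_le_integral) (use that int_\<delta> prod_diff in auto)
    then show ?thesis using that int_\<delta> by (simp add: d_def)
  qed
  have e_le: "cmod (expectation e) \<le> 2 * \<kappa>\<^sup>2 * d2"
  proof -
    have "cmod (expectation e) \<le> expectation (\<lambda>\<omega>. 2 * \<kappa>\<^sup>2 * ((cmod (\<xi> \<omega>))\<^sup>2 * \<delta> \<omega>))"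
    proof (rule norm_integral_le_integral[OF int_e])
      fix \<omega>
      have "cmod (e \<omega>) \<le> (cmod (\<xi> \<omega>))\<^sup>2 * (\<kappa> * (\<kappa> * \<delta> \<omega>)) + (cmod (\<xi> \<omega>))\<^sup>2 * (\<kappa> * (\<kappa> * \<delta> \<omega>))"
        unfolding e_def
        by (rule order_trans[OF norm_triangle_ineq add_mono]; unfold norm_mult sq ab;
            intro mult_left_mono mult_mono bnd diff) (use \<kappa> \<delta>[of \<omega>] in auto)
      then show "norm (e \<omega>) \<le> 2 * \<kappa>\<^sup>2 * ((cmod (\<xi> \<omega>))\<^sup>2 * \<delta> \<omega>)"
        by (simp add: power2_eq_square algebra_simps)
    qed (use int_\<xi>\<delta> in auto)
    then show ?thesis using int_\<xi>\<delta> by (simp add: d2_def)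
  qed
  have RC_le: "cmod (expectation (\<lambda>\<omega>. R \<omega> * C \<omega>)) \<le> \<kappa> * expectation (\<lambda>\<omega>. cmod (R \<omega>))"
  proof -
    have "integrable M R" by (rule int_bnd[of _ \<kappa>]) (use bnd in auto)
    then have int: "integrable M (\<lambda>\<omega>. \<kappa> * cmod (R \<omega>))" by auto
    have "cmod (expectation (\<lambda>\<omega>. R \<omega> * C \<omega>)) \<le> expectation (\<lambda>\<omega>. \<kappa> * cmod (R \<omega>))"
    proof (rule norm_integral_le_integral[OF int_RC(1) int])
      fix \<omega>
      show "norm (R \<omega> * C \<omega>) \<le> \<kappa> * cmod (R \<omega>)"
        using mult_left_mono[OF bnd(1)[of \<omega>], of "cmod (R \<omega>)"] by (simp add: norm_mult mult.commute)
    qed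
    then show ?thesis by simp
  qed
  \<comment> \<open>After independence has been used, \<open>u\<close> and \<open>v\<close> return
    from the quantities without \<xi> to the full ones, at a cost proportional to the mean of
    \<open>\<delta>\<close>; \<open>t\<close> is the contribution of the mean of \<xi>^2.\<close>
  define u where "u = T * (expectation (\<lambda>\<omega>. R0 \<omega> * C0 \<omega>) - expectation (\<lambda>\<omega>. R \<omega> * C \<omega>))"
  define v where "v = expectation (\<lambda>\<omega>. R0' \<omega> * C0' \<omega>) - expectation (\<lambda>\<omega>. R' \<omega> * C' \<omega>)"
  define t where "t = T * expectation (\<lambda>\<omega>. R \<omega> * C \<omega>)"
  have T_le: "cmod (T * y) \<le> cmod y" for y
    using mult_right_mono[OF T, of "cmod y"] by (simp add: norm_mult)
  have u: "cmod u \<le> 2 * \<kappa>\<^sup>2 * d"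
    unfolding u_def by (rule order_trans[OF T_le E_diff]) (use int_RC bnd diff in auto)
  have v: "cmod v \<le> 2 * \<kappa>\<^sup>2 * d"
    unfolding v_def by (rule E_diff) (use int_RC bnd diff in auto)
  have t: "cmod t \<le> \<kappa> * expectation (\<lambda>\<omega>. cmod (R \<omega>))"
    unfolding t_def by (rule order_trans[OF T_le RC_le])
  have "expectation (\<lambda>\<omega>. \<xi> \<omega> * C \<omega>) + of_real c * expectation (\<lambda>\<omega>. R' \<omega> * C' \<omega>) =
      - of_real c * (expectation e + u + v + t)"
    unfolding EC u_def v_def t_def by (simp add: algebra_simps)
  then have "cmod (expectation (\<lambda>\<omega>. \<xi> \<omega> * C \<omega>) + of_real c * expectation (\<lambda>\<omega>. R' \<omega> * C' \<omega>)) =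
      c * cmod (expectation e + u + v + t)"
    using c by (simp add: norm_mult)
  also have "\<dots> \<le> c * (4 * \<kappa>\<^sup>2 * (d + d2) + \<kappa> * expectation (\<lambda>\<omega>. cmod (R \<omega>)))"
  proof (rule mult_left_mono[OF _ c])
    have "cmod (expectation e + u + v + t) \<le> cmod (expectation e) + cmod u + cmod v + cmod t"
      by (intro order_trans[OF norm_triangle_ineq] add_mono order_refl)
    moreover have "0 \<le> \<kappa>\<^sup>2 * d2" using \<delta> by (auto simp: d2_def intro!: mult_nonneg_nonneg integral_nonneg)
    ultimately show "cmod (expectation e + u + v + t) \<le> 4 * \<kappa>\<^sup>2 * (d + d2) + \<kappa> * expectation (\<lambda>\<omega>. cmod (R \<omega>))"
      using e_le u v t by (simp add: algebra_simps)
  qed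
  also have "d + d2 = expectation (\<lambda>\<omega>. (1 + (cmod (\<xi> \<omega>))\<^sup>2) * \<delta> \<omega>)"
    unfolding d_def d2_def using int_\<delta> int_\<xi>\<delta> by (simp add: distrib_right)
  finally show ?thesis by (simp add: \<delta>_def)
qed

text \<open>The resolvent identity with D on the left, followed by a cyclic rotation that brings R D
  together. The random part of the perturbation fills only the off-diagonal blocks, and the
  difference of the shifts only the diagonal.\<close>

lemma trace_difference_array_resolvent:
  assumes "\<eta> > 0" "a > 0"
  shows "(\<Sum>i<2 * N. resolvent (2 * N) (hermitization N w) a i i) - (\<Sum>i<2 * N. array_resolvent N w c \<eta> x i i) =
    of_real c * (\<Sum>p<N. \<Sum>q<N. x p q * array_product N w c \<eta> a x (N + q) p
       + cnj (x p q) * array_product N w c \<eta> a x p (N + q))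
    + \<i> * of_real (a - \<eta>) * (\<Sum>i<2 * N. array_product N w c \<eta> a x i i)"
proof -
  define D where "D = resolvent (2 * N) (hermitization N w) a"
  define R where "R = array_resolvent N w c \<eta> x"
  define C where "C = array_product N w c \<eta> a x"
  define E where "E = hermitization N (\<lambda>i j. of_real c * x i j)"
  have G: "shifted (hermitization N (\<lambda>i j. w i j + of_real c * x i j)) \<eta> p q - shifted (hermitization N w) a p q =
      E p q + (if p = q then \<i> * of_real (a - \<eta>) else 0)" for p q
    by (auto simp: shifted_def hermitization_def E_def algebra_simps)
  have "(\<Sum>i<2 * N. D i i) - (\<Sum>i<2 * N. R i i) = (\<Sum>i<2 * N. D i i - R i i)"
    by (simp add: sum_subtractf)
  also have "\<dots> = (\<Sum>i<2 * N. \<Sum>p<2 * N. \<Sum>q<2 * N. D i p * (E p q + (if p = q then \<i> * of_real (a - \<eta>) else 0)) * R q i)"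
    unfolding D_def R_def array_resolvent_def G[symmetric]
    by (intro sum.cong refl resolvent_identity hermitian_on_hermitization assms) auto
  also have "\<dots> = (\<Sum>p<2 * N. \<Sum>i<2 * N. \<Sum>q<2 * N. D i p * (E p q + (if p = q then \<i> * of_real (a - \<eta>) else 0)) * R q i)"
    by (rule sum.swap)
  also have "\<dots> = (\<Sum>p<2 * N. \<Sum>q<2 * N. \<Sum>i<2 * N. D i p * (E p q + (if p = q then \<i> * of_real (a - \<eta>) else 0)) * R q i)"
    by (intro sum.cong refl sum.swap)
  also have "\<dots> = (\<Sum>p<2 * N. \<Sum>q<2 * N. (E p q + (if p = q then \<i> * of_real (a - \<eta>) else 0)) * C q p)"
    unfolding C_def array_product_def sum_distrib_left D_def[symmetric] R_def[symmetric]
    by (intro sum.cong refl) (simp add: algebra_simps)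
  also have "\<dots> = (\<Sum>p<2 * N. \<Sum>q<2 * N. E p q * C q p + (if q = p then \<i> * of_real (a - \<eta>) * C q p else 0))"
    by (intro sum.cong refl) (simp add: distrib_right)
  also have "\<dots> = (\<Sum>p<2 * N. \<Sum>q<2 * N. E p q * C q p) + \<i> * of_real (a - \<eta>) * (\<Sum>p<2 * N. C p p)"
    by (simp add: sum.distrib sum_distrib_left)
  also have "(\<Sum>p<2 * N. \<Sum>q<2 * N. E p q * C q p) =
      (\<Sum>p<N. \<Sum>q<N. of_real c * (x p q * C (N + q) p)) + (\<Sum>p<N. \<Sum>q<N. of_real c * (cnj (x q p) * C q (N + p)))"
    unfolding sum_lessThan_double
    by (intro arg_cong2[of _ _ _ _ "(+)"] sum.cong refl) (simp_all add: E_def hermitization_def mult.assoc)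
  also have "(\<Sum>p<N. \<Sum>q<N. of_real c * (cnj (x q p) * C q (N + p))) = (\<Sum>q<N. \<Sum>p<N. of_real c * (cnj (x q p) * C q (N + p)))"
    by (rule sum.swap)
  finally show ?thesis
    by (simp add: D_def R_def C_def sum.distrib sum_distrib_left distrib_left)
qed

section \<open>Arrays of independent, identically distributed entries\<close>

locale iid_array = prob_space P for P :: "'w measure" +
  fixes X :: "nat \<Rightarrow> nat \<Rightarrow> 'w \<Rightarrow> complex"
  assumes indep: "indep_vars (\<lambda>_. borel) (\<lambda>(i, j). X i j) UNIV"
    and ident: "\<And>i j. distr P borel (X i j) = distr P borel (X 0 0)"
    and mean: "\<And>i j. integrable P (X i j)" "\<And>i j. expectation (X i j) = 0"
    and var: "\<And>i j. integrable P (\<lambda>\<omega>. (cmod (X i j \<omega>))\<^sup>2)"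
      "\<And>i j. expectation (\<lambda>\<omega>. (cmod (X i j \<omega>))\<^sup>2) = 1"
begin

lemma X_measurable [measurable]: "X i j \<in> borel_measurable P"
  using mean(1) by auto

text \<open>A function of the array with entry (p, q) erased factors through the remaining
  coordinates, and disjoint groups of independent variables are independent. Measurability is
  therefore required on the product space over the other indices.\<close>

lemma indep_zero_entry:
  assumes "(\<lambda>y. F (zero_entry p q (\<lambda>i j. y (i, j)))) \<in> borel_measurable (PiM (UNIV - {(p, q)}) (\<lambda>_. borel))"
  shows "indep_var borel (X p q) borel (\<lambda>\<omega>. F (zero_entry p q (\<lambda>i j. X i j \<omega>)))"
proof -
  let ?A = "{(p, q)}" and ?B = "UNIV - {(p, q)}"
  have "indep_var (PiM ?A (\<lambda>_. borel)) (\<lambda>\<omega>. restrict (\<lambda>i. (case i of (i, j) \<Rightarrow> X i j) \<omega>) ?A)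
      (PiM ?B (\<lambda>_. borel)) (\<lambda>\<omega>. restrict (\<lambda>i. (case i of (i, j) \<Rightarrow> X i j) \<omega>) ?B)"
    by (rule indep_var_restrict[OF indep]) auto
  then have "indep_var borel ((\<lambda>y. y (p, q)) \<circ> (\<lambda>\<omega>. restrict (\<lambda>i. (case i of (i, j) \<Rightarrow> X i j) \<omega>) ?A))
      borel ((\<lambda>y. F (zero_entry p q (\<lambda>i j. y (i, j)))) \<circ> (\<lambda>\<omega>. restrict (\<lambda>i. (case i of (i, j) \<Rightarrow> X i j) \<omega>) ?B))"
    by (rule indep_var_compose) (use assms in \<open>auto intro: measurable_component_singleton\<close>)
  moreover have "zero_entry p q (\<lambda>i j. restrict (\<lambda>i. (case i of (i, j) \<Rightarrow> X i j) \<omega>) ?B (i, j)) =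
      zero_entry p q (\<lambda>i j. X i j \<omega>)" for \<omega>
    by (auto simp: zero_entry_def fun_eq_iff)
  ultimately show ?thesis by (simp add: o_def)
qed

lemma zero_entry_component_measurable:
  "(\<lambda>y. zero_entry p q (\<lambda>i j. y (i, j)) i j) \<in> borel_measurable (PiM (UNIV - {(p, q)}) (\<lambda>_. borel :: complex measure))"
  by (cases "i = p \<and> j = q") (auto simp: zero_entry_def intro: measurable_component_singleton)

definition truncation_error :: "real \<Rightarrow> real" where
  "truncation_error c = expectation (\<lambda>\<omega>. (1 + (cmod (X 0 0 \<omega>))\<^sup>2) * min 1 (c * cmod (X 0 0 \<omega>)))"

lemma truncation_error_eq:
  "expectation (\<lambda>\<omega>. (1 + (cmod (X i j \<omega>))\<^sup>2) * min 1 (c * cmod (X i j \<omega>))) = truncation_error c"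
proof -
  let ?f = "\<lambda>x. (1 + (cmod x)\<^sup>2) * min 1 (c * cmod x)"
  have "expectation (\<lambda>\<omega>. ?f (X i j \<omega>)) = integral\<^sup>L (distr P borel (X i j)) ?f" for i j
    by (rule integral_distr[symmetric]) measurable
  then show ?thesis unfolding truncation_error_def using ident[of i j] by simp
qed

text \<open>The integrand is dominated by 1 + |X|^2, which is integrable by the second moment alone;
  no rate of decay is claimed.\<close>

lemma truncation_error_tendsto:
  assumes "c \<longlonglongrightarrow> 0" "\<And>n. c n \<ge> 0"
  shows "(\<lambda>n. truncation_error (c n)) \<longlonglongrightarrow> 0"
proof -
  have "(\<lambda>n. expectation (\<lambda>\<omega>. (1 + (cmod (X 0 0 \<omega>))\<^sup>2) * min 1 (c n * cmod (X 0 0 \<omega>)))) \<longlonglongrightarrow> expectation (\<lambda>\<omega>. 0)"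
  proof (rule integral_dominated_convergence)
    show "integrable P (\<lambda>\<omega>. 1 + (cmod (X 0 0 \<omega>))\<^sup>2)" using var(1) by auto
    show "AE \<omega> in P. (\<lambda>n. (1 + (cmod (X 0 0 \<omega>))\<^sup>2) * min 1 (c n * cmod (X 0 0 \<omega>))) \<longlonglongrightarrow> 0"
    proof (rule AE_I2)
      fix \<omega>
      have "(\<lambda>n. (1 + (cmod (X 0 0 \<omega>))\<^sup>2) * min 1 (c n * cmod (X 0 0 \<omega>))) \<longlonglongrightarrow>
          (1 + (cmod (X 0 0 \<omega>))\<^sup>2) * min 1 (0 * cmod (X 0 0 \<omega>))"
        by (intro tendsto_intros assms)
      then show "(\<lambda>n. (1 + (cmod (X 0 0 \<omega>))\<^sup>2) * min 1 (c n * cmod (X 0 0 \<omega>))) \<longlonglongrightarrow> 0" by simp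
    qed
    show "AE \<omega> in P. norm ((1 + (cmod (X 0 0 \<omega>))\<^sup>2) * min 1 (c n * cmod (X 0 0 \<omega>))) \<le> 1 + (cmod (X 0 0 \<omega>))\<^sup>2" for n
    proof (rule AE_I2)
      fix \<omega>
      have "0 \<le> min 1 (c n * cmod (X 0 0 \<omega>))" using assms(2)[of n] by simp
      then have "norm ((1 + (cmod (X 0 0 \<omega>))\<^sup>2) * min 1 (c n * cmod (X 0 0 \<omega>))) =
          (1 + (cmod (X 0 0 \<omega>))\<^sup>2) * min 1 (c n * cmod (X 0 0 \<omega>))"
        by (simp add: abs_mult)
      also have "\<dots> \<le> (1 + (cmod (X 0 0 \<omega>))\<^sup>2) * 1"
        by (rule mult_left_mono) auto
      finally show "norm ((1 + (cmod (X 0 0 \<omega>))\<^sup>2) * min 1 (c n * cmod (X 0 0 \<omega>))) \<le> 1 + (cmod (X 0 0 \<omega>))\<^sup>2"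
        by simp
    qed
  qed measurable
  then show ?thesis by (simp add: truncation_error_def)
qed

context
  fixes N :: nat and w :: "nat \<Rightarrow> nat \<Rightarrow> complex" and c \<eta> a \<kappa> :: real
  assumes c: "c \<ge> 0" and \<eta>: "\<eta> > 0" and a: "a > 0"
    and \<kappa>: "\<kappa> = 2 * (1 / \<eta> + 1 / \<eta>\<^sup>2 + 1 / (\<eta> * a) + 1 / (\<eta>\<^sup>2 * a))"
begin

abbreviation (input) "R \<omega> \<equiv> array_resolvent N w c \<eta> (\<lambda>i j. X i j \<omega>)"
abbreviation (input) "C \<omega> \<equiv> array_product N w c \<eta> a (\<lambda>i j. X i j \<omega>)"
abbreviation (input) "R\<^sub>0 p q \<omega> \<equiv> array_resolvent N w c \<eta> (zero_entry p q (\<lambda>i j. X i j \<omega>))"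
abbreviation (input) "C\<^sub>0 p q \<omega> \<equiv> array_product N w c \<eta> a (zero_entry p q (\<lambda>i j. X i j \<omega>))"

text \<open>With A = 1 / \<eta> bounding the entries of R, and B equal to 1 / \<eta> for R or 1 /
  (\<eta> a) for R D, the constants 2 B and 2 A B of \<open>norm_expansion_difference_le\<close>
  take four values; \<open>\<kappa>\<close> is their sum, so that a single constant serves
  everywhere.\<close>

lemma kappa_bounds:
  "1 / \<eta> \<le> \<kappa>" "1 / (\<eta> * a) \<le> \<kappa>" "2 * (1 / \<eta>) \<le> \<kappa>" "2 * (1 / (\<eta> * a)) \<le> \<kappa>"
  "2 * (1 / \<eta>) * (1 / \<eta>) \<le> \<kappa>" "2 * (1 / \<eta>) * (1 / (\<eta> * a)) \<le> \<kappa>" "0 \<le> \<kappa>"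
proof -
  define A1 A2 A3 A4 where A: "A1 = 1 / \<eta>" "A2 = 1 / \<eta>\<^sup>2" "A3 = 1 / (\<eta> * a)" "A4 = 1 / (\<eta>\<^sup>2 * a)"
  have nn: "A1 \<ge> 0" "A2 \<ge> 0" "A3 \<ge> 0" "A4 \<ge> 0" using \<eta> a by (auto simp: A)
  have k: "\<kappa> = 2 * (A1 + A2 + A3 + A4)" by (simp only: \<kappa> A)
  have "2 * A1 * A1 = 2 * A2" "2 * A1 * A3 = 2 * A4" by (simp_all add: A power2_eq_square)
  then show "1 / \<eta> \<le> \<kappa>" "1 / (\<eta> * a) \<le> \<kappa>" "2 * (1 / \<eta>) \<le> \<kappa>" "2 * (1 / (\<eta> * a)) \<le> \<kappa>"
    "2 * (1 / \<eta>) * (1 / \<eta>) \<le> \<kappa>" "2 * (1 / \<eta>) * (1 / (\<eta> * a)) \<le> \<kappa>" "0 \<le> \<kappa>"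
    unfolding A(1)[symmetric] A(3)[symmetric] k using nn by simp_all
qed

lemma R_le: "i < 2 * N \<Longrightarrow> k < 2 * N \<Longrightarrow> cmod (array_resolvent N w c \<eta> x i k) \<le> \<kappa>"
  using norm_array_resolvent_le[OF \<eta>, of i N k w c x] kappa_bounds(1) by linarith

lemma C_le: "i < 2 * N \<Longrightarrow> k < 2 * N \<Longrightarrow> cmod (array_product N w c \<eta> a x i k) \<le> \<kappa>"
  using norm_array_product_le[OF \<eta> a, of i N k w c x] kappa_bounds(2) by linarith

lemma R_difference_le:
  assumes "p < N" "q < N" "i < 2 * N" "k < 2 * N"
  shows "cmod (array_resolvent N w c \<eta> x i k - array_resolvent N w c \<eta> (zero_entry p q x) i k) \<le>
    \<kappa> * min 1 (c * cmod (x p q))"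
  by (rule norm_expansion_difference_le[OF array_resolvent_expansion[OF \<eta> assms] c _ _ _ _ _ _
        kappa_bounds(3) kappa_bounds(5)])
     (use assms in \<open>auto intro!: norm_array_resolvent_le \<eta>\<close>)

lemma C_difference_le:
  assumes "p < N" "q < N" "i < 2 * N" "k < 2 * N"
  shows "cmod (array_product N w c \<eta> a x i k - array_product N w c \<eta> a (zero_entry p q x) i k) \<le>
    \<kappa> * min 1 (c * cmod (x p q))"
  by (rule norm_expansion_difference_le[OF array_product_expansion[OF \<eta> assms(1-3)] c _ _ _ _ _ _
        kappa_bounds(4) kappa_bounds(6)])
     (use assms in \<open>auto intro!: norm_array_resolvent_le norm_array_product_le \<eta> a\<close>)

lemma R_measurable [measurable]:
  "i < 2 * N \<Longrightarrow> k < 2 * N \<Longrightarrow> (\<lambda>\<omega>. R \<omega> i k) \<in> borel_measurable P"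
  by (rule borel_measurable_array_resolvent) auto

lemma C_measurable [measurable]:
  "i < 2 * N \<Longrightarrow> (\<lambda>\<omega>. C \<omega> i k) \<in> borel_measurable P"
  by (rule borel_measurable_array_product) auto

lemma zero_entry_X_measurable: "(\<lambda>\<omega>. zero_entry p q (\<lambda>i j. X i j \<omega>) i j) \<in> borel_measurable P"
  by (auto simp: zero_entry_def)

lemma R0_measurable: "i < 2 * N \<Longrightarrow> k < 2 * N \<Longrightarrow> (\<lambda>\<omega>. R\<^sub>0 p q \<omega> i k) \<in> borel_measurable P"
  by (rule borel_measurable_array_resolvent[OF zero_entry_X_measurable])

lemma C0_measurable: "i < 2 * N \<Longrightarrow> (\<lambda>\<omega>. C\<^sub>0 p q \<omega> i k) \<in> borel_measurable P"
  by (rule borel_measurable_array_product[OF zero_entry_X_measurable])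

lemma indep_C0: "i < 2 * N \<Longrightarrow> indep_var borel (X p q) borel (\<lambda>\<omega>. C\<^sub>0 p q \<omega> i k)"
  by (rule indep_zero_entry[of "\<lambda>x. array_product N w c \<eta> a x i k"])
     (rule borel_measurable_array_product[OF zero_entry_component_measurable])

lemma indep_R0_C0:
  "i < 2 * N \<Longrightarrow> k < 2 * N \<Longrightarrow> j < 2 * N \<Longrightarrow> indep_var borel (X p q) borel (\<lambda>\<omega>. R\<^sub>0 p q \<omega> i k * C\<^sub>0 p q \<omega> j l)"
  by (rule indep_zero_entry[of "\<lambda>x. array_resolvent N w c \<eta> x i k * array_product N w c \<eta> a x j l"])
     (intro borel_measurable_times borel_measurable_array_product[OF zero_entry_component_measurable]
        borel_measurable_array_resolvent[OF zero_entry_component_measurable])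

text \<open>In the Hermitization \<open>X p q\<close> sits at (p, N + q). Expanding the entry (N +
  q, p) of R D, the factor |X|^2 meets the diagonal entries
  \<open>R \<omega> (N + q) (N + q)\<close> and \<open>C \<omega> p p\<close>, while X^2 meets the
  off-diagonal \<open>R \<omega> (N + q) p\<close>.\<close>

lemma entry_estimate:
  assumes pq: "p < N" "q < N"
  shows "cmod (expectation (\<lambda>\<omega>. X p q \<omega> * C \<omega> (N + q) p) + of_real c * expectation (\<lambda>\<omega>. R \<omega> (N + q) (N + q) * C \<omega> p p)) \<le>
    c * (4 * \<kappa>\<^sup>2 * truncation_error c + \<kappa> * expectation (\<lambda>\<omega>. cmod (R \<omega> (N + q) p)))"
proof -
  have "cmod (expectation (\<lambda>\<omega>. X p q \<omega> * C \<omega> (N + q) p) + of_real c * expectation (\<lambda>\<omega>. R \<omega> (N + q) (N + q) * C \<omega> p p)) \<le>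
    c * (4 * \<kappa>\<^sup>2 * expectation (\<lambda>\<omega>. (1 + (cmod (X p q \<omega>))\<^sup>2) * min 1 (c * cmod (X p q \<omega>)))
      + \<kappa> * expectation (\<lambda>\<omega>. cmod (R \<omega> (N + q) p)))"
  proof (rule second_order_expansion[where ?C0.0 = "\<lambda>\<omega>. C\<^sub>0 p q \<omega> (N + q) p" and ?C0'.0 = "\<lambda>\<omega>. C\<^sub>0 p q \<omega> p p"
        and ?R0.0 = "\<lambda>\<omega>. R\<^sub>0 p q \<omega> (N + q) p" and ?R0'.0 = "\<lambda>\<omega>. R\<^sub>0 p q \<omega> (N + q) (N + q)"])
    show "C \<omega> (N + q) p = C\<^sub>0 p q \<omega> (N + q) p - of_real c *
      (X p q \<omega> * R\<^sub>0 p q \<omega> (N + q) p * C \<omega> (N + q) p + cnj (X p q \<omega>) * R\<^sub>0 p q \<omega> (N + q) (N + q) * C \<omega> p p)" for \<omega>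
      using pq by (intro array_product_expansion[OF \<eta>]) auto
  qed (use pq c in \<open>auto intro!: R_le C_le R_difference_le C_difference_le R_measurable C_measurable
      R0_measurable C0_measurable indep_C0 indep_R0_C0 mean var\<close>)
  then show ?thesis by (simp only: truncation_error_eq)
qed

text \<open>The mirror image for the position (N + q, p): the variable \<xi> is now the conjugate
  entry, so the two correction terms exchange their roles.\<close>

lemma entry_estimate_cnj:
  assumes pq: "p < N" "q < N"
  shows "cmod (expectation (\<lambda>\<omega>. cnj (X p q \<omega>) * C \<omega> p (N + q)) + of_real c * expectation (\<lambda>\<omega>. R \<omega> p p * C \<omega> (N + q) (N + q))) \<le>
    c * (4 * \<kappa>\<^sup>2 * truncation_error c + \<kappa> * expectation (\<lambda>\<omega>. cmod (R \<omega> p (N + q))))"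
proof -
  have cnj_meas [measurable]: "cnj \<in> borel_measurable borel"
    by (intro borel_measurable_continuous_onI continuous_intros)
  have indep_cnj: "indep_var borel (\<lambda>\<omega>. cnj (X p q \<omega>)) borel Z" if "indep_var borel (X p q) borel Z" for Z :: "'w \<Rightarrow> complex"
  proof -
    have "indep_var borel (cnj \<circ> X p q) borel ((\<lambda>x. x) \<circ> Z)"
      by (rule indep_var_compose[OF that]) auto
    then show ?thesis by (simp only: o_def)
  qed
  have "cmod (expectation (\<lambda>\<omega>. cnj (X p q \<omega>) * C \<omega> p (N + q)) + of_real c * expectation (\<lambda>\<omega>. R \<omega> p p * C \<omega> (N + q) (N + q))) \<le>
    c * (4 * \<kappa>\<^sup>2 * expectation (\<lambda>\<omega>. (1 + (cmod (cnj (X p q \<omega>)))\<^sup>2) * min 1 (c * cmod (cnj (X p q \<omega>))))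
      + \<kappa> * expectation (\<lambda>\<omega>. cmod (R \<omega> p (N + q))))"
  proof (rule second_order_expansion[where ?C0.0 = "\<lambda>\<omega>. C\<^sub>0 p q \<omega> p (N + q)" and ?C0'.0 = "\<lambda>\<omega>. C\<^sub>0 p q \<omega> (N + q) (N + q)"
        and ?R0.0 = "\<lambda>\<omega>. R\<^sub>0 p q \<omega> p (N + q)" and ?R0'.0 = "\<lambda>\<omega>. R\<^sub>0 p q \<omega> p p"])
    show "C \<omega> p (N + q) = C\<^sub>0 p q \<omega> p (N + q) - of_real c *
      (cnj (X p q \<omega>) * R\<^sub>0 p q \<omega> p (N + q) * C \<omega> p (N + q) + cnj (cnj (X p q \<omega>)) * R\<^sub>0 p q \<omega> p p * C \<omega> (N + q) (N + q))" for \<omega>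
      using array_product_expansion[OF \<eta> pq, of p w c a "\<lambda>i j. X i j \<omega>" "N + q"] pq by (simp add: add.commute)
  qed (use pq c in \<open>auto intro!: R_le C_le R_difference_le C_difference_le R_measurable C_measurable
      R0_measurable C0_measurable indep_cnj indep_C0 indep_R0_C0 simp: mean var\<close>)
  then show ?thesis by (simp only: truncation_error_eq complex_mod_cnj)
qed

end

end

section \<open>The fixed-point equation\<close>

text \<open>The entry estimates are inserted into the trace difference and summed over all N^2
  entries, which turns their main terms into traces. Here \<open>g\<close> and \<open>n\<close> are
  the normalised traces of the two resolvents, stripped of \<i> \<eta> and \<i> a. The number
  \<open>s\<close> may be any candidate for the limit of \<open>g\<close>; the price of a wrong
  guess is the last term of the bound.\<close>

lemma (in iid_array) fixed_point_estimate:
  fixes N :: nat and w :: "nat \<Rightarrow> nat \<Rightarrow> complex" and \<sigma> \<eta> s a c \<kappa> n :: real and g :: "'w \<Rightarrow> real"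
  assumes N: "N \<ge> 1" and \<sigma>: "\<sigma> > 0" and \<eta>: "\<eta> > 0" and s: "s \<ge> 0"
    and a: "a = \<eta> * (1 + \<sigma>\<^sup>2 * s)" and c: "c = \<sigma> / sqrt N"
    and \<kappa>: "\<kappa> = 2 * (1 / \<eta> + 1 / \<eta>\<^sup>2 + 1 / (\<eta> * a) + 1 / (\<eta>\<^sup>2 * a))"
    and g: "\<And>\<omega>. (\<Sum>i<N. array_resolvent N w c \<eta> (\<lambda>i j. X i j \<omega>) i i) = \<i> * of_real (\<eta> * real N * g \<omega>)"
    and n: "(\<Sum>i<N. resolvent (2 * N) (hermitization N w) a i i) = \<i> * of_real (a * real N * n)"
  shows "g \<in> borel_measurable P" "\<And>\<omega>. \<bar>g \<omega>\<bar> \<le> 1 / \<eta>\<^sup>2"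
    and "\<bar>a * n - \<eta> * expectation g\<bar> \<le>
      \<sigma>\<^sup>2 * (4 * \<kappa>\<^sup>2 * truncation_error c + \<kappa> / (\<eta> * sqrt N) + \<eta> * \<kappa> * expectation (\<lambda>\<omega>. \<bar>g \<omega> - s\<bar>))"
proof -
  have a0: "a > 0" using a \<eta> s by (simp add: add_pos_nonneg)
  have c0: "c \<ge> 0" using c \<sigma> by simp
  have c2: "c * c = \<sigma>\<^sup>2 / N" using N by (simp add: c power2_eq_square)
  note ctx = c0 \<eta> a0 \<kappa>
  define R where "R = (\<lambda>\<omega>. array_resolvent N w c \<eta> (\<lambda>i j. X i j \<omega>))"
  define C where "C = (\<lambda>\<omega>. array_product N w c \<eta> a (\<lambda>i j. X i j \<omega>))"
  have R_meas [measurable]: "(\<lambda>\<omega>. R \<omega> i k) \<in> borel_measurable P" if "i < 2 * N" "k < 2 * N" for i k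
    unfolding R_def by (rule R_measurable[OF ctx that])
  have C_meas [measurable]: "(\<lambda>\<omega>. C \<omega> i k) \<in> borel_measurable P" if "i < 2 * N" for i k
    unfolding C_def by (rule C_measurable[OF ctx that])
  have R_le: "cmod (R \<omega> i k) \<le> \<kappa>" if "i < 2 * N" "k < 2 * N" for \<omega> i k
    unfolding R_def by (rule R_le[OF ctx that])
  have C_le: "cmod (C \<omega> i k) \<le> \<kappa>" if "i < 2 * N" "k < 2 * N" for \<omega> i k
    unfolding C_def by (rule C_le[OF ctx that])
  have \<kappa>0: "\<kappa> \<ge> 0" by (rule kappa_bounds(7)[OF ctx])
  define trC where "trC = (\<lambda>\<omega>. \<Sum>i<2 * N. C \<omega> i i)"
  have trC_meas [measurable]: "trC \<in> borel_measurable P"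
    unfolding trC_def by (intro borel_measurable_sum C_meas) auto
  have trC_le: "cmod (trC \<omega>) \<le> 2 * N * \<kappa>" for \<omega>
  proof -
    have "cmod (trC \<omega>) \<le> (\<Sum>i<2 * N. \<kappa>)"
      unfolding trC_def by (rule order_trans[OF norm_sum]) (intro sum_mono C_le; simp)
    then show ?thesis by simp
  qed
  have g': "(\<Sum>i<N. R \<omega> i i) = \<i> * of_real (\<eta> * real N * g \<omega>)" for \<omega>
    unfolding R_def by (rule g)
  have g'': "(\<Sum>j<N. R \<omega> (N + j) (N + j)) = \<i> * of_real (\<eta> * real N * g \<omega>)" for \<omega>
    unfolding g'[symmetric] unfolding R_def array_resolvent_def
    by (rule resolvent_hermitization_block_traces[OF \<eta>])
  have g_eq: "g \<omega> = Im (\<Sum>i<N. R \<omega> i i) / (\<eta> * real N)" for \<omega>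
    unfolding g' using \<eta> N by simp
  have Im_meas: "Im \<in> borel_measurable borel" by (intro borel_measurable_continuous_onI continuous_intros)
  have "(\<lambda>\<omega>. Im (\<Sum>i<N. R \<omega> i i) / (\<eta> * real N)) \<in> borel_measurable P"
    by (intro borel_measurable_divide borel_measurable_const measurable_compose[OF _ Im_meas]
        borel_measurable_sum R_meas) auto
  then show g_meas [measurable]: "g \<in> borel_measurable P"
    by (simp add: g_eq[abs_def])
  show g_le: "\<bar>g \<omega>\<bar> \<le> 1 / \<eta>\<^sup>2" for \<omega>
  proof -
    have "\<bar>Im (\<Sum>i<N. R \<omega> i i)\<bar> \<le> cmod (\<Sum>i<N. R \<omega> i i)" by (rule abs_Im_le_cmod)
    also have "\<dots> \<le> (\<Sum>i<N. 1 / \<eta>)"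
      unfolding R_def by (rule order_trans[OF norm_sum]) (intro sum_mono norm_array_resolvent_le \<eta>; simp)
    finally have "\<bar>Im (\<Sum>i<N. R \<omega> i i)\<bar> \<le> N / \<eta>" by simp
    then have "\<bar>Im (\<Sum>i<N. R \<omega> i i)\<bar> / (\<eta> * real N) \<le> (N / \<eta>) / (\<eta> * real N)"
      using \<eta> by (intro divide_right_mono) auto
    then show ?thesis using \<eta> N by (simp add: g_eq abs_mult power2_eq_square)
  qed
  have int_bnd: "integrable P F" if "F \<in> borel_measurable P" "\<And>\<omega>. norm (F \<omega>) \<le> b" for F :: "'w \<Rightarrow> complex" and b
    using that by (intro integrable_const_bound[of _ b]) auto
  have int_g: "integrable P g" by (rule integrable_const_bound[of _ "1 / \<eta>\<^sup>2"]) (use g_le in auto)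
  have int_gs: "integrable P (\<lambda>\<omega>. \<bar>g \<omega> - s\<bar>)" using int_g by auto
  have int_trC: "integrable P trC" by (rule int_bnd[OF trC_meas trC_le])
  have int_gtrC: "integrable P (\<lambda>\<omega>. of_real (g \<omega>) * trC \<omega>)"
  proof (rule int_bnd[of _ "1 / \<eta>\<^sup>2 * (2 * N * \<kappa>)"])
    show "norm (of_real (g \<omega>) * trC \<omega>) \<le> 1 / \<eta>\<^sup>2 * (2 * N * \<kappa>)" for \<omega>
      unfolding norm_mult norm_of_real by (intro mult_mono g_le trC_le) auto
  qed measurable
  have int_XC: "integrable P (\<lambda>\<omega>. X p q \<omega> * C \<omega> i k)" "integrable P (\<lambda>\<omega>. cnj (X p q \<omega>) * C \<omega> i k)"
    if "i < 2 * N" "k < 2 * N" for p q i k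
  proof -
    have cnj_meas [measurable]: "cnj \<in> borel_measurable borel"
      by (intro borel_measurable_continuous_onI continuous_intros)
    have int: "integrable P (\<lambda>\<omega>. \<kappa> * cmod (X p q \<omega>))" using mean(1) by auto
    have "integrable P (\<lambda>\<omega>. Y \<omega> * C \<omega> i k)"
      if Y: "Y \<in> borel_measurable P" "\<And>\<omega>. cmod (Y \<omega>) = cmod (X p q \<omega>)" for Y
    proof (rule Bochner_Integration.integrable_bound[OF int])
      show "(\<lambda>\<omega>. Y \<omega> * C \<omega> i k) \<in> borel_measurable P"
        by (intro borel_measurable_times Y C_meas \<open>i < 2 * N\<close>)
      show "AE \<omega> in P. norm (Y \<omega> * C \<omega> i k) \<le> norm (\<kappa> * cmod (X p q \<omega>))"
      proof (rule AE_I2)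
        fix \<omega>
        show "norm (Y \<omega> * C \<omega> i k) \<le> norm (\<kappa> * cmod (X p q \<omega>))"
          using mult_left_mono[OF C_le[OF \<open>i < 2 * N\<close> \<open>k < 2 * N\<close>], of "cmod (X p q \<omega>)" \<omega>] \<kappa>0
          by (simp add: norm_mult Y(2) abs_mult mult.commute)
      qed
    qed
    from this[of "X p q"] this[of "\<lambda>\<omega>. cnj (X p q \<omega>)"]
    show "integrable P (\<lambda>\<omega>. X p q \<omega> * C \<omega> i k)" "integrable P (\<lambda>\<omega>. cnj (X p q \<omega>) * C \<omega> i k)"
      by simp_all
  qed
  have int_RC: "integrable P (\<lambda>\<omega>. R \<omega> j l * C \<omega> i k)"
    if "j < 2 * N" "l < 2 * N" "i < 2 * N" "k < 2 * N" for j l i k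
  proof (rule int_bnd[of _ "\<kappa> * \<kappa>"])
    show "norm (R \<omega> j l * C \<omega> i k) \<le> \<kappa> * \<kappa>" for \<omega>
      unfolding norm_mult using that \<kappa>0 by (intro mult_mono R_le C_le) auto
    show "(\<lambda>\<omega>. R \<omega> j l * C \<omega> i k) \<in> borel_measurable P"
      using that by (intro borel_measurable_times R_meas C_meas)
  qed
  define U where "U = (\<lambda>p q. expectation (\<lambda>\<omega>. X p q \<omega> * C \<omega> (N + q) p)
     + of_real c * expectation (\<lambda>\<omega>. R \<omega> (N + q) (N + q) * C \<omega> p p))"
  define V where "V = (\<lambda>p q. expectation (\<lambda>\<omega>. cnj (X p q \<omega>) * C \<omega> p (N + q))
     + of_real c * expectation (\<lambda>\<omega>. R \<omega> p p * C \<omega> (N + q) (N + q)))"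
  define \<tau> where "\<tau> = truncation_error c"
  have U_le: "cmod (U p q) \<le> c * (4 * \<kappa>\<^sup>2 * \<tau> + \<kappa> * expectation (\<lambda>\<omega>. cmod (R \<omega> (N + q) p)))" if "p < N" "q < N" for p q
    unfolding U_def R_def C_def \<tau>_def by (rule entry_estimate[OF ctx that])
  have V_le: "cmod (V p q) \<le> c * (4 * \<kappa>\<^sup>2 * \<tau> + \<kappa> * expectation (\<lambda>\<omega>. cmod (R \<omega> p (N + q))))" if "p < N" "q < N" for p q
    unfolding V_def R_def C_def \<tau>_def by (rule entry_estimate_cnj[OF ctx that])
  have int_R: "integrable P (\<lambda>\<omega>. cmod (R \<omega> i k))" if "i < 2 * N" "k < 2 * N" for i k
    by (rule integrable_norm, rule int_bnd[OF R_meas R_le]) (use that in auto)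
  \<comment> \<open>Summed over the remaining index, the off-diagonal entries total at most 2 N sqrt
    N / \<eta> rather than order N^2; after multiplication by c^2 and division by N this vanishes
    like 1 / sqrt N.\<close>
  have row: "(\<Sum>k<N. expectation (\<lambda>\<omega>. cmod (R \<omega> i (f k)))) \<le> sqrt N / \<eta>"
    if "i < 2 * N" "\<And>k. k < N \<Longrightarrow> f k < 2 * N" "inj_on f {..<N}" for i f
  proof -
    have "(\<Sum>k<N. expectation (\<lambda>\<omega>. cmod (R \<omega> i (f k)))) = expectation (\<lambda>\<omega>. \<Sum>k<N. cmod (R \<omega> i (f k)))"
      using that by (subst Bochner_Integration.integral_sum) (auto intro!: int_R)
    also have "\<dots> \<le> expectation (\<lambda>\<omega>. sqrt N / \<eta>)"
      using that
      by (intro integral_mono Bochner_Integration.integrable_sum int_R)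
         (auto simp: R_def intro!: sum_norm_array_resolvent_le \<eta>)
    finally show ?thesis by (simp add: prob_space)
  qed
  have "cmod (\<Sum>p<N. \<Sum>q<N. U p q + V p q) \<le> (\<Sum>p<N. \<Sum>q<N.
      c * (4 * \<kappa>\<^sup>2 * \<tau> + \<kappa> * expectation (\<lambda>\<omega>. cmod (R \<omega> (N + q) p))) +
      c * (4 * \<kappa>\<^sup>2 * \<tau> + \<kappa> * expectation (\<lambda>\<omega>. cmod (R \<omega> p (N + q)))))"
    by (rule order_trans[OF norm_sum], rule sum_mono, rule order_trans[OF norm_sum], rule sum_mono,
        rule order_trans[OF norm_triangle_ineq], rule add_mono) (auto intro!: U_le V_le)
  also have "\<dots> = c * (8 * \<kappa>\<^sup>2 * \<tau> * N * N + \<kappa> * ((\<Sum>p<N. \<Sum>q<N. expectation (\<lambda>\<omega>. cmod (R \<omega> (N + q) p))) +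
      (\<Sum>p<N. \<Sum>q<N. expectation (\<lambda>\<omega>. cmod (R \<omega> p (N + q))))))"
    by (simp add: sum.distrib sum_distrib_left algebra_simps)
  also have "\<dots> \<le> c * (8 * \<kappa>\<^sup>2 * \<tau> * N * N + \<kappa> * ((\<Sum>q<N. sqrt N / \<eta>) + (\<Sum>p<N. sqrt N / \<eta>)))"
  proof (rule mult_left_mono[OF add_left_mono[OF mult_left_mono[OF add_mono \<kappa>0]] c0])
    have "(\<Sum>p<N. \<Sum>q<N. expectation (\<lambda>\<omega>. cmod (R \<omega> (N + q) p))) = (\<Sum>q<N. \<Sum>p<N. expectation (\<lambda>\<omega>. cmod (R \<omega> (N + q) p)))"
      by (rule sum.swap)
    also have "\<dots> \<le> (\<Sum>q<N. sqrt N / \<eta>)"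
      by (intro sum_mono row[of _ "\<lambda>p. p"]) auto
    finally show "(\<Sum>p<N. \<Sum>q<N. expectation (\<lambda>\<omega>. cmod (R \<omega> (N + q) p))) \<le> (\<Sum>q<N. sqrt N / \<eta>)" .
    show "(\<Sum>p<N. \<Sum>q<N. expectation (\<lambda>\<omega>. cmod (R \<omega> p (N + q)))) \<le> (\<Sum>p<N. sqrt N / \<eta>)"
      by (intro sum_mono row) (auto simp: inj_on_def)
  qed
  finally have UV: "cmod (\<Sum>p<N. \<Sum>q<N. U p q + V p q) \<le> c * (8 * \<kappa>\<^sup>2 * \<tau> * N * N + 2 * \<kappa> * N * sqrt N / \<eta>)"
    by (simp add: algebra_simps)
  \<comment> \<open>The double sums factor into a diagonal block trace of R times the complementary
    one of R D. As both block traces of R equal \<i> \<eta> N g, the two products combine to the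
    full trace of R D.\<close>
  have RC_sum: "(\<Sum>p<N. \<Sum>q<N. expectation (\<lambda>\<omega>. R \<omega> (N + q) (N + q) * C \<omega> p p) + expectation (\<lambda>\<omega>. R \<omega> p p * C \<omega> (N + q) (N + q))) =
      \<i> * of_real (\<eta> * N) * expectation (\<lambda>\<omega>. of_real (g \<omega>) * trC \<omega>)"
  proof -
    have "(\<Sum>p<N. \<Sum>q<N. expectation (\<lambda>\<omega>. R \<omega> (N + q) (N + q) * C \<omega> p p) + expectation (\<lambda>\<omega>. R \<omega> p p * C \<omega> (N + q) (N + q))) =
       (\<Sum>p<N. \<Sum>q<N. expectation (\<lambda>\<omega>. R \<omega> (N + q) (N + q) * C \<omega> p p + R \<omega> p p * C \<omega> (N + q) (N + q)))"
      by (intro sum.cong refl Bochner_Integration.integral_add[symmetric] int_RC) auto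
    also have "\<dots> = (\<Sum>p<N. expectation (\<lambda>\<omega>. \<Sum>q<N. R \<omega> (N + q) (N + q) * C \<omega> p p + R \<omega> p p * C \<omega> (N + q) (N + q)))"
      by (intro sum.cong refl Bochner_Integration.integral_sum[symmetric] Bochner_Integration.integrable_add int_RC) auto
    also have "\<dots> = expectation (\<lambda>\<omega>. \<Sum>p<N. \<Sum>q<N. R \<omega> (N + q) (N + q) * C \<omega> p p + R \<omega> p p * C \<omega> (N + q) (N + q))"
      by (intro Bochner_Integration.integral_sum[symmetric] Bochner_Integration.integrable_sum
          Bochner_Integration.integrable_add int_RC) auto
    also have "\<dots> = expectation (\<lambda>\<omega>. (\<i> * of_real (\<eta> * N)) * (of_real (g \<omega>) * trC \<omega>))"
    proof (intro Bochner_Integration.integral_cong refl)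
      fix \<omega>
      have "(\<Sum>p<N. \<Sum>q<N. R \<omega> (N + q) (N + q) * C \<omega> p p + R \<omega> p p * C \<omega> (N + q) (N + q)) =
        (\<Sum>p<N. \<Sum>q<N. C \<omega> p p * R \<omega> (N + q) (N + q)) + (\<Sum>p<N. \<Sum>q<N. R \<omega> p p * C \<omega> (N + q) (N + q))"
        by (simp add: sum.distrib mult.commute)
      also have "\<dots> = (\<Sum>p<N. C \<omega> p p) * (\<Sum>q<N. R \<omega> (N + q) (N + q)) + (\<Sum>p<N. R \<omega> p p) * (\<Sum>q<N. C \<omega> (N + q) (N + q))"
        by (simp only: sum_product)
      also have "\<dots> = (\<i> * of_real (\<eta> * N)) * (of_real (g \<omega>) * trC \<omega>)"
        unfolding g' g'' trC_def sum_lessThan_double by (simp add: algebra_simps)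
      finally show "(\<Sum>p<N. \<Sum>q<N. R \<omega> (N + q) (N + q) * C \<omega> p p + R \<omega> p p * C \<omega> (N + q) (N + q)) =
        (\<i> * of_real (\<eta> * N)) * (of_real (g \<omega>) * trC \<omega>)" .
    qed
    finally show ?thesis by simp
  qed
  have nn: "(\<Sum>j<N. resolvent (2 * N) (hermitization N w) a (N + j) (N + j)) = \<i> * of_real (a * real N * n)"
    unfolding n[symmetric] by (rule resolvent_hermitization_block_traces[OF a0])
  \<comment> \<open>The factor 2 counts the two diagonal blocks, whose traces coincide for either
    resolvent.\<close>
  have point: "\<i> * of_real (2 * real N * (a * n - \<eta> * g \<omega>)) =
     of_real c * (\<Sum>p<N. \<Sum>q<N. X p q \<omega> * C \<omega> (N + q) p + cnj (X p q \<omega>) * C \<omega> p (N + q))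
     + \<i> * of_real (a - \<eta>) * trC \<omega>" for \<omega>
  proof -
    have "(\<Sum>i<2 * N. resolvent (2 * N) (hermitization N w) a i i) - (\<Sum>i<2 * N. R \<omega> i i) =
        \<i> * of_real (2 * real N * (a * n - \<eta> * g \<omega>))"
      unfolding sum_lessThan_double g' g'' n nn by (simp add: algebra_simps)
    then show ?thesis
      using trace_difference_array_resolvent[OF \<eta> a0, of N w c "\<lambda>i j. X i j \<omega>"]
      by (simp add: R_def C_def trC_def)
  qed
  have "\<i> * of_real (2 * real N * (a * n - \<eta> * expectation g)) =
      expectation (\<lambda>\<omega>. \<i> * of_real (2 * real N * (a * n - \<eta> * g \<omega>)))"
    using int_g by (simp add: prob_space del: of_real_mult of_real_diff)
  also have "\<dots> = expectation (\<lambda>\<omega>. of_real c * (\<Sum>p<N. \<Sum>q<N. X p q \<omega> * C \<omega> (N + q) p + cnj (X p q \<omega>) * C \<omega> p (N + q))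
     + \<i> * of_real (a - \<eta>) * trC \<omega>)"
    by (simp only: point)
  also have "\<dots> = of_real c * expectation (\<lambda>\<omega>. \<Sum>p<N. \<Sum>q<N. X p q \<omega> * C \<omega> (N + q) p + cnj (X p q \<omega>) * C \<omega> p (N + q))
     + \<i> * of_real (a - \<eta>) * expectation trC"
  proof (subst Bochner_Integration.integral_add)
    show "integrable P (\<lambda>\<omega>. of_real c * (\<Sum>p<N. \<Sum>q<N. X p q \<omega> * C \<omega> (N + q) p + cnj (X p q \<omega>) * C \<omega> p (N + q)))"
      by (intro integrable_mult_right Bochner_Integration.integrable_sum Bochner_Integration.integrable_add int_XC) auto
    show "integrable P (\<lambda>\<omega>. \<i> * of_real (a - \<eta>) * trC \<omega>)"
      by (intro integrable_mult_right int_trC)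
  qed simp
  also have "expectation (\<lambda>\<omega>. \<Sum>p<N. \<Sum>q<N. X p q \<omega> * C \<omega> (N + q) p + cnj (X p q \<omega>) * C \<omega> p (N + q)) =
      (\<Sum>p<N. expectation (\<lambda>\<omega>. \<Sum>q<N. X p q \<omega> * C \<omega> (N + q) p + cnj (X p q \<omega>) * C \<omega> p (N + q)))"
    by (intro Bochner_Integration.integral_sum Bochner_Integration.integrable_sum
          Bochner_Integration.integrable_add int_XC) auto
  also have "\<dots> = (\<Sum>p<N. \<Sum>q<N. expectation (\<lambda>\<omega>. X p q \<omega> * C \<omega> (N + q) p + cnj (X p q \<omega>) * C \<omega> p (N + q)))"
    by (intro sum.cong refl Bochner_Integration.integral_sum Bochner_Integration.integrable_add int_XC) auto
  also have "\<dots> = (\<Sum>p<N. \<Sum>q<N. expectation (\<lambda>\<omega>. X p q \<omega> * C \<omega> (N + q) p) + expectation (\<lambda>\<omega>. cnj (X p q \<omega>) * C \<omega> p (N + q)))"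
    by (intro sum.cong refl Bochner_Integration.integral_add int_XC) auto
  also have "\<dots> = (\<Sum>p<N. \<Sum>q<N. U p q + V p q - of_real c *
      (expectation (\<lambda>\<omega>. R \<omega> (N + q) (N + q) * C \<omega> p p) + expectation (\<lambda>\<omega>. R \<omega> p p * C \<omega> (N + q) (N + q))))"
    by (intro sum.cong refl) (simp add: U_def V_def algebra_simps)
  also have "\<dots> = (\<Sum>p<N. \<Sum>q<N. U p q + V p q) - of_real c *
      (\<Sum>p<N. \<Sum>q<N. expectation (\<lambda>\<omega>. R \<omega> (N + q) (N + q) * C \<omega> p p) + expectation (\<lambda>\<omega>. R \<omega> p p * C \<omega> (N + q) (N + q)))"
    by (simp only: sum_subtractf sum_distrib_left)
  also have "\<dots> = (\<Sum>p<N. \<Sum>q<N. U p q + V p q) - of_real c *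
      (\<i> * of_real (\<eta> * N) * expectation (\<lambda>\<omega>. of_real (g \<omega>) * trC \<omega>))"
    by (simp only: RC_sum)
  finally have main: "\<i> * of_real (2 * real N * (a * n - \<eta> * expectation g)) =
      of_real c * (\<Sum>p<N. \<Sum>q<N. U p q + V p q)
      + (\<i> * of_real (a - \<eta>) * expectation trC
         - of_real (c * c * (\<eta> * N)) * (\<i> * expectation (\<lambda>\<omega>. of_real (g \<omega>) * trC \<omega>)))"
    by (simp add: algebra_simps)
  \<comment> \<open>The cancellation for which \<open>a\<close> was chosen: the second-order terms
    have weight c^2 \<eta> N = \<sigma>^2 \<eta> and the shift has weight a - \<eta> = \<sigma>^2
    \<eta> s, so only (s - g) times the trace of R D remains.\<close>
  have e1: "c * c * (\<eta> * N) = \<sigma>\<^sup>2 * \<eta>" unfolding c2 using N by simp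
  have e2: "a - \<eta> = \<sigma>\<^sup>2 * \<eta> * s" by (simp add: a algebra_simps)
  have e3: "expectation (\<lambda>\<omega>. of_real (s - g \<omega>) * trC \<omega>) =
      of_real s * expectation trC - expectation (\<lambda>\<omega>. of_real (g \<omega>) * trC \<omega>)"
    using int_trC int_gtrC by (simp add: left_diff_distrib)
  have rest: "\<i> * of_real (a - \<eta>) * expectation trC
         - of_real (c * c * (\<eta> * N)) * (\<i> * expectation (\<lambda>\<omega>. of_real (g \<omega>) * trC \<omega>)) =
      \<i> * of_real (\<sigma>\<^sup>2 * \<eta>) * expectation (\<lambda>\<omega>. of_real (s - g \<omega>) * trC \<omega>)"
    unfolding e1 e2 e3 by (simp add: algebra_simps)
  have sg: "cmod (expectation (\<lambda>\<omega>. of_real (s - g \<omega>) * trC \<omega>)) \<le> 2 * N * \<kappa> * expectation (\<lambda>\<omega>. \<bar>g \<omega> - s\<bar>)"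
  proof -
    have "cmod (expectation (\<lambda>\<omega>. of_real (s - g \<omega>) * trC \<omega>)) \<le> expectation (\<lambda>\<omega>. 2 * N * \<kappa> * \<bar>g \<omega> - s\<bar>)"
    proof (rule norm_integral_le_integral)
      show "integrable P (\<lambda>\<omega>. of_real (s - g \<omega>) * trC \<omega>)"
        using int_trC int_gtrC by (simp add: left_diff_distrib)
      show "norm (of_real (s - g \<omega>) * trC \<omega>) \<le> 2 * N * \<kappa> * \<bar>g \<omega> - s\<bar>" for \<omega>
        using mult_right_mono[OF trC_le[of \<omega>], of "\<bar>g \<omega> - s\<bar>"]
        unfolding norm_mult norm_of_real by (simp add: abs_minus_commute mult.commute)
    qed (use int_gs in auto)
    then show ?thesis by simp
  qed
  have "2 * real N * \<bar>a * n - \<eta> * expectation g\<bar> = cmod (\<i> * of_real (2 * real N * (a * n - \<eta> * expectation g)))"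
    unfolding norm_mult norm_of_real by (simp add: abs_mult)
  also have "\<dots> \<le> cmod (of_real c * (\<Sum>p<N. \<Sum>q<N. U p q + V p q)) +
      cmod (\<i> * of_real (\<sigma>\<^sup>2 * \<eta>) * expectation (\<lambda>\<omega>. of_real (s - g \<omega>) * trC \<omega>))"
    unfolding main rest by (rule norm_triangle_ineq)
  also have "\<dots> \<le> c * (c * (8 * \<kappa>\<^sup>2 * \<tau> * N * N + 2 * \<kappa> * N * sqrt N / \<eta>)) +
      \<sigma>\<^sup>2 * \<eta> * (2 * N * \<kappa> * expectation (\<lambda>\<omega>. \<bar>g \<omega> - s\<bar>))"
  proof (rule add_mono)
    show "cmod (of_real c * (\<Sum>p<N. \<Sum>q<N. U p q + V p q)) \<le> c * (c * (8 * \<kappa>\<^sup>2 * \<tau> * N * N + 2 * \<kappa> * N * sqrt N / \<eta>))"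
      unfolding norm_mult norm_of_real abs_of_nonneg[OF c0] by (rule mult_left_mono[OF UV c0])
    have "cmod (\<i> * of_real (\<sigma>\<^sup>2 * \<eta>) * expectation (\<lambda>\<omega>. of_real (s - g \<omega>) * trC \<omega>)) =
        \<sigma>\<^sup>2 * \<eta> * cmod (expectation (\<lambda>\<omega>. of_real (s - g \<omega>) * trC \<omega>))"
      unfolding norm_mult norm_of_real using \<eta> by simp
    also have "\<dots> \<le> \<sigma>\<^sup>2 * \<eta> * (2 * N * \<kappa> * expectation (\<lambda>\<omega>. \<bar>g \<omega> - s\<bar>))"
      using \<eta> by (intro mult_left_mono sg) auto
    finally show "cmod (\<i> * of_real (\<sigma>\<^sup>2 * \<eta>) * expectation (\<lambda>\<omega>. of_real (s - g \<omega>) * trC \<omega>)) \<le>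
        \<sigma>\<^sup>2 * \<eta> * (2 * N * \<kappa> * expectation (\<lambda>\<omega>. \<bar>g \<omega> - s\<bar>))" .
  qed
  also have "\<dots> = 2 * real N * (\<sigma>\<^sup>2 * (4 * \<kappa>\<^sup>2 * \<tau> + \<kappa> / (\<eta> * sqrt N) + \<eta> * \<kappa> * expectation (\<lambda>\<omega>. \<bar>g \<omega> - s\<bar>)))"
  proof -
    have "sqrt N = N / sqrt N" using N by (simp add: real_div_sqrt)
    then have "c * (c * (8 * \<kappa>\<^sup>2 * \<tau> * N * N + 2 * \<kappa> * N * sqrt N / \<eta>)) =
        (c * c) * (8 * \<kappa>\<^sup>2 * \<tau> * N * N + 2 * \<kappa> * N * (N / sqrt N) / \<eta>)" by simp
    also have "\<dots> = \<sigma>\<^sup>2 * (8 * \<kappa>\<^sup>2 * \<tau> * N + 2 * \<kappa> * (N / sqrt N) / \<eta>)"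
      unfolding c2 using N by (simp add: field_simps)
    finally show ?thesis using \<eta> by (simp add: algebra_simps)
  qed
  finally show "\<bar>a * n - \<eta> * expectation g\<bar> \<le>
      \<sigma>\<^sup>2 * (4 * \<kappa>\<^sup>2 * truncation_error c + \<kappa> / (\<eta> * sqrt N) + \<eta> * \<kappa> * expectation (\<lambda>\<omega>. \<bar>g \<omega> - s\<bar>))"
    using N by (simp add: \<tau>_def)
qed

section \<open>Passage to the limit of large matrices\<close>

lemma resolvent_cong:
  assumes "\<And>i j. i < n \<Longrightarrow> j < n \<Longrightarrow> h i j = h' i j"
  shows "resolvent n h \<eta> = resolvent n h' \<eta>"
proof -
  have "Matrix.mat n n (\<lambda>(i, j). shifted h \<eta> i j) = Matrix.mat n n (\<lambda>(i, j). shifted h' \<eta> i j)"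
    by (rule eq_matI) (auto simp: shifted_def assms)
  then show ?thesis by (simp add: resolvent_def[abs_def])
qed

lemma resolvent_test_bounded_continuous:
  assumes "t > 0"
  shows "continuous_on UNIV (resolvent_test t)" "bounded (range (resolvent_test t))"
proof -
  have pos: "max x 0 + t > 0" for x :: real using assms by (simp add: add_nonneg_pos)
  then have "max x 0 + t \<noteq> 0" for x :: real by (metis less_irrefl)
  then show "continuous_on UNIV (resolvent_test t)"
    unfolding resolvent_test_def[abs_def] by (intro continuous_intros) auto
  have "norm (resolvent_test t x) \<le> 1 / t" for x
    using pos[of x] assms by (simp add: resolvent_test_def frac_le)
  then show "bounded (range (resolvent_test t))" by (auto simp: bounded_iff)
qed

lemma integral_resolvent_test:
  assumes "AE x in m. 0 \<le> x"
    and m: "sets m = sets borel"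
  shows "(\<integral>x. resolvent_test t x \<partial>m) = stieltjes m t"
  unfolding stieltjes_def
proof (rule integral_cong_AE)
  note [measurable_cong] = m
  show "AE x in m. resolvent_test t x = 1 / (x + t)"
    using assms(1) by eventually_elim (simp add: resolvent_test_def max_def)
  show "resolvent_test t \<in> borel_measurable m" unfolding resolvent_test_def[abs_def] by measurable
qed (simp add: measurable_cong_sets[OF m refl])

text \<open>A bounded continuous function that is positive exactly on the negative half-line
  integrates to 0 against every Gram spectral distribution, hence also against the limit.\<close>

lemma AE_nonneg_if_weak_limit_of_gram:
  assumes A: "\<And>N. N \<ge> 1 \<Longrightarrow> A N \<in> carrier_mat N N"
    and m: "prob_space m" "sets m = sets borel"
    and lim: "weakly_converges (\<lambda>N. esd_real (shifted_gram (A N) z)) m"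
  shows "AE x in m. 0 \<le> x"
proof -
  interpret prob_space m by (fact m)
  note [measurable_cong] = m(2)
  let ?f = "\<lambda>x :: real. min 1 (max 0 (- x))"
  have "continuous_on UNIV ?f" by (intro continuous_intros)
  moreover have "bounded (range ?f)" by (auto simp: bounded_iff intro!: exI[of _ 1])
  ultimately have "(\<lambda>N. \<integral>x. ?f x \<partial>esd_real (shifted_gram (A N) z)) \<longlonglongrightarrow> (\<integral>x. ?f x \<partial>m)"
    using lim unfolding weakly_converges_def by blast
  \<comment> \<open>The term N = 0 is left out: the dimension of \<open>A 0\<close> is not
    prescribed and the spectral distribution of an empty matrix is unspecified.\<close>
  moreover have "(\<lambda>N. \<integral>x. ?f x \<partial>esd_real (shifted_gram (A N) z)) \<longlonglongrightarrow> 0"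
    by (rule tendsto_eventually, rule eventually_sequentiallyI[of 1])
       (rule integral_esd_real_negative_part[OF A]; assumption)
  ultimately have "(\<integral>x. ?f x \<partial>m) = 0" by (rule LIMSEQ_unique)
  moreover have "integrable m ?f" by (rule integrable_const_bound[of _ 1]) auto
  ultimately have "AE x in m. ?f x = 0"
    by (subst (asm) integral_nonneg_eq_0_iff_AE) auto
  then show ?thesis by eventually_elim (auto simp: min_def max_def split: if_splits)
qed

text \<open>Letting N tend to \<infinity> at fixed t, with s the almost sure limit of the random
  trace, every error term vanishes, and a times the transform of \<open>\<nu>\<close> at a^2 equals
  \<eta> s.\<close>

lemma (in iid_array) stieltjes_fixed_point:
  fixes A :: "nat \<Rightarrow> complex mat" and \<sigma> t :: real and z :: complex and \<mu> \<nu> :: "real measure"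
  assumes \<sigma>: "\<sigma> > 0" and t: "t > 0"
    and A: "\<And>N. N \<ge> 1 \<Longrightarrow> A N \<in> carrier_mat N N"
    and \<nu>: "prob_space \<nu>" "sets \<nu> = sets borel" "AE x in \<nu>. 0 \<le> x"
    and \<nu>_lim: "weakly_converges (\<lambda>N. esd_real (shifted_gram (A N) z)) \<nu>"
    and \<mu>: "prob_space \<mu>" "sets \<mu> = sets borel" "AE x in \<mu>. 0 \<le> x"
    and \<mu>_lim: "AE \<omega> in P. weakly_converges (\<lambda>N. esd_real (shifted_gram (deformed_mat A \<sigma> X N \<omega>) z)) \<mu>"
  shows "stieltjes \<nu> (t * (1 + \<sigma>\<^sup>2 * stieltjes \<mu> t)\<^sup>2) = stieltjes \<mu> t / (1 + \<sigma>\<^sup>2 * stieltjes \<mu> t)"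
proof -
  define \<eta> where "\<eta> = sqrt t"
  have \<eta>: "\<eta> > 0" "\<eta>\<^sup>2 = t" using t by (auto simp: \<eta>_def)
  define s where "s = stieltjes \<mu> t"
  have s: "s \<ge> 0" unfolding s_def using \<mu>(3) t by (intro stieltjes_nonneg) auto
  define a where "a = \<eta> * (1 + \<sigma>\<^sup>2 * s)"
  have pos: "1 + \<sigma>\<^sup>2 * s > 0" using s by (simp add: add_pos_nonneg)
  have a: "a > 0" unfolding a_def using \<eta> pos by simp
  define \<kappa> where "\<kappa> = 2 * (1 / \<eta> + 1 / \<eta>\<^sup>2 + 1 / (\<eta> * a) + 1 / (\<eta>\<^sup>2 * a))"
  \<comment> \<open>From here on sequences are indexed by n for matrices of size
    \<open>Suc n\<close>, since the estimates divide by the size.\<close>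
  define w where "w = (\<lambda>n i j. A (Suc n) $$ (i, j) - (if i = j then z else 0))"
  define c where "c = (\<lambda>n. \<sigma> / sqrt (real (Suc n)))"
  define g where "g = (\<lambda>n \<omega>. \<integral>x. resolvent_test t x \<partial>esd_real (shifted_gram (deformed_mat A \<sigma> X (Suc n) \<omega>) z))"
  define b where "b = (\<lambda>n. \<integral>x. resolvent_test (a\<^sup>2) x \<partial>esd_real (shifted_gram (A (Suc n)) z))"
  have g_trace: "(\<Sum>i<Suc n. array_resolvent (Suc n) (w n) (c n) \<eta> (\<lambda>i j. X i j \<omega>) i i) =
      \<i> * of_real (\<eta> * real (Suc n) * g n \<omega>)" for n \<omega>
  proof -
    let ?M = "deformed_mat A \<sigma> X (Suc n) \<omega>"
    have An: "A (Suc n) \<in> carrier_mat (Suc n) (Suc n)" by (rule A) simp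
    have M: "?M \<in> carrier_mat (Suc n) (Suc n)"
      using An by (auto simp: deformed_mat_def array_mat_def)
    have "array_resolvent (Suc n) (w n) (c n) \<eta> (\<lambda>i j. X i j \<omega>) =
        resolvent (2 * Suc n) (hermitization (Suc n) (\<lambda>i j. ?M $$ (i, j) - (if i = j then z else 0))) \<eta>"
      unfolding array_resolvent_def
    proof (rule resolvent_cong)
      have "w n i j + of_real (c n) * X i j \<omega> = ?M $$ (i, j) - (if i = j then z else 0)"
        if "i < Suc n" "j < Suc n" for i j
        using that An by (simp add: w_def c_def deformed_mat_def array_mat_def)
      then show "hermitization (Suc n) (\<lambda>i j. w n i j + of_real (c n) * X i j \<omega>) i j =
          hermitization (Suc n) (\<lambda>i j. ?M $$ (i, j) - (if i = j then z else 0)) i j"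
        if "i < 2 * Suc n" "j < 2 * Suc n" for i j
        using that by (auto simp: hermitization_def)
    qed
    then show ?thesis
      using trace_resolvent_hermitization[OF M _ \<eta>(1), of z] by (simp only: g_def \<eta>(2))
  qed
  have b_trace: "(\<Sum>i<Suc n. resolvent (2 * Suc n) (hermitization (Suc n) (w n)) a i i) =
      \<i> * of_real (a * real (Suc n) * b n)" for n
    unfolding w_def b_def by (rule trace_resolvent_hermitization[OF A _ a]) auto
  note est = fixed_point_estimate[OF _ \<sigma> \<eta>(1) s a_def _ \<kappa>_def g_trace b_trace]
  have g_meas [measurable]: "g n \<in> borel_measurable P" for n
    by (rule est(1)) (auto simp: c_def)
  have g_le: "\<bar>g n \<omega>\<bar> \<le> 1 / \<eta>\<^sup>2" for n \<omega>
    by (rule est(2)) (auto simp: c_def)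
  have int_g: "integrable P (g n)" for n
    by (rule integrable_const_bound[of _ "1 / \<eta>\<^sup>2"]) (use g_le in auto)
  have g_lim: "AE \<omega> in P. (\<lambda>n. g n \<omega>) \<longlonglongrightarrow> s"
    using \<mu>_lim
  proof eventually_elim
    case (elim \<omega>)
    then have "(\<lambda>N. \<integral>x. resolvent_test t x \<partial>esd_real (shifted_gram (deformed_mat A \<sigma> X N \<omega>) z))
        \<longlonglongrightarrow> (\<integral>x. resolvent_test t x \<partial>\<mu>)"
      unfolding weakly_converges_def using resolvent_test_bounded_continuous[OF t] by blast
    then show ?case
      unfolding g_def s_def integral_resolvent_test[OF \<mu>(3,2)] by (rule LIMSEQ_Suc)
  qed
  \<comment> \<open>The resolvent bound keeps |g| below 1 / \<eta>^2, so dominated convergence turns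
    the almost sure limit into convergence in mean, which is what the estimate consumes.\<close>
  have gs_lim: "(\<lambda>n. expectation (\<lambda>\<omega>. \<bar>g n \<omega> - s\<bar>)) \<longlonglongrightarrow> 0"
  proof -
    have "(\<lambda>n. expectation (\<lambda>\<omega>. \<bar>g n \<omega> - s\<bar>)) \<longlonglongrightarrow> expectation (\<lambda>\<omega>. 0)"
    proof (rule integral_dominated_convergence)
      show "integrable P (\<lambda>\<omega>. 1 / \<eta>\<^sup>2 + s)" by simp
      show "AE \<omega> in P. (\<lambda>n. \<bar>g n \<omega> - s\<bar>) \<longlonglongrightarrow> 0"
        using g_lim
      proof eventually_elim
        case (elim \<omega>)
        from tendsto_rabs[OF tendsto_diff[OF elim tendsto_const[of s]]] show ?case by simp
      qed
      show "AE \<omega> in P. norm \<bar>g n \<omega> - s\<bar> \<le> 1 / \<eta>\<^sup>2 + s" for n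
      proof (rule AE_I2)
        fix \<omega>
        show "norm \<bar>g n \<omega> - s\<bar> \<le> 1 / \<eta>\<^sup>2 + s" using g_le[of n \<omega>] s by (simp add: abs_le_iff)
      qed
    qed measurable
    then show ?thesis by simp
  qed
  have Eg_lim: "(\<lambda>n. expectation (g n)) \<longlonglongrightarrow> s"
  proof (rule LIM_zero_cancel, rule Lim_null_comparison[OF always_eventually gs_lim], rule allI)
    fix n
    have "norm (expectation (\<lambda>\<omega>. g n \<omega> - s)) \<le> expectation (\<lambda>\<omega>. \<bar>g n \<omega> - s\<bar>)"
      using integral_norm_bound[of P "\<lambda>\<omega>. g n \<omega> - s"] by simp
    then show "norm (expectation (g n) - s) \<le> expectation (\<lambda>\<omega>. \<bar>g n \<omega> - s\<bar>)"
      using int_g by (simp add: prob_space)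
  qed
  have a2: "a\<^sup>2 > 0" using a by simp
  have b_lim: "b \<longlonglongrightarrow> stieltjes \<nu> (a\<^sup>2)"
  proof -
    have "(\<lambda>N. \<integral>x. resolvent_test (a\<^sup>2) x \<partial>esd_real (shifted_gram (A N) z)) \<longlonglongrightarrow> (\<integral>x. resolvent_test (a\<^sup>2) x \<partial>\<nu>)"
      using \<nu>_lim unfolding weakly_converges_def using resolvent_test_bounded_continuous[OF a2] by blast
    then show ?thesis
      unfolding b_def integral_resolvent_test[OF \<nu>(3,2)] by (rule LIMSEQ_Suc)
  qed
  have sqrt_lim: "(\<lambda>n. d / sqrt (real (Suc n))) \<longlonglongrightarrow> 0" for d :: real
    by (rule LIMSEQ_Suc) real_asymp
  have "(\<lambda>n. a * b n - \<eta> * expectation (g n)) \<longlonglongrightarrow> 0"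
  proof (rule Lim_null_comparison[OF always_eventually], rule allI)
    show "norm (a * b n - \<eta> * expectation (g n)) \<le>
      \<sigma>\<^sup>2 * (4 * \<kappa>\<^sup>2 * truncation_error (c n) + \<kappa> / \<eta> / sqrt (real (Suc n)) + \<eta> * \<kappa> * expectation (\<lambda>\<omega>. \<bar>g n \<omega> - s\<bar>))" for n
      using est(3)[of n] by (simp add: c_def)
    have "(\<lambda>n. \<sigma>\<^sup>2 * (4 * \<kappa>\<^sup>2 * truncation_error (c n) + \<kappa> / \<eta> / sqrt (real (Suc n)) + \<eta> * \<kappa> * expectation (\<lambda>\<omega>. \<bar>g n \<omega> - s\<bar>)))
      \<longlonglongrightarrow> \<sigma>\<^sup>2 * (4 * \<kappa>\<^sup>2 * 0 + 0 + \<eta> * \<kappa> * 0)"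
      by (intro tendsto_intros gs_lim sqrt_lim truncation_error_tendsto)
         (use \<sigma> sqrt_lim[of \<sigma>] in \<open>auto simp: c_def\<close>)
    then show "(\<lambda>n. \<sigma>\<^sup>2 * (4 * \<kappa>\<^sup>2 * truncation_error (c n) + \<kappa> / \<eta> / sqrt (real (Suc n)) + \<eta> * \<kappa> * expectation (\<lambda>\<omega>. \<bar>g n \<omega> - s\<bar>)))
      \<longlonglongrightarrow> 0" by simp
  qed
  moreover have "(\<lambda>n. a * b n - \<eta> * expectation (g n)) \<longlonglongrightarrow> a * stieltjes \<nu> (a\<^sup>2) - \<eta> * s"
    by (intro tendsto_intros b_lim Eg_lim)
  \<comment> \<open>Dividing by \<eta> and using a^2 = \<eta>^2 (1 + \<sigma>^2 s)^2 with \<eta>^2 =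
    t gives the stated form.\<close>
  ultimately have "a * stieltjes \<nu> (a\<^sup>2) = \<eta> * s"
    using LIMSEQ_unique by fastforce
  then have "(1 + \<sigma>\<^sup>2 * s) * stieltjes \<nu> (a\<^sup>2) = s"
    using \<eta>(1) by (simp add: a_def)
  then have "stieltjes \<nu> (a\<^sup>2) = s / (1 + \<sigma>\<^sup>2 * s)"
    using pos by (simp add: field_simps)
  moreover have "a\<^sup>2 = t * (1 + \<sigma>\<^sup>2 * s)\<^sup>2" by (simp add: a_def power_mult_distrib \<eta>(2))
  ultimately show ?thesis by (simp add: s_def)
qed

theorem proposition1p2:
  fixes \<sigma> :: real
    and P :: "'w measure"
    and X :: "nat \<Rightarrow> nat \<Rightarrow> 'w \<Rightarrow> complex"
    and A :: "nat \<Rightarrow> complex mat"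
    and \<nu> \<mu> :: "complex \<Rightarrow> real measure"
    and \<beta> :: "complex measure"
    and S :: "complex set"
  assumes sigma_pos: "\<sigma> > 0"
    and prob: "prob_space P"
    and indep: "prob_space.indep_vars P (\<lambda>_. borel) (\<lambda>(i, j). X i j) UNIV"
    and ident: "\<And>i j. distr P borel (X i j) = distr P borel (X 0 0)"
    and mean: "\<And>i j. integrable P (X i j)" "\<And>i j. (\<integral>\<omega>. X i j \<omega> \<partial>P) = 0"
    and var: "\<And>i j. integrable P (\<lambda>\<omega>. (cmod (X i j \<omega>))\<^sup>2)"
      "\<And>i j. (\<integral>\<omega>. (cmod (X i j \<omega>))\<^sup>2 \<partial>P) = 1"
    and A_dim: "\<And>N. N \<ge> 1 \<Longrightarrow> A N \<in> carrier_mat N N"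
    and A_bdd: "\<exists>M>0. \<forall>N\<ge>1. mat_op_norm (A N) \<le> M"
    and nu_prob: "\<And>z. prob_space (\<nu> z)" "\<And>z. sets (\<nu> z) = sets borel"
    and nu_lim: "\<And>z. weakly_converges (\<lambda>N. esd_real (shifted_gram (A N) z)) (\<nu> z)"
    and beta_prob: "prob_space \<beta>" "sets \<beta> = sets borel"
    and beta_lim: "AE \<omega> in P. weakly_converges (\<lambda>N. esd (deformed_mat A \<sigma> X N \<omega>)) \<beta>"
    and mu_prob: "\<And>z. prob_space (\<mu> z)" "\<And>z. sets (\<mu> z) = sets borel"
      "\<And>z. AE l in \<mu> z. 0 \<le> l"
    and mu_lim: "\<And>z. AE \<omega> in P.
      weakly_converges (\<lambda>N. esd_real (shifted_gram (deformed_mat A \<sigma> X N \<omega>) z)) (\<mu> z)"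
    and supp_beta: "measure_support \<beta> = {z. 0 \<in> measure_support (\<mu> z)}"
    and S_eq: "S = {z. 0 \<in> measure_support (\<nu> z)}"
  shows "measure_support \<beta> =
    {z. z \<in> S \<or> (\<integral>\<^sup>+ l. inverse (ennreal l) \<partial>\<nu> z) \<ge> ennreal (1 / \<sigma>\<^sup>2)}"
  proof -
  interpret iid_array P X
    using prob indep ident mean var by (intro iid_array.intro iid_array_axioms.intro)
  have "0 \<in> measure_support (\<mu> z) \<longleftrightarrow>
      z \<in> S \<or> (\<integral>\<^sup>+ l. inverse (ennreal l) \<partial>\<nu> z) \<ge> ennreal (1 / \<sigma>\<^sup>2)" for z
  proof -
    \<comment> \<open>For the deterministic limits, nonnegativity is inherited from the Gram
      matrices; for \<open>\<mu> z\<close> it is part of the hypotheses.\<close>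
    have nonneg: "AE x in \<nu> z. 0 \<le> x"
      by (rule AE_nonneg_if_weak_limit_of_gram[OF A_dim nu_prob nu_lim])
    show ?thesis
      unfolding S_eq mem_Collect_eq
    proof (rule zero_in_support_iff_inverse_moment[OF mu_prob nu_prob nonneg])
      show "stieltjes (\<nu> z) (t * (1 + \<sigma>\<^sup>2 * stieltjes (\<mu> z) t)\<^sup>2) =
          stieltjes (\<mu> z) t / (1 + \<sigma>\<^sup>2 * stieltjes (\<mu> z) t)" if "0 < t" for t
        by (rule stieltjes_fixed_point[OF sigma_pos that A_dim nu_prob nonneg nu_lim mu_prob mu_lim])
    qed (use sigma_pos in simp)
  qed
  then show ?thesis unfolding supp_beta by blast
qed

end
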